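(* Let $u_1,\ldots,u_p\in\mathcal{U}$ be pairwise different, let $X_l=D_lY(u_l)D_{l+1}$ for $1\le l\le p$, and let $B=X_1X_2\cdots X_p$. Then the moments $m_k=\lim_{n\to\infty}\tau_1((BB^* )^k)$, $k\in\mathbb{N}$, of the asymptotic distribution $\mu$ of $BB^*$ under $\tau_1$ are given by $$m_k=d_1^{-1}\sum_{r=1}^{k}P_{k,r}(d_1,d_2,\ldots,d_{p+1})\,T_{k,r}(t_0,t_1,\ldots,t_{r-1}),$$ where $$T_{k,r}(t_0,t_1,\ldots,t_{r-1})=\sum_{i_1+\ldots+i_k=r-1}t_{i_1}t_{i_2}\cdots t_{i_k}$$ (summation over nonnegative integers $i_1,\ldots,i_k$) for any $k,r\in\mathbb{N}$, and the numbers $t_k$ are the coefficients of the $T$-transform $T_{\widetilde\nu}(z)=\sum_{k=0}^\infty t_kz^k$ of $\widetilde\nu=\widetilde\nu_1\boxtimes\ldots\boxtimes\widetilde\nu_p$.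
   Context: **Random matrices.** Fix $p\in\mathbb{N}$. For each $n$ let $n=n_1+\ldots+n_{p+1}$ with natural numbers $n_j$ depending on $n$, such that $d_j=\lim_{n\to\infty}n_j/n>0$ exists for $1\le j\le p+1$. Let $D_j$ be the $n\times n$ diagonal matrix whose only nonzero entries are $(D_j)_{i,i}=1$ for $n_1+\ldots+n_{j-1}<i\le n_1+\ldots+n_j$. Let $\mathbb{E}$ be classical expectation, $\tau(A)=\frac1n\mathbb{E}(\mathrm{Tr}(A))$ for $n\times n$ random matrices, and $\tau_j(A)=\frac1{n_j}\mathbb{E}(\mathrm{Tr}(D_jA))$ the normalized partial traces. Let $\{Y(u):u\in\mathcal{U}\}$ be a family of independent Hermitian $n\times n$ random matrices (dependence on $n$ is suppressed) such that: (A1) the family is asymptotically free under $\tau$; (A2) the family is asymptotically free under $\tau$ against the family of deterministic diagonal matrices; (A3) the norms of the matrices $Y(u)$ are uniformly bounded almost surely. Let $\nu_j$ be the limit distribution of $Y(u_j)$ under $\tau$, with free cumulants $(r_k(u_j))_{k\ge1}$. **Distributions and transforms.** A distribution is a moment sequence (a unital linear functional on $\mathbb{C}[x]$), not necessarily coming from a measure. The combinatorial $R$-series of a distribution with free cumulants $(\kappa_n)$ is $R(z)=\sum_{n\ge1}\kappa_nz^n$. If $\nu$ has free cumulants $(r_n)$, then $\widetilde\nu$ is the distribution with $R_{\widetilde\nu}(z)=\sum_{n=1}^\infty r_{2n}z^n$, i.e. whose $n$-th free cumulant is $r_{2n}$. For a distribution $\mu$ with moments $(m_k)$, $\psi_\mu(z)=\sum_{k\ge1}m_kz^k$;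 the $S$-transform is the formal power series $S_\mu(z)=\frac{z+1}{z}\psi_\mu^{-1}(z)$, where $\psi_\mu^{-1}$ is the compositional inverse (the first moment is nonzero); equivalently $S_\mu(z)=z^{-1}R_\mu^{-1}(z)$ with $R_\mu^{-1}$ the compositional inverse. The $T$-transform is $T_\mu(z)=1/S_\mu(z)$. $\boxtimes$ is free multiplicative convolution, so $S_{\mu\boxtimes\nu}=S_\mu S_\nu$. Transforms are used only for distributions for which they are defined; thus $r_2(u_j)\ne0$ for all $j$ is understood. **Generalized multivariate Fuss-Narayana polynomials.** For $k,r\in\mathbb{N}$, $$P_{k,r}(d_1,\ldots,d_{p+1})=\sum_{j_1+\ldots+j_{p+1}=kp+r}\frac1k\binom{k}{j_1}\cdots\binom{k}{j_{p+1}}d_1^{j_1}\cdots d_{p+1}^{j_{p+1}},$$ summation over nonnegative integers $j_1,\ldots,j_{p+1}$. *)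

theory Defs
  imports
    "HOL-Probability.Probability"
    "HOL-Computational_Algebra.Formal_Power_Series"
    "HOL-Library.Poly_Mapping"
    "Jordan_Normal_Form.Schur_Decomposition"
begin

section \<open>Noncommutative polynomials and freeness\<close>

text \<open>Words form the free monoid, written additively so that finitely supported
  functions on words become the algebra of noncommutative polynomials.\<close>

datatype 'i nc_word = NC_Word (letters: "'i list")

instantiation nc_word :: (type) monoid_add
begin
definition zero_nc_word :: "'a nc_word" where "0 = NC_Word []"
definition plus_nc_word :: "'a nc_word \<Rightarrow> 'a nc_word \<Rightarrow> 'a nc_word"
  where "v + w = NC_Word (letters v @ letters w)"
instance
  by standard (simp_all add: zero_nc_word_def plus_nc_word_def)
end

type_synonym 'i nc_poly = "'i nc_word \<Rightarrow>\<^sub>0 complex"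

text \<open>The unital subalgebra generated by the variables in \<open>S\<close>.\<close>

definition nc_subalg :: "'i set \<Rightarrow> 'i nc_poly set" where
  "nc_subalg S = {P. \<forall>w\<in>Poly_Mapping.keys P. set (letters w) \<subseteq> S}"

text \<open>The linear functional on noncommutative polynomials with prescribed values on words.\<close>

definition lin_ext :: "('i nc_word \<Rightarrow> complex) \<Rightarrow> 'i nc_poly \<Rightarrow> complex" where
  "lin_ext \<phi> P = (\<Sum>w\<in>Poly_Mapping.keys P. Poly_Mapping.lookup P w * \<phi> w)"

definition free_family :: "('a::ring_1 \<Rightarrow> complex) \<Rightarrow> 'g set \<Rightarrow> ('g \<Rightarrow> 'a set) \<Rightarrow> bool" where
  "free_family \<phi> J A \<longleftrightarrow>
     (\<forall>js as. as \<noteq> [] \<longrightarrow> length js = length as \<longrightarrow> set js \<subseteq> J \<longrightarrow> distinct_adj js \<longrightarrow>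
        (\<forall>i<length as. as ! i \<in> A (js ! i) \<and> \<phi> (as ! i) = 0) \<longrightarrow>
        \<phi> (prod_list as) = 0)"


section \<open>Random matrices\<close>

definition random_matrix :: "'w measure \<Rightarrow> nat \<Rightarrow> ('w \<Rightarrow> complex mat) \<Rightarrow> bool" where
  "random_matrix M n A \<longleftrightarrow>
     (\<forall>\<omega>\<in>space M. A \<omega> \<in> carrier_mat n n) \<and>
     (\<forall>i<n. \<forall>j<n. (\<lambda>\<omega>. A \<omega> $$ (i, j)) \<in> borel_measurable M)"

text \<open>Independence of matrices is independence of the families of their entries.\<close>

definition indep_matrices ::
  "'w measure \<Rightarrow> nat \<Rightarrow> ('u \<Rightarrow> 'w \<Rightarrow> complex mat) \<Rightarrow> 'u set \<Rightarrow> bool" where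
  "indep_matrices M n Y U \<longleftrightarrow>
     prob_space.indep_vars M (\<lambda>_. PiM ({..<n} \<times> {..<n}) (\<lambda>_. borel))
       (\<lambda>v \<omega>. \<lambda>ij\<in>{..<n} \<times> {..<n}. Y v \<omega> $$ ij) U"

definition mat_trace :: "complex mat \<Rightarrow> complex" where
  "mat_trace A = (\<Sum>i<dim_row A. A $$ (i, i))"

definition tau :: "'w measure \<Rightarrow> nat \<Rightarrow> ('w \<Rightarrow> complex mat) \<Rightarrow> complex" where
  "tau M n A = (1 / of_nat n) * integral\<^sup>L M (\<lambda>\<omega>. mat_trace (A \<omega>))"

definition partial_tau ::
  "'w measure \<Rightarrow> nat \<Rightarrow> complex mat \<Rightarrow> ('w \<Rightarrow> complex mat) \<Rightarrow> complex" where
  "partial_tau M m D A = (1 / of_nat m) * integral\<^sup>L M (\<lambda>\<omega>. mat_trace (D * A \<omega>))"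

definition mat_prod_list :: "nat \<Rightarrow> complex mat list \<Rightarrow> complex mat" where
  "mat_prod_list n As = foldr (*) As (1\<^sub>m n)"

definition cvec_norm :: "complex vec \<Rightarrow> real" where
  "cvec_norm v = sqrt (\<Sum>i<dim_vec v. (cmod (vec_index v i))\<^sup>2)"

definition op_norm :: "complex mat \<Rightarrow> real" where
  "op_norm A = (SUP v\<in>{v \<in> carrier_vec (dim_col A). cvec_norm v \<le> 1}. cvec_norm (A *\<^sub>v v))"

text \<open>Rows and columns are indexed from 0, so the \<open>j\<close>-th diagonal block (with \<open>j\<close> counted
  from 1) consists of the indices \<open>i\<close> with
  \<open>N 1 + \<dots> + N (j - 1) \<le> i < N 1 + \<dots> + N j\<close>.\<close>

definition block_proj :: "nat \<Rightarrow> (nat \<Rightarrow> nat) \<Rightarrow> nat \<Rightarrow> complex mat" where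
  "block_proj n N j = mat n n (\<lambda>(i, i').
     if i = i' \<and> (\<Sum>l\<in>{1..<j}. N l) \<le> i \<and> i < (\<Sum>l\<in>{1..j}. N l) then 1 else 0)"

text \<open>The sets \<open>{Z i | i \<in> A j}\<close>, for \<open>j \<in> J\<close>, are asymptotically free under the
  functionals \<open>tau\<close>: all joint moments converge, and under the limit functional the
  subalgebras generated by these sets of variables are free.\<close>

definition asymptotically_free ::
  "(nat \<Rightarrow> 'w measure) \<Rightarrow> (nat \<Rightarrow> 'i \<Rightarrow> 'w \<Rightarrow> complex mat) \<Rightarrow> 'g set \<Rightarrow> ('g \<Rightarrow> 'i set) \<Rightarrow> bool" where
  "asymptotically_free M Z J A \<longleftrightarrow>
     (\<exists>\<phi>. (\<forall>w\<in>lists (\<Union>j\<in>J. A j).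
              (\<lambda>n. tau (M n) n (\<lambda>\<omega>. mat_prod_list n (map (\<lambda>i. Z n i \<omega>) w)))
                \<longlonglongrightarrow> \<phi> (NC_Word w)) \<and>
          free_family (lin_ext \<phi>) J (\<lambda>j. nc_subalg (A j)))"


section \<open>Distributions, free cumulants and transforms\<close>

text \<open>A distribution is represented by its moment sequence, with zeroth moment 1.\<close>

type_synonym distr = "nat \<Rightarrow> complex"

definition noncrossing :: "nat set set \<Rightarrow> bool" where
  "noncrossing \<pi> \<longleftrightarrow>
     \<not> (\<exists>V\<in>\<pi>. \<exists>W\<in>\<pi>. V \<noteq> W \<and>
          (\<exists>a\<in>V. \<exists>b\<in>W. \<exists>c\<in>V. \<exists>d\<in>W. a < b \<and> b < c \<and> c < d))"

definition NC :: "nat \<Rightarrow> nat set set set" where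
  "NC n = {\<pi>. partition_on {1..n} \<pi> \<and> noncrossing \<pi>}"

text \<open>The distribution with free cumulants \<open>\<kappa>\<close>, by the moment-cumulant formula. The value
  \<open>\<kappa> 0\<close> is irrelevant, and the zeroth moment is 1 because \<open>NC 0 = {{}}\<close>.\<close>

definition distr_of_cumulants :: "(nat \<Rightarrow> complex) \<Rightarrow> distr" where
  "distr_of_cumulants \<kappa> n = (\<Sum>\<pi>\<in>NC n. \<Prod>V\<in>\<pi>. \<kappa> (card V))"

definition has_free_cumulants :: "distr \<Rightarrow> (nat \<Rightarrow> complex) \<Rightarrow> bool" where
  "has_free_cumulants \<mu> \<kappa> \<longleftrightarrow> \<mu> = distr_of_cumulants \<kappa>"

text \<open>Free multiplicative convolution: the distribution of \<open>a * b\<close>, where \<open>a\<close> (the variable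
  \<open>True\<close>) and \<open>b\<close> (the variable \<open>False\<close>) are free with distributions \<open>\<mu>\<close> and \<open>\<nu>\<close>. For
  moment sequences \<open>\<mu>\<close> and \<open>\<nu>\<close> with zeroth moment 1 such a sequence \<open>\<rho>\<close> exists and is
  unique.\<close>

definition free_mult_conv :: "distr \<Rightarrow> distr \<Rightarrow> distr" where
  "free_mult_conv \<mu> \<nu> = (THE \<rho>. \<exists>\<phi>.
     free_family (lin_ext \<phi>) UNIV (\<lambda>b :: bool. nc_subalg {b}) \<and>
     (\<forall>k. \<phi> (NC_Word (replicate k True)) = \<mu> k) \<and>
     (\<forall>k. \<phi> (NC_Word (replicate k False)) = \<nu> k) \<and>
     (\<forall>k. \<phi> (NC_Word (concat (replicate k [True, False]))) = \<rho> k))"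

definition psi_series :: "distr \<Rightarrow> complex fps" where
  "psi_series \<mu> = Abs_fps (\<lambda>k. if k = 0 then 0 else \<mu> k)"

text \<open>Both are meaningful for distributions with nonzero first moment only. The compositional
  inverse \<open>fps_inv\<close> has zero constant term, so the division by \<open>fps_X\<close> is exact.\<close>

definition S_transform :: "distr \<Rightarrow> complex fps" where
  "S_transform \<mu> = ((fps_X + 1) * fps_inv (psi_series \<mu>)) / fps_X"

definition T_transform :: "distr \<Rightarrow> complex fps" where
  "T_transform \<mu> = inverse (S_transform \<mu>)"


section \<open>Generalized multivariate Fuss-Narayana polynomials\<close>

text \<open>\<open>natpermute m k\<close> is the set of lists of \<open>k\<close> natural numbers with sum \<open>m\<close>. The list
  \<open>js\<close> is indexed from 0, the variables \<open>d\<close> from 1.\<close>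

definition fuss_narayana :: "nat \<Rightarrow> nat \<Rightarrow> nat \<Rightarrow> (nat \<Rightarrow> real) \<Rightarrow> real" where
  "fuss_narayana p k r d =
     (\<Sum>js\<in>natpermute (k * p + r) (p + 1).
        1 / real k * (\<Prod>i<p + 1. real (k choose (js ! i))) * (\<Prod>i<p + 1. d (i + 1) ^ (js ! i)))"

definition T_coeff :: "nat \<Rightarrow> nat \<Rightarrow> (nat \<Rightarrow> complex) \<Rightarrow> complex" where
  "T_coeff k r t = (\<Sum>ls\<in>natpermute (r - 1) k. prod_list (map t ls))"

end

theory Submission
  imports Defs
begin

text \<open>
  Let \<open>\<phi>\<close> be the limit of the states \<open>\<tau>\<close> on polynomials in the variables \<open>y\<^sub>l\<close> (for \<open>Y(u\<^sub>l)\<close>) and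
  \<open>D\<^sub>j\<close>. It is a trace, the \<open>D\<^sub>j\<close> behave like orthogonal projections, and \<open>d\<^sub>1 m\<^sub>k\<close> is the value of
  \<open>\<phi>\<close> at the word of \<open>D\<^sub>1 (B B\<^sup>*)\<^sup>k\<close>. Such a word is a closed walk on the path with vertices
  \<open>1, \<dots>, p + 1\<close>: the letter \<open>D\<^sub>j\<close> stands for a visit of the vertex \<open>j\<close>, the letter \<open>y\<^sub>l\<close> for a step
  along the edge between \<open>l\<close> and \<open>l + 1\<close>, and each factor \<open>B B\<^sup>*\<close> goes from \<open>1\<close> up to \<open>p + 1\<close> and
  back.

  Freeness enters only through the Schwinger-Dyson equation (\<open>schwinger_dyson\<close>): if \<open>y\<close> is free
  from the other variables and has free cumulants \<open>\<kappa>\<close>, then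
  \<open>\<phi>(y w) = \<Sum> \<kappa>\<^sub>s \<phi>(q\<^sub>1) \<dots> \<phi>(q\<^sub>s)\<close>, the sum over all factorizations \<open>w = q\<^sub>1 y q\<^sub>2 y \<dots> y q\<^sub>s\<close>. This is
  the moment-cumulant formula organized by the block of the first \<open>y\<close>; the factors \<open>q\<^sub>i\<close> may again
  contain \<open>y\<close>. Both sides are linear in \<open>w\<close>, so it is enough to compare them on alternating
  products of centered elements, where they vanish for trivial reasons.

  For \<open>y\<^sub>l\<close> and a walk, \<open>\<phi>(q\<^sub>i) = 0\<close> unless \<open>q\<^sub>i\<close> starts and ends at the same vertex, since
  \<open>D\<^sub>l D\<^bsub>l+1\<^esub> = 0\<close>. Hence the \<open>q\<^sub>i\<close> lie alternately above and below the edge, their number is even, and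
  only the cumulants \<open>r\<^bsub>2s\<^esub>(u\<^sub>l)\<close> occur, that is, those of \<open>\<nu>\<^sub>l\<close> with a tilde. Let \<open>M\<close> be the generating
  series of \<open>\<phi>((B B\<^sup>*)\<^sup>k)\<close> for \<open>k \<ge> 1\<close>, let \<open>A\<^sub>l\<close> and \<open>B\<^sub>l\<close> be those of the walks at \<open>l\<close> that begin and
  end with an upward, respectively a downward, excursion, and let \<open>R\<^sub>l\<close> be the R-series of \<open>\<nu>\<^sub>l\<close> with a
  tilde. Summing the Schwinger-Dyson equations gives
  \<open>M = R\<^sub>l(z A\<^bsub>l+1\<^esub> B\<^sub>l)\<close> for every edge (\<open>moment_series_eq\<close>) and \<open>z A\<^sub>l B\<^sub>l = M (d\<^sub>l + M)\<close> for
  every inner vertex (\<open>up_series_down_series\<close>), with \<open>A\<^bsub>p+1\<^esub> = d\<^bsub>p+1\<^esub> + M\<close> and \<open>B\<^sub>1 = d\<^sub>1 + M\<close> at the ends.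
  As \<open>z S\<^sub>l(z)\<close> is the inverse of \<open>R\<^sub>l\<close>, multiplying over all edges makes the \<open>A\<^sub>l\<close> and \<open>B\<^sub>l\<close> disappear:
  \<open>M \<Prod>\<^sub>l S\<^sub>l(M) = z \<Prod>\<^sub>j (d\<^sub>j + M)\<close> (\<open>moment_equation\<close>).

  The S-transform turns free multiplicative convolution into a product
  (\<open>free_mult_conv_S_transform\<close>); this follows from the Schwinger-Dyson equations of two free
  variables by the same elimination. Therefore \<open>M = z T(M) \<Prod>\<^sub>j (d\<^sub>j + M)\<close>, and Lagrange inversion
  yields \<open>k [z\<^sup>k] M = [x\<^bsup>k-1\<^esup>] T(x)\<^sup>k \<Prod>\<^sub>j (d\<^sub>j + x)\<^sup>k\<close>. The coefficients of the product over \<open>j\<close> are the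
  Fuss-Narayana polynomials and those of \<open>T(x)\<^sup>k\<close> are the numbers \<open>T\<^bsub>k,r\<^esub>\<close>.
\<close>

section \<open>Formal power series\<close>

text \<open>Iterating the recursion gives the geometric series \<open>\<Sum>\<^sub>j \<kappa> (s + j) E (z F)\<^sup>j\<close>; nothing remains in the
  limit because each step gains a factor \<open>z\<close>.\<close>

lemma fps_geometric_unfold:
  fixes F :: "complex fps" and \<kappa> :: "nat \<Rightarrow> complex"
  assumes X: "\<And>s. X s = fps_const (\<kappa> s) * E + fps_X * F * X (Suc s)"
  shows "X s = E * (Abs_fps (\<lambda>j. \<kappa> (s + j)) oo (fps_X * F))"
proof -
  define Z where "Z s = E * (Abs_fps (\<lambda>j. \<kappa> (s + j)) oo (fps_X * F))" for s
  have Z: "Z s = fps_const (\<kappa> s) * E + fps_X * F * Z (Suc s)" for s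
  proof -
    have eq: "Abs_fps (\<lambda>j. \<kappa> (s + j))
        = fps_const (\<kappa> s) + fps_X * Abs_fps (\<lambda>j. \<kappa> (Suc s + j))"
      by (rule fps_ext) (auto simp: fps_X_mult_nth)
    have "Abs_fps (\<lambda>j. \<kappa> (s + j)) oo (fps_X * F)
        = fps_const (\<kappa> s) + fps_X * F * (Abs_fps (\<lambda>j. \<kappa> (Suc s + j)) oo (fps_X * F))"
      unfolding eq by (simp add: fps_compose_add_distrib fps_compose_mult_distrib)
    then show ?thesis
      unfolding Z_def by (simp add: algebra_simps)
  qed
  have "fps_nth (X s) n = fps_nth (Z s) n" for n
  proof (induction n arbitrary: s rule: less_induct)
    case (less n)
    have "fps_nth (fps_X * (F * X (Suc s))) n = fps_nth (fps_X * (F * Z (Suc s))) n"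
    proof (cases n)
      case (Suc m)
      then show ?thesis
        using less by (auto simp: fps_mult_nth intro!: sum.cong)
    qed simp
    then show ?case
      by (subst X, subst Z) (simp add: mult.assoc)
  qed
  then show ?thesis
    unfolding Z_def by (simp add: fps_eq_iff)
qed

text \<open>\<open>A = X / G\<close> is the compositional inverse of \<open>M\<close>. Differentiating \<open>M(A) = X\<close> and multiplying by
  \<open>G\<^sup>k\<close> gives \<open>G\<^sup>k = \<Sum>\<^sub>n n M\<^sub>n A\<^bsup>n-1\<^esup> A' G\<^sup>k\<close>. In degree \<open>k - 1\<close> only \<open>n = k\<close> survives: the other terms
  are, up to a shift, \<open>G\<^sup>m - X G' G\<^bsup>m-1\<^esup> = G\<^sup>m - X (G\<^sup>m)' / m\<close> with \<open>m = k - n\<close>, whose coefficient of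
  degree \<open>m\<close> is zero.\<close>

lemma lagrange_inversion:
  fixes M G :: "complex fps"
  assumes G0: "fps_nth G 0 \<noteq> 0" and M: "M = fps_X * (G oo M)" and k: "k \<ge> 1"
  shows "of_nat k * fps_nth M k = fps_nth (G ^ k) (k - 1)"
proof -
  have M0: "fps_nth M 0 = 0"
    by (subst M) simp
  define A where "A = fps_X * inverse G"
  have A0: "fps_nth A 0 = 0" and A1: "fps_nth A 1 \<noteq> 0"
    using G0 by (auto simp: A_def)
  have "A oo M = M * inverse (G oo M)"
    unfolding A_def using M0 G0
    by (simp add: fps_compose_mult_distrib fps_inverse_compose)
  also have "\<dots> = fps_X * ((G oo M) * inverse (G oo M))"
    by (subst (1) M) (simp add: mult_ac)
  also have "(G oo M) * inverse (G oo M) = 1"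
    using G0 by (metis fps_compose_nth_0 inverse_mult_eq_1 mult.commute)
  finally have AM: "A oo M = fps_X" by simp
  have M1: "fps_nth M 1 \<noteq> 0"
  proof -
    have "fps_nth M 1 = fps_nth G 0"
      by (subst M) simp
    then show ?thesis using G0 by simp
  qed
  have "M = fps_inv A oo (A oo M)"
    by (subst fps_compose_assoc) (use A0 A1 M0 in \<open>simp_all add: fps_inv\<close>)
  then have "M = fps_inv A"
    using AM by simp
  then have MA: "M oo A = fps_X"
    using fps_inv A0 A1 by blast
  have "fps_deriv (M oo A) = (fps_deriv M oo A) * fps_deriv A"
    using A0 by (simp add: fps_compose_deriv)
  then have dMA: "(fps_deriv M oo A) * fps_deriv A = 1"
    using MA by simp
  have dA: "fps_deriv A = inverse G - fps_X * fps_deriv G * inverse G ^ 2"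
    unfolding A_def using G0 by (simp add: fps_inverse_deriv power2_eq_square algebra_simps)
  have GG: "G * inverse G = 1"
    using G0 by (metis inverse_mult_eq_1 mult.commute)
  obtain q where q: "k = Suc q" using k by (cases k) auto
  \<comment> \<open>Only the term with \<open>n + 1 = k\<close> contributes to the coefficient.\<close>
  have coeff: "fps_nth (A ^ n * (fps_deriv A * G ^ k)) q = (if n = q then 1 else 0)" (is "?L n = _") for n
  proof (cases "n \<le> q")
    case False
    then show ?thesis
      by (auto simp: A_def power_mult_distrib mult.assoc fps_X_power_mult_nth)
  next
    case True
    define m where "m = q - n"
    have ring: "(X * P) ^ n * ((P - X * D * P ^ 2) * (Q ^ n * (Q * Q ^ m)))
        = X ^ n * ((Q * P) ^ n * ((Q * P) * Q ^ m) - X * D * ((Q * P) ^ n * ((Q * P) * P * Q ^ m)))"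
      for X P Q D :: "complex fps"
      by (simp add: power_mult_distrib power2_eq_square algebra_simps)
    have "A ^ n * (fps_deriv A * G ^ k)
        = fps_X ^ n * ((G * inverse G) ^ n * ((G * inverse G) * G ^ m)
           - fps_X * fps_deriv G * ((G * inverse G) ^ n * ((G * inverse G) * inverse G * G ^ m)))"
    proof -
      have "G ^ k = G ^ n * (G * G ^ m)"
        unfolding m_def q using True by (simp flip: power_Suc power_add)
      then show ?thesis
        unfolding dA by (simp add: A_def power_mult_distrib power2_eq_square algebra_simps)
    qed
    also have "\<dots> = fps_X ^ n * (G ^ m - fps_X * (fps_deriv G * (inverse G * G ^ m)))"
      by (simp add: GG mult.assoc)
    finally have eq: "?L n = fps_nth (G ^ m - fps_X * (fps_deriv G * (inverse G * G ^ m))) m"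
      using True by (simp add: fps_X_power_mult_nth m_def)
    show ?thesis
    proof (cases "n = q")
      case True
      then show ?thesis
        unfolding eq by (simp add: m_def)
    next
      case False
      then obtain l where l: "m = Suc l"
        using True unfolding m_def by (cases "q - n") auto
      have inv: "inverse G * G ^ m = G ^ l"
        unfolding l power_Suc mult.assoc[symmetric] mult.commute[of "inverse G" G] GG by simp
      have "fps_deriv (G ^ m) = fps_const (of_nat m) * (fps_deriv G * G ^ l)"
        by (subst fps_deriv_power) (simp add: l mult.assoc del: of_nat_Suc)
      then have "fps_nth (fps_deriv (G ^ m)) l = of_nat m * fps_nth (fps_deriv G * G ^ l) l"
        by (simp only: fps_mult_left_const_nth)
      moreover have "fps_nth (fps_deriv (G ^ m)) l = of_nat m * fps_nth (G ^ m) m"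
        by (simp only: fps_deriv_nth l Suc_eq_plus1)
      ultimately have "fps_nth (G ^ m) m = fps_nth (fps_deriv G * G ^ l) l"
        using of_nat_neq_0[of l, where ?'a = complex] by (simp only: l mult_cancel_left) metis
      then show ?thesis
        unfolding eq inv using False by (simp add: l del: power_Suc)
    qed
  qed
  have "fps_nth (G ^ k) q = fps_nth ((fps_deriv M oo A) * (fps_deriv A * G ^ k)) q"
    by (simp add: mult.assoc[symmetric] dMA)
  also have "\<dots> = (\<Sum>i\<le>q. fps_nth (fps_deriv M oo A) i * fps_nth (fps_deriv A * G ^ k) (q - i))"
    by (simp add: fps_mult_nth atLeast0AtMost)
  also have "\<dots> = (\<Sum>i\<le>q. (\<Sum>n\<le>q. fps_nth (fps_deriv M) n * fps_nth (A ^ n) i) * fps_nth (fps_deriv A * G ^ k) (q - i))"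
  proof (rule sum.cong[OF refl])
    fix i assume i: "i \<in> {..q}"
    have "fps_nth (fps_deriv M oo A) i = (\<Sum>n=0..i. fps_nth (fps_deriv M) n * fps_nth (A ^ n) i)"
      by (simp add: fps_compose_nth)
    also have "\<dots> = (\<Sum>n\<le>q. fps_nth (fps_deriv M) n * fps_nth (A ^ n) i)"
      using i A0 by (intro sum.mono_neutral_left) (auto simp: startsby_zero_power_prefix)
    finally show "fps_nth (fps_deriv M oo A) i * fps_nth (fps_deriv A * G ^ k) (q - i)
      = (\<Sum>n\<le>q. fps_nth (fps_deriv M) n * fps_nth (A ^ n) i) * fps_nth (fps_deriv A * G ^ k) (q - i)"
      by simp
  qed
  also have "\<dots> = (\<Sum>n\<le>q. fps_nth (fps_deriv M) n * ?L n)"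
    by (simp add: sum_distrib_right sum_distrib_left fps_mult_nth[of "A ^ _"] atLeast0AtMost mult.assoc)
       (rule sum.swap)
  also have "\<dots> = fps_nth (fps_deriv M) q"
    by (simp add: coeff if_distrib cong: if_cong)
  finally show ?thesis
    by (simp add: q)
qed

lemma prod_list_map_nth: "prod_list (map f xs) = (\<Prod>i<length xs. f (xs ! i))"
  by (induction xs rule: rev_induct) (auto simp: nth_append)

lemma fps_power_nth_natpermute:
  fixes F :: "'a::comm_ring_1 fps"
  assumes "k \<ge> 1"
  shows "fps_nth (F ^ k) n = (\<Sum>ls\<in>natpermute n k. prod_list (map (fps_nth F) ls))"
proof -
  have "fps_nth (F ^ k) n = (\<Sum>ls\<in>natpermute n k. \<Prod>i\<in>{0..k - 1}. fps_nth F (ls ! i))"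
    using assms by (simp add: fps_power_nth)
  also have "{0..k - 1} = {..<k}"
    using assms by auto
  finally show ?thesis
    by (simp add: prod_list_map_nth natpermute_def)
qed

lemma natpermute_nth_sum: "js \<in> natpermute n k \<Longrightarrow> (\<Sum>i<k. js ! i) = n"
  by (auto simp: natpermute_def sum_list_sum_nth atLeast0LessThan)

lemma binomial_power_coeff:
  "fps_nth ((fps_const c + fps_X) ^ k) j = of_nat (k choose j) * c ^ (k - j)" for c :: complex
proof -
  have "(fps_const c + fps_X) ^ k = (\<Sum>i\<le>k. of_nat (k choose i) * fps_X ^ i * fps_const c ^ (k - i))"
    by (subst add.commute) (rule binomial_ring)
  also have "\<dots> = (\<Sum>i\<le>k. fps_const (of_nat (k choose i) * c ^ (k - i)) * fps_X ^ i)"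
    by (simp add: fps_of_nat[symmetric] mult_ac)
  finally have "fps_nth ((fps_const c + fps_X) ^ k) j
     = (\<Sum>i\<le>k. of_nat (k choose i) * c ^ (k - i) * (if j = i then 1 else 0))"
    by (simp only: fps_sum_nth fps_mult_left_const_nth fps_X_power_nth)
  also have "\<dots> = (\<Sum>i\<in>{..k} \<inter> {j}. of_nat (k choose i) * c ^ (k - i))"
    by (intro sum.mono_neutral_cong_right) auto
  also have "\<dots> = of_nat (k choose j) * c ^ (k - j)"
    by (cases "j \<le> k") auto
  finally show ?thesis .
qed

text \<open>Replacing every exponent \<open>j\<close> by \<open>k - j\<close> turns \<open>\<Prod>\<^sub>i (1 + d\<^sub>i x)\<^sup>k\<close> into \<open>\<Prod>\<^sub>i (d\<^sub>i + x)\<^sup>k\<close> and the total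
  degree \<open>k p + s\<close> into \<open>k - s\<close>.\<close>

lemma fuss_narayana_coeff:
  fixes d :: "nat \<Rightarrow> real"
  assumes k: "k \<ge> 1" and s: "s \<le> k"
  shows "of_nat k * complex_of_real (fuss_narayana p k s d)
    = fps_nth ((\<Prod>i<p + 1. fps_const (complex_of_real (d (i + 1))) + fps_X) ^ k) (k - s)"
proof -
  let ?a = "\<lambda>i. (fps_const (complex_of_real (d (i + 1))) + fps_X) ^ k"
  let ?g = "\<lambda>js. \<Prod>i<p + 1. of_nat (k choose (js ! i)) * complex_of_real (d (i + 1)) ^ (js ! i)"
  let ?h = "\<lambda>js. \<Prod>i<p + 1. of_nat (k choose (js ! i)) * complex_of_real (d (i + 1)) ^ (k - js ! i)"
  let ?L = "\<lambda>n. {js \<in> natpermute n (p + 1). \<forall>i<p + 1. js ! i \<le> k}"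
  let ?r = "map (\<lambda>j. k - j) :: nat list \<Rightarrow> nat list"
  have "of_nat k * complex_of_real (fuss_narayana p k s d) = (\<Sum>js\<in>natpermute (k * p + s) (p + 1). ?g js)"
    unfolding fuss_narayana_def using k
    by (simp add: sum_distrib_left prod.distrib del: prod.lessThan_Suc)
  also have "\<dots> = (\<Sum>js\<in>?L (k * p + s). ?g js)"
    by (rule sum.mono_neutral_right) (auto simp: natpermute_finite not_le simp del: prod.lessThan_Suc)
  also have "\<dots> = (\<Sum>js\<in>?L (k - s). ?h js)"
  proof (rule sum.reindex_bij_witness[of _ ?r ?r])
    have flip: "?r (?r js) = js" "?r js \<in> ?L m" "\<And>i. i < p + 1 \<Longrightarrow> ?r js ! i = k - js ! i"
      if js: "js \<in> ?L n" and mn: "m + n = k * (p + 1)" for js n m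
    proof -
      have len: "length js = p + 1" and sum: "(\<Sum>i<p + 1. js ! i) = n" and le: "\<And>i. i < p + 1 \<Longrightarrow> js ! i \<le> k"
        using js natpermute_nth_sum[of js n "p + 1"] by (auto simp: natpermute_def)
      have "sum_list (?r js) = (\<Sum>i<p + 1. k - js ! i)"
        by (simp add: sum_list_sum_nth len atLeast0LessThan del: sum.lessThan_Suc)
      also have "\<dots> = (\<Sum>i<p + 1. k) - (\<Sum>i<p + 1. js ! i)"
        by (rule sum_subtractf_nat) (use le in auto)
      also have "\<dots> = m"
        unfolding sum using mn by (simp add: algebra_simps)
      finally show "?r js \<in> ?L m"
        using len by (auto simp: natpermute_def)
      show "?r (?r js) = js"
        using le len by (intro nth_equalityI) auto
      show "\<And>i. i < p + 1 \<Longrightarrow> ?r js ! i = k - js ! i"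
        using len by auto
    qed
    have e1: "(k - s) + (k * p + s) = k * (p + 1)" and e2: "(k * p + s) + (k - s) = k * (p + 1)"
      using s by (auto simp: algebra_simps)
    fix js
    show "js \<in> ?L (k * p + s) \<Longrightarrow> ?r (?r js) = js" "js \<in> ?L (k * p + s) \<Longrightarrow> ?r js \<in> ?L (k - s)"
      using flip[OF _ e1] by blast+
    show "js \<in> ?L (k - s) \<Longrightarrow> ?r (?r js) = js" "js \<in> ?L (k - s) \<Longrightarrow> ?r js \<in> ?L (k * p + s)"
      using flip[OF _ e2] by blast+
    assume js: "js \<in> ?L (k * p + s)"
    have le: "\<And>i. i < p + 1 \<Longrightarrow> js ! i \<le> k" using js by auto
    show "?h (?r js) = ?g js"
    proof (rule prod.cong[OF refl])
      fix i assume "i \<in> {..<p + 1}"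
      then have i: "i < p + 1" by simp
      show "of_nat (k choose (?r js ! i)) * complex_of_real (d (i + 1)) ^ (k - ?r js ! i)
        = of_nat (k choose (js ! i)) * complex_of_real (d (i + 1)) ^ (js ! i)"
        using flip(3)[OF js e1 i] le[OF i] by (simp add: binomial_symmetric[of "js ! i" k])
    qed
  qed
  also have "\<dots> = (\<Sum>js\<in>natpermute (k - s) (p + 1). ?h js)"
    by (rule sum.mono_neutral_left) (auto simp: natpermute_finite not_le simp del: prod.lessThan_Suc)
  also have "\<dots> = (\<Sum>js\<in>natpermute (k - s) (p + 1). \<Prod>j\<in>{0..p}. fps_nth (?a j) (js ! j))"
    by (simp add: binomial_power_coeff lessThan_Suc_atMost atLeast0AtMost del: prod.lessThan_Suc)
  also have "\<dots> = fps_nth (\<Prod>i<p + 1. ?a i) (k - s)"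
    using fps_prod_nth[of "?a" p "k - s"] by (simp add: lessThan_Suc_atMost atLeast0AtMost del: prod.lessThan_Suc)
  finally show ?thesis
    by (simp add: prod_power_distrib del: prod.lessThan_Suc)
qed

lemma coeff_of_functional_equation:
  fixes M T :: "complex fps" and d :: "nat \<Rightarrow> real"
  assumes M: "M = fps_X * (((\<Prod>i<p + 1. fps_const (complex_of_real (d (i + 1))) + fps_X) * T) oo M)"
    and T0: "fps_nth T 0 \<noteq> 0" and d: "\<And>i. i \<in> {1..p + 1} \<Longrightarrow> d i > 0" and k: "k \<ge> 1"
  shows "fps_nth M k = (\<Sum>s = 1..k. of_real (fuss_narayana p k s d) * T_coeff k s (fps_nth T))"
proof -
  let ?P = "\<Prod>i<p + 1. fps_const (complex_of_real (d (i + 1))) + fps_X"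
  have P0: "fps_nth ?P 0 \<noteq> 0"
  proof -
    have "fps_nth ?P 0 = (\<Prod>i<p + 1. complex_of_real (d (i + 1)))"
      by (induction p) simp_all
    also have "\<dots> \<noteq> 0"
    proof -
      have "complex_of_real (d (i + 1)) \<noteq> 0" if "i < p + 1" for i
        using d[of "i + 1"] that by simp
      then show ?thesis by (subst prod_zero_iff) auto
    qed
    finally show ?thesis .
  qed
  have "of_nat k * fps_nth M k = fps_nth ((?P * T) ^ k) (k - 1)"
    by (rule lagrange_inversion[OF _ M k]) (use P0 T0 in \<open>simp del: prod.lessThan_Suc\<close>)
  also have "\<dots> = (\<Sum>i=0..k - 1. fps_nth (?P ^ k) (k - 1 - i) * fps_nth (T ^ k) i)"
    unfolding power_mult_distrib mult.commute[of "?P ^ k" "T ^ k"] fps_mult_nth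
    by (intro sum.cong refl mult.commute)
  also have "\<dots> = (\<Sum>s = 1..k. fps_nth (?P ^ k) (k - s) * fps_nth (T ^ k) (s - 1))"
    by (rule sum.reindex_bij_witness[of _ "\<lambda>s. s - 1" Suc]) (use k in auto)
  also have "\<dots> = (\<Sum>s = 1..k. of_nat k * of_real (fuss_narayana p k s d) * T_coeff k s (fps_nth T))"
    by (rule sum.cong[OF refl])
       (use k in \<open>simp add: fuss_narayana_coeff T_coeff_def fps_power_nth_natpermute del: prod.lessThan_Suc\<close>)
  finally show ?thesis
    using k by (simp add: sum_distrib_left[symmetric] mult.assoc)
qed

section \<open>Noncrossing partitions and free cumulants\<close>

definition noncrossing_partitions :: "nat set \<Rightarrow> nat set set set" where
  "noncrossing_partitions S = {\<pi>. partition_on S \<pi> \<and> noncrossing \<pi>}"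

lemma NC_eq: "NC n = noncrossing_partitions {1..n}"
  by (simp add: NC_def noncrossing_partitions_def)

lemma noncrossing_partitionsD:
  assumes "\<pi> \<in> noncrossing_partitions S"
  shows "\<Union>\<pi> = S" "{} \<notin> \<pi>" "\<And>V W x. V \<in> \<pi> \<Longrightarrow> W \<in> \<pi> \<Longrightarrow> x \<in> V \<Longrightarrow> x \<in> W \<Longrightarrow> V = W"
    "\<And>V W a b c d. V \<in> \<pi> \<Longrightarrow> W \<in> \<pi> \<Longrightarrow> V \<noteq> W \<Longrightarrow> a \<in> V \<Longrightarrow> b \<in> W \<Longrightarrow> c \<in> V \<Longrightarrow> d \<in> W
       \<Longrightarrow> a < b \<Longrightarrow> b < c \<Longrightarrow> c < d \<Longrightarrow> False"
proof -
  have P: "partition_on S \<pi>" and N: "noncrossing \<pi>"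
    using assms by (auto simp: noncrossing_partitions_def)
  show "\<Union>\<pi> = S" "{} \<notin> \<pi>"
    using P by (auto simp: partition_on_def)
  show "\<And>V W x. V \<in> \<pi> \<Longrightarrow> W \<in> \<pi> \<Longrightarrow> x \<in> V \<Longrightarrow> x \<in> W \<Longrightarrow> V = W"
    using partition_onD2[OF P] by (meson disjointD disjoint_iff)
  show "\<And>V W a b c d. V \<in> \<pi> \<Longrightarrow> W \<in> \<pi> \<Longrightarrow> V \<noteq> W \<Longrightarrow> a \<in> V \<Longrightarrow> b \<in> W \<Longrightarrow> c \<in> V \<Longrightarrow> d \<in> W
       \<Longrightarrow> a < b \<Longrightarrow> b < c \<Longrightarrow> c < d \<Longrightarrow> False"
    using N unfolding noncrossing_def by meson
qed

lemma noncrossing_partitionsI: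
  assumes "\<Union>\<pi> = S" "{} \<notin> \<pi>" "\<And>V W x. V \<in> \<pi> \<Longrightarrow> W \<in> \<pi> \<Longrightarrow> x \<in> V \<Longrightarrow> x \<in> W \<Longrightarrow> V = W"
    "\<And>V W a b c d. V \<in> \<pi> \<Longrightarrow> W \<in> \<pi> \<Longrightarrow> V \<noteq> W \<Longrightarrow> a \<in> V \<Longrightarrow> b \<in> W \<Longrightarrow> c \<in> V \<Longrightarrow> d \<in> W
       \<Longrightarrow> a < b \<Longrightarrow> b < c \<Longrightarrow> c < d \<Longrightarrow> False"
  shows "\<pi> \<in> noncrossing_partitions S"
proof -
  have "disjoint \<pi>"
    using assms(3) by (intro disjointI) blast
  moreover have "noncrossing \<pi>"
    unfolding noncrossing_def using assms(4) by meson
  ultimately show ?thesis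
    using assms(1,2) by (simp add: noncrossing_partitions_def partition_on_def)
qed

lemma noncrossing_partitions_subset:
  assumes "\<pi> \<in> noncrossing_partitions S" "\<sigma> \<subseteq> \<pi>" "\<Union>\<sigma> = S'"
  shows "\<sigma> \<in> noncrossing_partitions S'"
proof (rule noncrossing_partitionsI[OF assms(3)])
  note D = noncrossing_partitionsD[OF assms(1)]
  show "{} \<notin> \<sigma>" using D(2) assms(2) by blast
  fix V W assume "V \<in> \<sigma>" "W \<in> \<sigma>"
  then have VW: "V \<in> \<pi>" "W \<in> \<pi>" using assms(2) by auto
  show "V = W" if "x \<in> V" "x \<in> W" for x by (rule D(3)[OF VW that])
  show False if "V \<noteq> W" "a \<in> V" "b \<in> W" "c \<in> V" "d \<in> W" "a < b" "b < c" "c < d" for a b c d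
    by (rule D(4)[OF VW that])
qed

lemma noncrossing_partitions_finite:
  assumes "finite S"
  shows "finite (noncrossing_partitions S)" "\<pi> \<in> noncrossing_partitions S \<Longrightarrow> finite \<pi>"
    "\<pi> \<in> noncrossing_partitions S \<Longrightarrow> V \<in> \<pi> \<Longrightarrow> finite V"
proof -
  have sub: "\<pi> \<subseteq> Pow S" if "\<pi> \<in> noncrossing_partitions S" for \<pi>
    using noncrossing_partitionsD(1)[OF that] by blast
  show "finite (noncrossing_partitions S)"
    by (rule finite_subset[of _ "Pow (Pow S)"]) (use sub assms in auto)
  show "\<pi> \<in> noncrossing_partitions S \<Longrightarrow> finite \<pi>"
    using sub assms by (meson finite_Pow_iff rev_finite_subset)
  show "\<pi> \<in> noncrossing_partitions S \<Longrightarrow> V \<in> \<pi> \<Longrightarrow> finite V"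
    using sub assms by (meson PowD rev_finite_subset subsetD)
qed

text \<open>Used to move partitions of an interval to an interval of the form \<open>{1..n}\<close>.\<close>

lemma noncrossing_partitions_image:
  assumes \<pi>: "\<pi> \<in> noncrossing_partitions S" and f: "strict_mono_on S f"
  shows "image f ` \<pi> \<in> noncrossing_partitions (f ` S)"
proof (rule noncrossing_partitionsI)
  note D = noncrossing_partitionsD[OF \<pi>]
  have inj: "inj_on f S"
    using f strict_mono_on_imp_inj_on by blast
  show "\<Union> (image f ` \<pi>) = f ` S" unfolding D(1)[symmetric] by (rule image_Union[symmetric])
  show "{} \<notin> image f ` \<pi>" using D(2) by (auto simp: image_iff)
  fix V' W' assume "V' \<in> image f ` \<pi>" "W' \<in> image f ` \<pi>"
  then obtain V W where V: "V \<in> \<pi>" "V' = f ` V" and W: "W \<in> \<pi>" "W' = f ` W" by blast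
  have sub: "V \<subseteq> S" "W \<subseteq> S" using V W D(1) by blast+
  show "V' = W'" if x: "x \<in> V'" "x \<in> W'" for x
  proof -
    obtain v w where vw: "x = f v" "x = f w" "v \<in> V" "w \<in> W"
      using x V W by blast
    then have "v = w" using inj sub by (metis inj_onD subsetD)
    then show ?thesis using vw D(3) V W by blast
  qed
  have less: "f x < f y \<longleftrightarrow> x < y" if "x \<in> S" "y \<in> S" for x y
    using that f strict_mono_on_less by blast
  fix a b c d assume *: "V' \<noteq> W'" "a \<in> V'" "b \<in> W'" "c \<in> V'" "d \<in> W'" "a < b" "b < c" "c < d"
  then obtain a' b' c' d' where p: "a' \<in> V" "b' \<in> W" "c' \<in> V" "d' \<in> W"
    and eq: "a = f a'" "b = f b'" "c = f c'" "d = f d'"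
    unfolding V(2) W(2) by (elim imageE)
  have "a' < b'" "b' < c'" "c' < d'"
    using *(6-8) p sub unfolding eq by (meson less subsetD)+
  moreover have "V \<noteq> W" using *(1) V(2) W(2) by blast
  ultimately show False
    using D(4)[OF V(1) W(1) _ p] by simp
qed

lemma sum_noncrossing_partitions_interval:
  fixes \<kappa> :: "nat \<Rightarrow> complex"
  assumes "c \<le> n"
  shows "(\<Sum>\<pi>\<in>noncrossing_partitions {c<..n}. \<Prod>V\<in>\<pi>. \<kappa> (card V)) = distr_of_cumulants \<kappa> (n - c)"
  unfolding distr_of_cumulants_def NC_eq
proof (rule sum.reindex_bij_witness[of _ "image (image (\<lambda>i. i + c))" "image (image (\<lambda>i. i - c))"])
  have im1: "(\<lambda>i. i + c) ` {1..n - c} = {c<..n}"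
    using assms by (auto simp: image_iff intro!: bexI[of _ "_ - c"])
  have im2: "(\<lambda>i. i - c) ` {c<..n} = {1..n - c}"
    using assms by (auto simp: image_iff intro!: bexI[of _ "_ + c"])
  fix \<pi>
  {
    assume \<pi>: "\<pi> \<in> noncrossing_partitions {1..n - c}"
    show "image (image (\<lambda>i. i - c)) (image (image (\<lambda>i. i + c)) \<pi>) = \<pi>"
      by (simp add: image_image)
    show "image (image (\<lambda>i. i + c)) \<pi> \<in> noncrossing_partitions {c<..n}"
      using noncrossing_partitions_image[OF \<pi>, of "\<lambda>i. i + c"] im1 by (auto simp: strict_mono_on_def)
  }
  assume \<pi>: "\<pi> \<in> noncrossing_partitions {c<..n}"
  have sub: "V \<subseteq> {c<..n}" if "V \<in> \<pi>" for V
    using noncrossing_partitionsD(1)[OF \<pi>] that by blast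
  have "(\<lambda>i. i + c) ` (\<lambda>i. i - c) ` V = V" if "V \<in> \<pi>" for V
    using sub[OF that] by (force simp: image_image image_iff)
  then show inv: "image (image (\<lambda>i. i + c)) (image (image (\<lambda>i. i - c)) \<pi>) = \<pi>"
    by (simp add: image_image cong: image_cong)
  show "image (image (\<lambda>i. i - c)) \<pi> \<in> noncrossing_partitions {1..n - c}"
    using noncrossing_partitions_image[OF \<pi>, of "\<lambda>i. i - c"] im2
    by (simp add: strict_mono_on_def diff_less_mono)
  have inj: "inj_on (image (\<lambda>i. i - c)) \<pi>"
    by (rule inj_on_inverseI[of _ "image (\<lambda>i. i + c)"]) fact
  have "card ((\<lambda>i. i - c) ` V) = card V" if "V \<in> \<pi>" for V
    using sub[OF that] by (intro card_image inj_onI) force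
  then show "(\<Prod>V\<in>image (image (\<lambda>i. i - c)) \<pi>. \<kappa> (card V)) = (\<Prod>V\<in>\<pi>. \<kappa> (card V))"
    by (simp add: prod.reindex[OF inj])
qed

text \<open>The moment-cumulant sum in which the block of the last point counts with \<open>s\<close> additional points.
  These stand for points that were split off from that block.\<close>

definition marked_cumulant_sum :: "(nat \<Rightarrow> complex) \<Rightarrow> nat \<Rightarrow> nat \<Rightarrow> complex" where
  "marked_cumulant_sum \<kappa> s n =
     (\<Sum>\<pi>\<in>NC n. \<Prod>V\<in>\<pi>. \<kappa> (card V + (if n \<in> V then s else 0)))"

lemma marked_cumulant_sum_0: "marked_cumulant_sum \<kappa> 0 n = distr_of_cumulants \<kappa> n"
  by (simp add: marked_cumulant_sum_def distr_of_cumulants_def if_distrib cong: if_cong)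

lemma sum_singleton_last:
  "(\<Sum>\<pi>\<in>{\<pi>\<in>NC (Suc n). {Suc n} \<in> \<pi>}. \<Prod>V\<in>\<pi>. \<kappa> (card V + (if Suc n \<in> V then s else 0)))
   = \<kappa> (Suc s) * distr_of_cumulants \<kappa> n"
  unfolding distr_of_cumulants_def sum_distrib_left
proof (rule sum.reindex_bij_witness[of _ "insert {Suc n}" "\<lambda>\<pi>. \<pi> - {{Suc n}}"])
  fix \<pi>
  {
    assume \<pi>: "\<pi> \<in> NC n"
    then have D: "\<pi> \<in> noncrossing_partitions {1..n}" by (simp add: NC_eq)
    have "V \<subseteq> {1..n}" if "V \<in> \<pi>" for V
      using noncrossing_partitionsD(1)[OF D] that by blast
    then have new: "Suc n \<notin> V" if "V \<in> \<pi>" for V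
      using that by force
    then show "insert {Suc n} \<pi> - {{Suc n}} = \<pi>" by blast
    have "insert {Suc n} \<pi> \<in> noncrossing_partitions {1..Suc n}"
    proof (rule noncrossing_partitionsI)
      show "\<Union> (insert {Suc n} \<pi>) = {1..Suc n}"
        using noncrossing_partitionsD(1)[OF D] by auto
      show "{} \<notin> insert {Suc n} \<pi>" using noncrossing_partitionsD(2)[OF D] by auto
      fix V W assume VW: "V \<in> insert {Suc n} \<pi>" "W \<in> insert {Suc n} \<pi>"
      show "V = W" if "x \<in> V" "x \<in> W" for x
        using VW that noncrossing_partitionsD(3)[OF D, of V W x] new[of V] new[of W] by auto
      fix a b c d assume *: "V \<noteq> W" "a \<in> V" "b \<in> W" "c \<in> V" "d \<in> W" "a < b" "b < c" "c < d"
      then have "V \<in> \<pi>" "W \<in> \<pi>"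
        using VW by auto
      then show False
        using noncrossing_partitionsD(4)[OF D _ _ *] by blast
    qed
    then show "insert {Suc n} \<pi> \<in> {\<pi>\<in>NC (Suc n). {Suc n} \<in> \<pi>}"
      by (simp add: NC_eq)
  }
  assume "\<pi> \<in> {\<pi>\<in>NC (Suc n). {Suc n} \<in> \<pi>}"
  then have D: "\<pi> \<in> noncrossing_partitions {1..Suc n}" and sing: "{Suc n} \<in> \<pi>"
    by (auto simp: NC_eq)
  show "insert {Suc n} (\<pi> - {{Suc n}}) = \<pi>" using sing by blast
  have new: "Suc n \<notin> V" if "V \<in> \<pi> - {{Suc n}}" for V
    using noncrossing_partitionsD(3)[OF D _ sing, of V "Suc n"] that by blast
  have "\<pi> - {{Suc n}} \<in> noncrossing_partitions {1..n}"
  proof (rule noncrossing_partitions_subset[OF D])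
    have "\<Union> (\<pi> - {{Suc n}}) = {1..Suc n} - {Suc n}"
      using noncrossing_partitionsD(1)[OF D] new by blast
    also have "\<dots> = {1..n}" by auto
    finally show "\<Union> (\<pi> - {{Suc n}}) = {1..n}" .
  qed blast
  then show "\<pi> - {{Suc n}} \<in> NC n" by (simp add: NC_eq)
  have "finite \<pi>" using noncrossing_partitions_finite(2)[OF _ D] by simp
  then have "(\<Prod>V\<in>\<pi>. \<kappa> (card V + (if Suc n \<in> V then s else 0)))
      = \<kappa> (Suc s) * (\<Prod>V\<in>\<pi> - {{Suc n}}. \<kappa> (card V + (if Suc n \<in> V then s else 0)))"
    using sing by (simp add: prod.remove[of _ "{Suc n}"])
  also have "(\<Prod>V\<in>\<pi> - {{Suc n}}. \<kappa> (card V + (if Suc n \<in> V then s else 0)))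
     = (\<Prod>V\<in>\<pi> - {{Suc n}}. \<kappa> (card V))"
    using new by (intro prod.cong refl) simp
  finally show "\<kappa> (Suc s) * (\<Prod>V\<in>\<pi> - {{Suc n}}. \<kappa> (card V))
      = (\<Prod>V\<in>\<pi>. \<kappa> (card V + (if Suc n \<in> V then s else 0)))" ..
qed

text \<open>No block crosses the arc from \<open>c\<close> to \<open>n + 1\<close>, so the partition falls apart into a partition of the
  points strictly between them and one of \<open>{1..c}\<close>. The latter has lost the point \<open>n + 1\<close> from the
  block of \<open>c\<close>, which the increased mark remembers.\<close>

lemma sum_last_block_predecessor:
  assumes c: "1 \<le> c" "c \<le> n"
  shows "(\<Sum>\<pi>\<in>{\<pi>\<in>NC (Suc n). \<exists>V\<in>\<pi>. Suc n \<in> V \<and> c \<in> V \<and> V \<inter> {c<..n} = {}}.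
            \<Prod>V\<in>\<pi>. \<kappa> (card V + (if Suc n \<in> V then s else 0)))
   = distr_of_cumulants \<kappa> (n - c) * marked_cumulant_sum \<kappa> (Suc s) c"
proof -
  \<comment> \<open>Puts the point \<open>n + 1\<close> back into the block of \<open>c\<close>.\<close>
  define aug where "aug W = (if c \<in> W then insert (Suc n) W else W)" for W
  let ?A = "{\<pi>\<in>NC (Suc n). \<exists>V\<in>\<pi>. Suc n \<in> V \<and> c \<in> V \<and> V \<inter> {c<..n} = {}}"
  let ?i = "\<lambda>(\<pi>1, \<pi>2). \<pi>1 \<union> aug ` \<pi>2"
  let ?j = "\<lambda>\<pi>. ({W\<in>\<pi>. W \<subseteq> {c<..n}}, (\<lambda>W. W - {Suc n}) ` {W\<in>\<pi>. W \<inter> {1..c} \<noteq> {}})"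
  let ?f = "\<lambda>(\<pi>1, \<pi>2). (\<Prod>V\<in>\<pi>1. \<kappa> (card V)) * (\<Prod>V\<in>\<pi>2. \<kappa> (card V + (if c \<in> V then Suc s else 0)))"
  have "(\<Sum>\<pi>\<in>?A. \<Prod>V\<in>\<pi>. \<kappa> (card V + (if Suc n \<in> V then s else 0)))
    = (\<Sum>x\<in>noncrossing_partitions {c<..n} \<times> noncrossing_partitions {1..c}. ?f x)"
  proof (rule sum.reindex_bij_witness[of _ ?i ?j])
    fix x assume "x \<in> noncrossing_partitions {c<..n} \<times> noncrossing_partitions {1..c}"
    then obtain \<pi>1 \<pi>2 where x: "x = (\<pi>1, \<pi>2)"
      and P1: "\<pi>1 \<in> noncrossing_partitions {c<..n}" and P2: "\<pi>2 \<in> noncrossing_partitions {1..c}"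
      by blast
    note D1 = noncrossing_partitionsD[OF P1] and D2 = noncrossing_partitionsD[OF P2]
    have s1: "W \<subseteq> {c<..n}" "W \<noteq> {}" "W \<inter> {1..c} = {}" "Suc n \<notin> W" if "W \<in> \<pi>1" for W
    proof -
      show *: "W \<subseteq> {c<..n}" using D1(1) that by blast
      show "W \<noteq> {}" using D1(2) that by blast
      show "W \<inter> {1..c} = {}" "Suc n \<notin> W" using * by auto
    qed
    have s2: "W \<subseteq> {1..c}" "W \<noteq> {}" "Suc n \<notin> W" "aug W \<inter> {1..c} = W" "aug W - {Suc n} = W"
      "aug W \<inter> {c<..n} = {}" "aug W \<subseteq> insert (Suc n) W" if "W \<in> \<pi>2" for W
    proof -
      show *: "W \<subseteq> {1..c}" using D2(1) that by blast
      show "W \<noteq> {}" using D2(2) that by blast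
      show **: "Suc n \<notin> W" using * c by force
      show "aug W \<inter> {1..c} = W" "aug W - {Suc n} = W"
        "aug W \<inter> {c<..n} = {}" "aug W \<subseteq> insert (Suc n) W"
        using * ** c by (auto simp: aug_def)
    qed
    obtain V where V: "V \<in> \<pi>2" "c \<in> V"
      using D2(1) c by (metis Union_iff atLeastAtMost_iff order_refl)
    have augV: "aug V = insert (Suc n) V" using V by (simp add: aug_def)
    have last: "W = V" if "W \<in> \<pi>2" "Suc n \<in> aug W" for W
      using that V D2(3) s2(3) unfolding aug_def by (metis (full_types))
    have new: "\<pi>1 \<union> aug ` \<pi>2 \<in> noncrossing_partitions {1..Suc n}"
    proof (rule noncrossing_partitionsI)
      have "\<Union> (aug ` \<pi>2) = insert (Suc n) (\<Union> \<pi>2)"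
        using s2(5,7) V(1) augV by blast
      then show "\<Union> (\<pi>1 \<union> aug ` \<pi>2) = {1..Suc n}"
        using D1(1) D2(1) c by auto
      show "{} \<notin> \<pi>1 \<union> aug ` \<pi>2"
        using s1(2) s2(2,5) by force
      fix X Y assume XY: "X \<in> \<pi>1 \<union> aug ` \<pi>2" "Y \<in> \<pi>1 \<union> aug ` \<pi>2"
      show "X = Y" if z: "z \<in> X" "z \<in> Y" for z
      proof -
        consider "X \<in> \<pi>1" "Y \<in> \<pi>1" | W where "X \<in> \<pi>1" "Y = aug W" "W \<in> \<pi>2"
          | W where "Y \<in> \<pi>1" "X = aug W" "W \<in> \<pi>2"
          | W W' where "X = aug W" "W \<in> \<pi>2" "Y = aug W'" "W' \<in> \<pi>2" using XY by blast
        then show ?thesis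
        proof cases
          case 1 then show ?thesis using D1(3) z by blast
        next
          case 2 then show ?thesis using s1(1) s2(6) z by blast
        next
          case 3 then show ?thesis using s1(1) s2(6) z by blast
        next
          case 4
          show ?thesis
          proof (cases "z = Suc n")
            case True then show ?thesis using 4 z last by metis
          next
            case False
            then have "z \<in> W" "z \<in> W'" using 4 z s2(7) by blast+
            then show ?thesis using 4 D2(3) by blast
          qed
        qed
      qed
      fix i1 i2 i3 i4
      assume *: "X \<noteq> Y" "i1 \<in> X" "i2 \<in> Y" "i3 \<in> X" "i4 \<in> Y" "i1 < i2" "i2 < i3" "i3 < i4"
      consider "X \<in> \<pi>1" "Y \<in> \<pi>1" | W where "X \<in> \<pi>1" "Y = aug W" "W \<in> \<pi>2"
        | W where "Y \<in> \<pi>1" "X = aug W" "W \<in> \<pi>2"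
        | W W' where "X = aug W" "W \<in> \<pi>2" "Y = aug W'" "W' \<in> \<pi>2" using XY by blast
      then show False
      proof cases
        case 1 then show ?thesis by (rule D1(4)[OF _ _ *])
      next
        case 2
        then have "i1 \<in> {c<..n}" "i3 \<in> {c<..n}" "i2 \<in> {1..c} \<union> {Suc n}"
          using * s1(1) s2(1,7) by blast+
        then show ?thesis using * by auto
      next
        case 3
        then have "i2 \<in> {c<..n}" "i4 \<in> {c<..n}" "i3 \<in> {1..c} \<union> {Suc n}"
          using * s1(1) s2(1,7) by blast+
        then show ?thesis using * by auto
      next
        case 4
        have W: "W \<subseteq> {1..c}" "W' \<subseteq> {1..c}" "X \<subseteq> insert (Suc n) W" "Y \<subseteq> insert (Suc n) W'"
          using 4 s2(1,7) by auto
        have le: "i4 \<le> Suc n"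
          using W(2,4) *(5) c by auto
        then have "i1 \<noteq> Suc n" "i2 \<noteq> Suc n" "i3 \<noteq> Suc n" using *(6-8) by auto
        then have i: "i1 \<in> W" "i2 \<in> W'" "i3 \<in> W" using W(3,4) *(2-4) by auto
        have ne: "W \<noteq> W'" using 4 * by blast
        show ?thesis
        proof (cases "i4 = Suc n")
          case True
          then have "W' = V" using 4(3,4) *(5) last by auto
          moreover have "i3 < c"
          proof -
            have "i3 \<le> c" using i(3) W(1) by auto
            moreover have "i3 \<noteq> c" using i ne \<open>W' = V\<close> V 4 D2(3) by blast
            ultimately show ?thesis by simp
          qed
          ultimately show ?thesis
            using D2(4)[OF 4(2,4) ne i(1,2,3), of c] V(2) *(6,7) by simp
        next
          case False
          then have "i4 \<in> W'" using W(4) *(5) by auto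
          then show ?thesis by (rule D2(4)[OF 4(2,4) ne i _ *(6-8)])
        qed
      qed
    qed
    have "aug V \<in> \<pi>1 \<union> aug ` \<pi>2" "Suc n \<in> aug V" "c \<in> aug V" "aug V \<inter> {c<..n} = {}"
      using V(1) apply (intro UnI2 imageI)
      using V(2) augV s2(6)[OF V(1)] by simp_all
    then show "?i x \<in> ?A"
      using new unfolding x by (auto simp: NC_eq)
    have "{W \<in> \<pi>1 \<union> aug ` \<pi>2. W \<subseteq> {c<..n}} = \<pi>1"
    proof -
      have "\<not> aug W \<subseteq> {c<..n}" if "W \<in> \<pi>2" for W
        using s2(2,5,6)[OF that] by blast
      then show ?thesis using s1(1) by blast
    qed
    moreover have "{W \<in> \<pi>1 \<union> aug ` \<pi>2. W \<inter> {1..c} \<noteq> {}} = aug ` \<pi>2"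
    proof -
      have "aug W \<inter> {1..c} \<noteq> {}" if "W \<in> \<pi>2" for W
        using s2(2,4)[OF that] by simp
      then show ?thesis using s1(3) by blast
    qed
    moreover have "(\<lambda>W. W - {Suc n}) ` aug ` \<pi>2 = \<pi>2"
      using s2(5) by (simp add: image_image)
    ultimately show "?j (?i x) = x"
      unfolding x by simp
  next
    fix \<pi> assume \<pi>: "\<pi> \<in> ?A"
    then have D: "\<pi> \<in> noncrossing_partitions {1..Suc n}" by (simp add: NC_eq)
    note D' = noncrossing_partitionsD[OF D]
    obtain V where V: "V \<in> \<pi>" "Suc n \<in> V" "c \<in> V" "V \<inter> {c<..n} = {}" using \<pi> by blast
    have last: "W = V" if "W \<in> \<pi>" "Suc n \<in> W" for W using D'(3) that V by blast
    have lastc: "W = V" if "W \<in> \<pi>" "c \<in> W" for W using D'(3) that V by blast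
    define \<pi>1 where "\<pi>1 = {W\<in>\<pi>. W \<subseteq> {c<..n}}"
    define \<pi>2' where "\<pi>2' = {W\<in>\<pi>. W \<inter> {1..c} \<noteq> {}}"
    define \<pi>2 where "\<pi>2 = (\<lambda>W. W - {Suc n}) ` \<pi>2'"
    have in_range: "W \<subseteq> {1..Suc n}" if "W \<in> \<pi>" for W using D'(1) that by blast
    \<comment> \<open>A block with points on both sides of \<open>c\<close> would cross the block of \<open>c\<close> and \<open>n + 1\<close>.\<close>
    have low: "W - {Suc n} \<subseteq> {1..c}" if W: "W \<in> \<pi>" "W \<inter> {1..c} \<noteq> {}" for W
    proof (cases "W = V")
      case True
      show ?thesis using V(4) in_range[OF V(1)] unfolding True by force
    next
      case False
      obtain x where x: "x \<in> W" "x \<le> c" using W by auto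
      have "x \<noteq> c" using lastc W False x by blast
      moreover have "Suc n \<notin> W" using last W False by blast
      moreover have "\<not> (c < y \<and> y \<le> n)" if "y \<in> W" for y
      proof
        assume "c < y \<and> y \<le> n"
        then show False
          using D'(4)[OF W(1) V(1) False x(1) V(3) that V(2)] x \<open>x \<noteq> c\<close> by simp
      qed
      ultimately show ?thesis using in_range[OF W(1)] by fastforce
    qed
    have split: "\<pi> = \<pi>1 \<union> \<pi>2'"
    proof -
      have "W \<inter> {1..c} \<noteq> {}" if W: "W \<in> \<pi>" "\<not> W \<subseteq> {c<..n}" for W
      proof (cases "Suc n \<in> W")
        case True
        then have "c \<in> W" using last[OF W(1)] V(3) by simp
        moreover have "c \<in> {1..c}" using c by simp
        ultimately show ?thesis by blast
      next
        case False
        obtain x where x: "x \<in> W" "x \<notin> {c<..n}" using W(2) by blast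
        moreover have "x \<in> {1..Suc n}" "x \<noteq> Suc n" using x in_range[OF W(1)] False by auto
        ultimately have "x \<in> {1..c}" by auto
        then show ?thesis using x by blast
      qed
      then show ?thesis unfolding \<pi>1_def \<pi>2'_def by blast
    qed
    have c_iff: "c \<in> W \<longleftrightarrow> Suc n \<in> W" if "W \<in> \<pi>" for W
      using last[OF that] lastc[OF that] V(2,3) by auto
    have aug: "aug (W - {Suc n}) = W" if "W \<in> \<pi>2'" for W
      using c_iff[of W] that c unfolding aug_def \<pi>2'_def by auto
    have aug_im: "aug ` \<pi>2 = \<pi>2'"
      unfolding \<pi>2_def using aug by (simp add: image_image)
    have cn: "c \<noteq> Suc n" using c by simp
    show "?i (?j \<pi>) = \<pi>"
      using split aug_im unfolding \<pi>1_def \<pi>2_def \<pi>2'_def by simp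
    have un1: "\<Union>\<pi>1 = {c<..n}" and un2: "\<Union>\<pi>2 = {1..c}"
    proof -
      have "\<Union>\<pi>1 \<subseteq> {c<..n}" unfolding \<pi>1_def by blast
      moreover have "\<Union>\<pi>2 \<subseteq> {1..c}" unfolding \<pi>2_def \<pi>2'_def using low by blast
      moreover have "x \<in> \<Union>\<pi>1 \<union> \<Union>\<pi>2" if x: "x \<in> {1..n}" for x
      proof -
        have "x \<in> \<Union>\<pi>" "x \<noteq> Suc n" using D'(1) x by auto
        then show ?thesis using split unfolding \<pi>2_def by blast
      qed
      moreover have "{1..c} \<inter> {c<..n} = {}" "{1..n} = {1..c} \<union> {c<..n}" using c by auto
      ultimately show "\<Union>\<pi>1 = {c<..n}" "\<Union>\<pi>2 = {1..c}" by blast+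
    qed
    have "\<pi>1 \<in> noncrossing_partitions {c<..n}"
      by (rule noncrossing_partitions_subset[OF D _ un1]) (simp add: \<pi>1_def)
    moreover have "\<pi>2 \<in> noncrossing_partitions {1..c}"
    proof (rule noncrossing_partitionsI[OF un2])
      show "{} \<notin> \<pi>2" unfolding \<pi>2_def \<pi>2'_def using c by fastforce
      fix X Y assume "X \<in> \<pi>2" "Y \<in> \<pi>2"
      then obtain X' Y' where X: "X = X' - {Suc n}" "X' \<in> \<pi>" and Y: "Y = Y' - {Suc n}" "Y' \<in> \<pi>"
        unfolding \<pi>2_def \<pi>2'_def by blast
      show "X = Y" if "x \<in> X" "x \<in> Y" for x
        using D'(3)[OF X(2) Y(2), of x] X Y that by blast
      show False if "X \<noteq> Y" "i1 \<in> X" "i2 \<in> Y" "i3 \<in> X" "i4 \<in> Y" "i1 < i2" "i2 < i3" "i3 < i4"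
        for i1 i2 i3 i4
        using D'(4)[OF X(2) Y(2) _ _ _ _ _ that(6-8)] X(1) Y(1) that(1-5) by blast
    qed
    ultimately show "?j \<pi> \<in> noncrossing_partitions {c<..n} \<times> noncrossing_partitions {1..c}"
      unfolding \<pi>1_def \<pi>2_def \<pi>2'_def by simp
    have fin: "finite \<pi>" using noncrossing_partitions_finite(2)[OF _ D] by simp
    have finW: "finite W" if "W \<in> \<pi>" for W
      using noncrossing_partitions_finite(3)[OF _ D that] by simp
    have disj: "\<pi>1 \<inter> \<pi>2' = {}" unfolding \<pi>1_def \<pi>2'_def by fastforce
    have inj: "inj_on (\<lambda>W. W - {Suc n}) \<pi>2'"
      using aug by (intro inj_on_inverseI[of _ aug])
    have "(\<Prod>V\<in>\<pi>. \<kappa> (card V + (if Suc n \<in> V then s else 0)))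
      = (\<Prod>V\<in>\<pi>1. \<kappa> (card V + (if Suc n \<in> V then s else 0)))
        * (\<Prod>V\<in>\<pi>2'. \<kappa> (card V + (if Suc n \<in> V then s else 0)))"
      unfolding split using fin split disj by (intro prod.union_disjoint) auto
    also have "(\<Prod>V\<in>\<pi>1. \<kappa> (card V + (if Suc n \<in> V then s else 0))) = (\<Prod>V\<in>\<pi>1. \<kappa> (card V))"
      unfolding \<pi>1_def by (intro prod.cong refl) auto
    also have "(\<Prod>V\<in>\<pi>2'. \<kappa> (card V + (if Suc n \<in> V then s else 0)))
      = (\<Prod>V\<in>\<pi>2. \<kappa> (card V + (if c \<in> V then Suc s else 0)))"
      unfolding \<pi>2_def prod.reindex[OF inj] comp_def
    proof (rule prod.cong[OF refl])
      fix W assume "W \<in> \<pi>2'"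
      then have W: "W \<in> \<pi>" unfolding \<pi>2'_def by blast
      show "\<kappa> (card W + (if Suc n \<in> W then s else 0))
        = \<kappa> (card (W - {Suc n}) + (if c \<in> W - {Suc n} then Suc s else 0))"
        using c_iff[OF W] finW[OF W] cn card.remove[of W "Suc n"]
        by (cases "Suc n \<in> W") simp_all
    qed
    finally show "?f (?j \<pi>) = (\<Prod>V\<in>\<pi>. \<kappa> (card V + (if Suc n \<in> V then s else 0)))"
      unfolding \<pi>1_def \<pi>2_def \<pi>2'_def by simp
  qed
  also have "\<dots> = (\<Sum>\<pi>1\<in>noncrossing_partitions {c<..n}. \<Prod>V\<in>\<pi>1. \<kappa> (card V)) * marked_cumulant_sum \<kappa> (Suc s) c"
    unfolding marked_cumulant_sum_def NC_eq sum_product sum.cartesian_product by simp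
  finally show ?thesis
    using sum_noncrossing_partitions_interval[OF c(2), of \<kappa>] by simp
qed

text \<open>Case distinction on the predecessor \<open>c\<close> of \<open>n + 1\<close> in its block, with \<open>i = n - c\<close> points in
  between. Splitting off one point at a time leads to a recursion with only two factors instead of
  a sum over all sizes of the block.\<close>

lemma marked_cumulant_sum_Suc:
  "marked_cumulant_sum \<kappa> s (Suc n) = \<kappa> (Suc s) * distr_of_cumulants \<kappa> n
     + (\<Sum>i<n. distr_of_cumulants \<kappa> i * marked_cumulant_sum \<kappa> (Suc s) (n - i))"
proof -
  let ?S = "{\<pi>\<in>NC (Suc n). {Suc n} \<in> \<pi>}"
  let ?A = "\<lambda>c. {\<pi>\<in>NC (Suc n). \<exists>V\<in>\<pi>. Suc n \<in> V \<and> c \<in> V \<and> V \<inter> {c<..n} = {}}"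
  let ?w = "\<lambda>\<pi>. \<Prod>V\<in>\<pi>. \<kappa> (card V + (if Suc n \<in> V then s else 0))"
  have fin: "finite (NC (Suc n))" unfolding NC_eq by (rule noncrossing_partitions_finite(1)) simp
  have cover: "NC (Suc n) = ?S \<union> (\<Union>c\<in>{1..n}. ?A c)"
  proof -
    have "\<pi> \<in> ?S \<union> (\<Union>c\<in>{1..n}. ?A c)" if \<pi>: "\<pi> \<in> NC (Suc n)" for \<pi>
    proof -
      have D: "\<pi> \<in> noncrossing_partitions {1..Suc n}" using \<pi> by (simp add: NC_eq)
      obtain V where V: "V \<in> \<pi>" "Suc n \<in> V"
        using noncrossing_partitionsD(1)[OF D] by (metis UnionE atLeastAtMost_iff le_add1 order_refl plus_1_eq_Suc)
      have VS: "V \<subseteq> {1..Suc n}" using noncrossing_partitionsD(1)[OF D] V by blast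
      show ?thesis
      proof (cases "V = {Suc n}")
        case True then show ?thesis using V \<pi> by auto
      next
        case False
        let ?c = "Max (V - {Suc n})"
        have fin: "finite (V - {Suc n})" using finite_subset[OF VS] by simp
        have "V - {Suc n} \<noteq> {}" using False V by blast
        then have c: "?c \<in> V - {Suc n}" by (rule Max_in[OF fin])
        then have "?c \<in> {1..n}" using VS by force
        moreover have "V \<inter> {?c<..n} = {}"
        proof (rule ccontr)
          assume "V \<inter> {?c<..n} \<noteq> {}"
          then obtain x where x: "x \<in> V" "?c < x" "x \<le> n" by auto
          then have "x \<le> ?c" using fin by (intro Max_ge) auto
          then show False using x by simp
        qed
        ultimately have "\<pi> \<in> ?A ?c" using V c \<pi> by (intro CollectI conjI bexI[of _ V]) auto
        then show ?thesis using \<open>?c \<in> {1..n}\<close> by blast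
      qed
    qed
    then show ?thesis by blast
  qed
  have uniq: "V = W" if "\<pi> \<in> NC (Suc n)" "V \<in> \<pi>" "W \<in> \<pi>" "Suc n \<in> V" "Suc n \<in> W" for \<pi> V W
    by (rule noncrossing_partitionsD(3)[OF that(1)[unfolded NC_eq] that(2-5)])
  have d0: "?S \<inter> (\<Union>c\<in>{1..n}. ?A c) = {}"
  proof (rule ccontr)
    assume "?S \<inter> (\<Union>c\<in>{1..n}. ?A c) \<noteq> {}"
    then obtain \<pi> c V where "\<pi> \<in> NC (Suc n)" "{Suc n} \<in> \<pi>" "c \<in> {1..n}" "V \<in> \<pi>" "Suc n \<in> V" "c \<in> V"
      by blast
    then show False using uniq[of \<pi> V "{Suc n}"] by auto
  qed
  have dc: "?A c \<inter> ?A c' = {}" if cc: "c \<in> {1..n}" "c' \<in> {1..n}" "c \<noteq> c'" for c c'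
  proof (rule ccontr)
    assume "?A c \<inter> ?A c' \<noteq> {}"
    then obtain \<pi> V W where *: "\<pi> \<in> NC (Suc n)" "V \<in> \<pi>" "W \<in> \<pi>" "Suc n \<in> V" "Suc n \<in> W" "c \<in> V" "c' \<in> W"
      "V \<inter> {c<..n} = {}" "W \<inter> {c'<..n} = {}" by blast
    then have "V = W" using uniq[OF *(1-5)] by simp
    then have "c' \<notin> {c<..n}" "c \<notin> {c'<..n}" using * by blast+
    then show False using cc by auto
  qed
  have "marked_cumulant_sum \<kappa> s (Suc n) = sum ?w ?S + (\<Sum>c\<in>{1..n}. sum ?w (?A c))"
  proof -
    have "sum ?w (NC (Suc n)) = sum ?w ?S + sum ?w (\<Union>c\<in>{1..n}. ?A c)"
      by (subst cover, rule sum.union_disjoint) (use fin d0 in auto)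
    also have "sum ?w (\<Union>c\<in>{1..n}. ?A c) = (\<Sum>c\<in>{1..n}. sum ?w (?A c))"
      by (rule sum.UNION_disjoint) (use fin dc in auto)
    finally show ?thesis by (simp add: marked_cumulant_sum_def)
  qed
  also have "(\<Sum>c\<in>{1..n}. sum ?w (?A c))
     = (\<Sum>c\<in>{1..n}. distr_of_cumulants \<kappa> (n - c) * marked_cumulant_sum \<kappa> (Suc s) c)"
    by (intro sum.cong refl sum_last_block_predecessor) auto
  also have "\<dots> = (\<Sum>i<n. distr_of_cumulants \<kappa> i * marked_cumulant_sum \<kappa> (Suc s) (n - i))"
    by (rule sum.reindex_bij_witness[of _ "\<lambda>i. n - i" "\<lambda>c. n - c"]) auto
  finally show ?thesis
    unfolding sum_singleton_last .
qed

definition cumulant_series :: "(nat \<Rightarrow> complex) \<Rightarrow> complex fps" where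
  "cumulant_series \<kappa> = Abs_fps (\<lambda>n. if n = 0 then 0 else \<kappa> n)"

lemma cumulant_series_nth_0 [simp]: "fps_nth (cumulant_series \<kappa>) 0 = 0"
  and cumulant_series_nth_1: "fps_nth (cumulant_series \<kappa>) (Suc 0) = \<kappa> 1"
  by (simp_all add: cumulant_series_def)

lemma cumulant_series_eq: "cumulant_series \<kappa> = fps_X * Abs_fps (\<lambda>j. \<kappa> (Suc j))"
  by (rule fps_ext) (auto simp: cumulant_series_def fps_X_mult_nth)

lemma cumulant_series_compose:
  "cumulant_series \<kappa> oo (fps_X * F) = fps_X * F * (Abs_fps (\<lambda>j. \<kappa> (Suc j)) oo (fps_X * F))"
  by (simp add: cumulant_series_eq fps_compose_mult_distrib)

lemma psi_series_nth_0 [simp]: "fps_nth (psi_series \<mu>) 0 = 0"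
  and psi_series_nth_1: "fps_nth (psi_series \<mu>) (Suc 0) = \<mu> 1"
  by (simp_all add: psi_series_def)

lemma Abs_fps_eq_psi_series: "\<mu> 0 = 1 \<Longrightarrow> Abs_fps \<mu> = 1 + psi_series \<mu>"
  by (rule fps_ext) (auto simp: psi_series_def)

text \<open>The moment-cumulant formula in terms of generating series. It defines free cumulants of every
  moment sequence, and unlike the sum over partitions it can be solved for \<open>\<kappa>\<close>.\<close>

definition cumulant_relation :: "distr \<Rightarrow> (nat \<Rightarrow> complex) \<Rightarrow> bool" where
  "cumulant_relation \<mu> \<kappa> \<longleftrightarrow>
     \<mu> 0 = 1 \<and> psi_series \<mu> = cumulant_series \<kappa> oo (fps_X * (1 + psi_series \<mu>))"

text \<open>All cumulant sums below satisfy a recursion of this shape: \<open>s\<close> counts the cumulant reached so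
  far, \<open>f\<close> belongs to a complete gap and \<open>e\<close> to the last one.\<close>

lemma convolution_recursion_fps:
  fixes e f :: "nat \<Rightarrow> complex"
  assumes "\<And>s n. H s n = \<kappa> s * e n + (\<Sum>i<n. f i * H (Suc s) (n - 1 - i))"
  shows "Abs_fps (H s) = Abs_fps e * (Abs_fps (\<lambda>j. \<kappa> (s + j)) oo (fps_X * Abs_fps f))"
proof (rule fps_geometric_unfold)
  fix s
  show "Abs_fps (H s) = fps_const (\<kappa> s) * Abs_fps e + fps_X * Abs_fps f * Abs_fps (H (Suc s))"
  proof (rule fps_ext)
    fix n
    have "(\<Sum>i<n. f i * H (Suc s) (n - 1 - i)) = fps_nth (fps_X * (Abs_fps f * Abs_fps (H (Suc s)))) n"
    proof (cases n)
      case (Suc m)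
      then show ?thesis
        by (simp only: fps_X_mult_nth fps_mult_nth[of "Abs_fps f"])
           (simp add: atLeast0AtMost lessThan_Suc_atMost)
    qed simp
    then show "fps_nth (Abs_fps (H s)) n
        = fps_nth (fps_const (\<kappa> s) * Abs_fps e + fps_X * Abs_fps f * Abs_fps (H (Suc s))) n"
      by (simp add: assms[of s n] mult.assoc del: fps_X_mult_nth)
  qed
qed

lemma distr_of_cumulants_0 [simp]: "distr_of_cumulants \<kappa> 0 = 1"
proof -
  have "NC 0 = {{}}"
    by (auto simp: NC_def partition_on_empty noncrossing_def)
  then show ?thesis by (simp add: distr_of_cumulants_def)
qed

lemma cumulant_relation_distr_of_cumulants: "cumulant_relation (distr_of_cumulants \<kappa>) \<kappa>"
proof -
  let ?\<mu> = "distr_of_cumulants \<kappa>"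
  have "Abs_fps (\<lambda>n. marked_cumulant_sum \<kappa> 0 (Suc n))
      = Abs_fps ?\<mu> * (Abs_fps (\<lambda>j. \<kappa> (Suc (0 + j))) oo (fps_X * Abs_fps ?\<mu>))"
  proof (rule convolution_recursion_fps[where H = "\<lambda>s n. marked_cumulant_sum \<kappa> s (Suc n)"
        and \<kappa> = "\<lambda>j. \<kappa> (Suc j)"])
    fix s n
    have "(\<Sum>i<n. ?\<mu> i * marked_cumulant_sum \<kappa> (Suc s) (n - i))
        = (\<Sum>i<n. ?\<mu> i * marked_cumulant_sum \<kappa> (Suc s) (Suc (n - 1 - i)))"
      by (intro sum.cong refl) (auto simp: Suc_diff_Suc)
    then show "marked_cumulant_sum \<kappa> s (Suc n) = \<kappa> (Suc s) * ?\<mu> n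
        + (\<Sum>i<n. ?\<mu> i * marked_cumulant_sum \<kappa> (Suc s) (Suc (n - 1 - i)))"
      by (simp add: marked_cumulant_sum_Suc)
  qed
  moreover have "psi_series ?\<mu> = fps_X * Abs_fps (\<lambda>n. marked_cumulant_sum \<kappa> 0 (Suc n))"
    by (rule fps_ext) (simp add: psi_series_def marked_cumulant_sum_0 fps_X_mult_nth)
  ultimately have "psi_series ?\<mu> = cumulant_series \<kappa> oo (fps_X * Abs_fps ?\<mu>)"
    by (simp add: cumulant_series_compose mult.assoc)
  then show ?thesis
    by (simp add: cumulant_relation_def Abs_fps_eq_psi_series)
qed

lemma cumulant_relation_exists:
  assumes "\<mu> 0 = 1"
  shows "\<exists>\<kappa>. cumulant_relation \<mu> \<kappa>"
proof -
  define g where "g = fps_X * (1 + psi_series \<mu>)"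
  have g: "fps_nth g 0 = 0" "fps_nth g 1 \<noteq> 0" by (simp_all add: g_def)
  have i0: "fps_nth (fps_inv g) 0 = 0" by (simp add: fps_inv_def)
  \<comment> \<open>Solving \<open>\<psi> = R(g)\<close> for \<open>R\<close>.\<close>
  define \<kappa> where "\<kappa> = fps_nth (psi_series \<mu> oo fps_inv g)"
  have "cumulant_series \<kappa> = psi_series \<mu> oo fps_inv g"
    by (rule fps_ext) (simp add: cumulant_series_def \<kappa>_def)
  then have "cumulant_series \<kappa> oo g = psi_series \<mu> oo (fps_inv g oo g)"
    using fps_compose_assoc[OF g(1) i0, of "psi_series \<mu>"] by simp
  also have "fps_inv g oo g = fps_X" using fps_inv g by blast
  finally show ?thesis
    using assms unfolding cumulant_relation_def g_def by (intro exI[of _ \<kappa>]) simp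
qed

text \<open>The converse direction: whatever is computed from the cumulants by the recursion of the
  moment-cumulant formula is the moment.\<close>

lemma cumulant_relation_recursion:
  assumes rel: "cumulant_relation \<mu> \<kappa>"
    and H: "\<And>s n. H s n = \<kappa> s * \<mu> n + (\<Sum>i<n. \<mu> i * H (Suc s) (n - 1 - i))"
  shows "H 1 n = \<mu> (Suc n)"
proof -
  have F: "Abs_fps \<mu> = 1 + psi_series \<mu>"
    using rel by (simp add: cumulant_relation_def Abs_fps_eq_psi_series)
  have "fps_X * Abs_fps (H 1) = cumulant_series \<kappa> oo (fps_X * Abs_fps \<mu>)"
    using convolution_recursion_fps[where H = H, OF H, of 1]
    by (simp add: cumulant_series_compose mult.assoc)
  also have "\<dots> = psi_series \<mu>"
    using rel unfolding F by (simp add: cumulant_relation_def)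
  finally have "fps_nth (fps_X * Abs_fps (H 1)) (Suc n) = fps_nth (psi_series \<mu>) (Suc n)" by simp
  then show ?thesis by (simp add: psi_series_def)
qed

lemma cumulant_relation_1:
  assumes "cumulant_relation \<mu> \<kappa>"
  shows "\<kappa> 1 = \<mu> 1"
proof -
  have "\<mu> 1 = fps_nth (cumulant_series \<kappa> oo (fps_X * (1 + psi_series \<mu>))) 1"
    using assms by (metis One_nat_def cumulant_relation_def psi_series_nth_1)
  also have "\<dots> = \<kappa> 1"
    by (simp add: fps_compose_nth cumulant_series_nth_1)
  finally show ?thesis by simp
qed

lemma fps_X_mult_divide:
  fixes a :: "complex fps"
  assumes "fps_nth a 0 = 0"
  shows "fps_X * (a / fps_X) = a"
  by (rule fps_ext) (use assms in \<open>auto simp: fps_X_mult_nth fps_div_fps_X_nth\<close>)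

lemma S_transform_eq:
  "fps_X * S_transform \<mu> = (fps_X + 1) * fps_inv (psi_series \<mu>)"
  unfolding S_transform_def by (rule fps_X_mult_divide) (simp add: fps_inv_def)

text \<open>Inverting \<open>\<psi> = R(X (1 + \<psi>))\<close> gives \<open>R\<^sup>-\<^sup>1(\<psi>) = X (1 + \<psi>)\<close>, hence \<open>R\<^sup>-\<^sup>1 = (1 + X) \<psi>\<^sup>-\<^sup>1\<close>.\<close>

lemma S_transform_cumulants:
  assumes rel: "cumulant_relation \<mu> \<kappa>" and nz: "\<mu> 1 \<noteq> 0"
  shows "fps_X * S_transform \<mu> = fps_inv (cumulant_series \<kappa>)"
proof -
  let ?\<psi> = "psi_series \<mu>" and ?R = "cumulant_series \<kappa>"
  have R: "fps_nth ?R 0 = 0" "fps_nth ?R 1 \<noteq> 0"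
    using nz cumulant_relation_1[OF rel] by (simp_all add: cumulant_series_nth_1)
  have P: "fps_nth ?\<psi> 0 = 0" "fps_nth ?\<psi> 1 \<noteq> 0"
    using nz by (simp_all add: psi_series_nth_1)
  have i0: "fps_nth (fps_inv ?\<psi>) 0 = 0" by (simp add: fps_inv_def)
  have "fps_inv ?R oo ?\<psi> = fps_inv ?R oo (?R oo (fps_X * (1 + ?\<psi>)))"
    using rel by (metis cumulant_relation_def)
  also have "\<dots> = fps_X * (1 + ?\<psi>)"
    using R by (simp add: fps_compose_assoc fps_inv)
  finally have eq: "fps_inv ?R oo ?\<psi> = fps_X * (1 + ?\<psi>)" .
  have "fps_inv ?R = (fps_inv ?R oo ?\<psi>) oo fps_inv ?\<psi>"
    using P i0 by (simp add: fps_compose_assoc[symmetric] fps_inv_right)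
  also have "\<dots> = fps_inv ?\<psi> * (1 + fps_X)"
    using P i0 by (simp add: eq fps_compose_mult_distrib fps_compose_add_distrib fps_inv_right)
  finally show ?thesis
    by (simp add: S_transform_eq algebra_simps)
qed

section \<open>Noncommutative polynomials and the Schwinger-Dyson equation\<close>

lemma poly_mapping_sum_single: "P = (\<Sum>w\<in>Poly_Mapping.keys P. Poly_Mapping.single w (Poly_Mapping.lookup P w))"
proof (rule poly_mapping_eqI)
  fix v
  have "(\<Sum>w\<in>Poly_Mapping.keys P. Poly_Mapping.lookup (Poly_Mapping.single w (Poly_Mapping.lookup P w)) v)
      = (\<Sum>w\<in>Poly_Mapping.keys P. if w = v then Poly_Mapping.lookup P v else 0)"
    by (intro sum.cong refl) (auto simp: lookup_single)
  also have "\<dots> = Poly_Mapping.lookup P v"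
    by (auto simp: in_keys_iff)
  finally show "Poly_Mapping.lookup P v
      = Poly_Mapping.lookup (\<Sum>w\<in>Poly_Mapping.keys P. Poly_Mapping.single w (Poly_Mapping.lookup P w)) v"
    by (simp add: lookup_sum)
qed

lemma lin_ext_superset:
  assumes "finite S" "Poly_Mapping.keys P \<subseteq> S"
  shows "lin_ext \<phi> P = (\<Sum>w\<in>S. Poly_Mapping.lookup P w * \<phi> w)"
  unfolding lin_ext_def using assms by (intro sum.mono_neutral_left) (auto simp: in_keys_iff)

lemma lin_ext_zero [simp]: "lin_ext \<phi> 0 = 0"
  by (simp add: lin_ext_def)

lemma lin_ext_single [simp]: "lin_ext \<phi> (Poly_Mapping.single w c) = c * \<phi> w"
  by (subst lin_ext_superset[of "{w}"]) auto

lemma lin_ext_one [simp]: "lin_ext \<phi> 1 = \<phi> 0"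
  using lin_ext_single[of \<phi> 0 1] by simp

lemma lin_ext_add: "lin_ext \<phi> (P + Q) = lin_ext \<phi> P + lin_ext \<phi> Q"
proof -
  let ?S = "Poly_Mapping.keys P \<union> Poly_Mapping.keys Q"
  have "lin_ext \<phi> (P + Q) = (\<Sum>w\<in>?S. Poly_Mapping.lookup (P + Q) w * \<phi> w)"
    by (rule lin_ext_superset) (simp_all add: keys_add)
  also have "\<dots> = (\<Sum>w\<in>?S. Poly_Mapping.lookup P w * \<phi> w) + (\<Sum>w\<in>?S. Poly_Mapping.lookup Q w * \<phi> w)"
    by (simp add: lookup_add distrib_right sum.distrib)
  also have "\<dots> = lin_ext \<phi> P + lin_ext \<phi> Q"
    by (simp add: lin_ext_superset[of ?S])
  finally show ?thesis .
qed

lemma lin_ext_diff: "lin_ext \<phi> (P - Q) = lin_ext \<phi> P - lin_ext \<phi> Q"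
  using lin_ext_add[of \<phi> "P - Q" Q] by simp

lemma lin_ext_sum: "lin_ext \<phi> (\<Sum>x\<in>X. f x) = (\<Sum>x\<in>X. lin_ext \<phi> (f x))"
  by (induction X rule: infinite_finite_induct) (auto simp: lin_ext_add)

lemma lin_ext_cong: "(\<And>w. w \<in> Poly_Mapping.keys P \<Longrightarrow> f w = g w) \<Longrightarrow> lin_ext f P = lin_ext g P"
  by (simp add: lin_ext_def)

lemma lin_ext_eq_0: "(\<And>w. w \<in> Poly_Mapping.keys P \<Longrightarrow> f w = 0) \<Longrightarrow> lin_ext f P = 0"
  by (simp add: lin_ext_def)

lemma lin_ext_fun_add: "lin_ext (\<lambda>w. f w + g w) P = lin_ext f P + lin_ext g P"
  by (simp add: lin_ext_def distrib_left sum.distrib)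

lemma lin_ext_fun_mult_left: "lin_ext (\<lambda>w. c * f w) P = c * lin_ext f P"
  by (simp add: lin_ext_def sum_distrib_left mult.left_commute)

lemma lin_ext_fun_mult_right: "lin_ext (\<lambda>w. f w * c) P = lin_ext f P * c"
  by (simp add: lin_ext_def sum_distrib_right mult.assoc)

lemma lin_ext_fun_sum: "lin_ext (\<lambda>w. \<Sum>x\<in>X. f x w) P = (\<Sum>x\<in>X. lin_ext (f x) P)"
  unfolding lin_ext_def sum_distrib_left by (rule sum.swap)

lemma lin_ext_swap: "lin_ext (\<lambda>v. lin_ext (h v) Q) P = lin_ext (\<lambda>w. lin_ext (\<lambda>v. h v w) P) Q"
  unfolding lin_ext_def sum_distrib_left by (subst sum.swap) (simp add: mult.left_commute)

text \<open>Together with \<open>lin_ext_swap\<close> this reduces multilinear identities between polynomials to identities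
  between words.\<close>

lemma lin_ext_mult: "lin_ext \<phi> (P * Q) = lin_ext (\<lambda>v. lin_ext (\<lambda>w. \<phi> (v + w)) Q) P"
proof -
  have "P * Q = (\<Sum>v\<in>Poly_Mapping.keys P. \<Sum>w\<in>Poly_Mapping.keys Q.
      Poly_Mapping.single (v + w) (Poly_Mapping.lookup P v * Poly_Mapping.lookup Q w))"
    by (subst poly_mapping_sum_single[of P], subst poly_mapping_sum_single[of Q])
       (simp add: sum_product mult_single)
  then show ?thesis
    by (simp add: lin_ext_sum) (simp add: lin_ext_def sum_distrib_left mult.assoc)
qed

abbreviation nc_const :: "complex \<Rightarrow> 'i nc_poly" where
  "nc_const c \<equiv> Poly_Mapping.single 0 c"

abbreviation nc_mon :: "'i list \<Rightarrow> 'i nc_poly" where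
  "nc_mon w \<equiv> Poly_Mapping.single (NC_Word w) 1"

lemma lin_ext_const_mult [simp]: "lin_ext \<phi> (nc_const c * P) = c * lin_ext \<phi> P"
  by (simp add: lin_ext_mult)

lemma nc_const_central: "P * nc_const c = nc_const c * P"
proof -
  have "(\<Sum>w\<in>Poly_Mapping.keys P. Poly_Mapping.single w (Poly_Mapping.lookup P w)) * nc_const c
      = nc_const c * (\<Sum>w\<in>Poly_Mapping.keys P. Poly_Mapping.single w (Poly_Mapping.lookup P w))"
    by (simp add: sum_distrib_left sum_distrib_right mult_single mult.commute)
  then show ?thesis
    by (simp only: poly_mapping_sum_single[symmetric])
qed

lemma letters_plus [simp]: "letters (v + w) = letters v @ letters w"
  by (simp add: plus_nc_word_def)

lemma letters_zero [simp]: "letters 0 = []"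
  by (simp add: zero_nc_word_def)

lemma NC_Word_plus [simp]: "NC_Word v + NC_Word w = NC_Word (v @ w)"
  by (simp add: plus_nc_word_def)

lemma NC_Word_Nil: "NC_Word [] = 0"
  by (simp add: zero_nc_word_def)

lemma nc_mon_append: "nc_mon (v @ w) = nc_mon v * nc_mon w"
  by (simp add: mult_single)

lemma nc_mon_Nil [simp]: "nc_mon [] = 1"
  by (simp add: NC_Word_Nil)

lemma nc_subalg_const [simp, intro]: "nc_const c \<in> nc_subalg S"
  by (simp add: nc_subalg_def)

lemma nc_subalg_mon: "nc_mon w \<in> nc_subalg S \<longleftrightarrow> set w \<subseteq> S"
  by (simp add: nc_subalg_def)

lemma nc_subalg_one [simp, intro]: "1 \<in> nc_subalg S"
  using nc_subalg_const[of 1] by simp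

lemma nc_subalg_mult: "P \<in> nc_subalg S \<Longrightarrow> Q \<in> nc_subalg S \<Longrightarrow> P * Q \<in> nc_subalg S"
  unfolding nc_subalg_def using keys_mult[of P Q] by fastforce

lemma nc_subalg_diff: "P \<in> nc_subalg S \<Longrightarrow> Q \<in> nc_subalg S \<Longrightarrow> P - Q \<in> nc_subalg S"
  unfolding nc_subalg_def using keys_diff[of P Q] by blast

lemma nc_subalg_prod_list: "(\<And>a. a \<in> set as \<Longrightarrow> a \<in> nc_subalg S) \<Longrightarrow> prod_list as \<in> nc_subalg S"
  by (induction as) (auto intro: nc_subalg_mult)

lemma nc_subalg_mono: "S \<subseteq> T \<Longrightarrow> nc_subalg S \<subseteq> nc_subalg T"
  unfolding nc_subalg_def by blast

definition centered :: "('i nc_word \<Rightarrow> complex) \<Rightarrow> ('g \<Rightarrow> 'i set) \<Rightarrow> 'g \<Rightarrow> 'i nc_poly \<Rightarrow> bool" where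
  "centered \<phi> A j a \<longleftrightarrow> a \<in> nc_subalg (A j) \<and> lin_ext \<phi> a = 0"

lemma free_family_iff:
  "free_family (lin_ext \<phi>) J (\<lambda>j. nc_subalg (A j)) \<longleftrightarrow>
     (\<forall>js as. as \<noteq> [] \<longrightarrow> set js \<subseteq> J \<longrightarrow> distinct_adj js \<longrightarrow> list_all2 (centered \<phi> A) js as
        \<longrightarrow> lin_ext \<phi> (prod_list as) = 0)"
  unfolding free_family_def centered_def list_all2_conv_all_nth by metis

locale free_functional =
  fixes \<phi> :: "'i nc_word \<Rightarrow> complex" and J :: "'g set" and A :: "'g \<Rightarrow> 'i set"
  assumes unit: "\<phi> 0 = 1"
    and free: "free_family (lin_ext \<phi>) J (\<lambda>j. nc_subalg (A j))"
begin

definition alternating :: "'g list \<Rightarrow> 'i nc_poly list \<Rightarrow> bool" where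
  "alternating js as \<longleftrightarrow> set js \<subseteq> J \<and> distinct_adj js \<and> list_all2 (centered \<phi> A) js as"

lemma alternating_zero: "alternating js as \<Longrightarrow> as \<noteq> [] \<Longrightarrow> lin_ext \<phi> (prod_list as) = 0"
  using free unfolding free_family_iff alternating_def by blast

lemma centered_diff:
  assumes "P \<in> nc_subalg (A j)"
  shows "centered \<phi> A j (P - nc_const (lin_ext \<phi> P))"
  using assms by (simp add: centered_def nc_subalg_diff lin_ext_diff unit)

lemma alternating_ConsD:
  assumes "alternating (j # js) as"
  obtains a as' where "as = a # as'" "alternating js as'" "centered \<phi> A j a"
  using assms by (auto simp: alternating_def list_all2_Cons1 dest: distinct_adj_ConsD)

lemma alternating_replace_hd:
  assumes "alternating (j # js) (a # as)" "centered \<phi> A j b"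
  shows "alternating (j # js) (b # as)"
  using assms by (auto simp: alternating_def)

lemma lin_ext_subalg_alternating:
  assumes "P \<in> nc_subalg (A j)" "j \<in> J" "alternating js as" "js = [] \<or> hd js \<noteq> j" "as \<noteq> []"
  shows "lin_ext \<phi> (P * prod_list as) = 0"
proof -
  let ?c = "lin_ext \<phi> P"
  have "alternating (j # js) ((P - nc_const ?c) # as)"
    using assms centered_diff[OF assms(1)] by (cases js) (auto simp: alternating_def)
  then have "lin_ext \<phi> (prod_list ((P - nc_const ?c) # as)) = 0" by (rule alternating_zero) simp
  moreover have "P * prod_list as = prod_list ((P - nc_const ?c) # as) + nc_const ?c * prod_list as"
    by (simp add: algebra_simps)
  ultimately show ?thesis
    using alternating_zero[OF assms(3,5)] by (simp add: lin_ext_add)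
qed

lemma lin_ext_alternating_subalg:
  assumes "P \<in> nc_subalg (A j)" "j \<in> J" "alternating js as" "js = [] \<or> last js \<noteq> j" "as \<noteq> []"
  shows "lin_ext \<phi> (prod_list as * P) = 0"
proof -
  let ?c = "lin_ext \<phi> P"
  have "alternating (js @ [j]) (as @ [P - nc_const ?c])"
    using assms centered_diff[OF assms(1)]
    by (auto simp: alternating_def distinct_adj_append_iff intro!: list_all2_appendI)
  then have "lin_ext \<phi> (prod_list (as @ [P - nc_const ?c])) = 0" by (rule alternating_zero) simp
  moreover have "prod_list as * P = prod_list (as @ [P - nc_const ?c]) + nc_const ?c * prod_list as"
    by (simp add: algebra_simps nc_const_central)
  ultimately show ?thesis
    using alternating_zero[OF assms(3,5)] by (simp add: lin_ext_add)
qed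

text \<open>The alternating products of centered elements span the algebra generated by all variables: a
  letter times such a product is, after centering the letter or its product with the first factor,
  a linear combination of two such products.\<close>

lemma linear_functional_zero:
  assumes add: "\<And>P Q. L (P + Q) = L P + L Q" and scale: "\<And>c P. L (nc_const c * P) = c * (L P :: complex)"
    and alt: "\<And>js as. alternating js as \<Longrightarrow> L (prod_list as) = 0"
    and w: "w \<in> lists (\<Union>j\<in>J. A j)"
  shows "L (nc_mon w) = 0"
proof -
  have "\<forall>js as. alternating js as \<longrightarrow> L (nc_mon w * prod_list as) = 0"
    using w
  proof (induction w rule: rev_induct)
    case Nil
    then show ?case using alt by simp
  next
    case (snoc x w)
    define L' where "L' P = L (nc_mon w * P)" for P
    have L': "L' (prod_list as) = 0" if "alternating js as" for js as
      unfolding L'_def using snoc that by auto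
    have split: "L' (P * Q) = L' ((P - nc_const c) * Q) + c * L' Q" for P Q c
    proof -
      have "nc_mon w * (P * Q) = nc_mon w * ((P - nc_const c) * Q) + nc_const c * (nc_mon w * Q)"
        by (simp add: algebra_simps nc_const_central[symmetric])
      then show ?thesis unfolding L'_def by (simp add: add scale)
    qed
    obtain j where j: "j \<in> J" "x \<in> A j" using snoc by auto
    have x: "nc_mon [x] \<in> nc_subalg (A j)" using j by (simp add: nc_subalg_mon)
    show ?case
    proof (intro allI impI)
      fix js as assume alt: "alternating js as"
      have "L' (nc_mon [x] * prod_list as) = 0"
      proof (cases "js \<noteq> [] \<and> hd js = j")
        case True
        then obtain js' where js: "js = j # js'" by (cases js) auto
        obtain a as' where as: "as = a # as'" "alternating js' as'" "centered \<phi> A j a"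
          using alternating_ConsD alt unfolding js by blast
        let ?b = "nc_mon [x] * a"
        have "?b \<in> nc_subalg (A j)" using as(3) x by (auto simp: centered_def intro: nc_subalg_mult)
        then have "alternating js ((?b - nc_const (lin_ext \<phi> ?b)) # as')"
          using alternating_replace_hd alt centered_diff unfolding js as(1) by blast
        then show ?thesis
          using split[of ?b "prod_list as'" "lin_ext \<phi> ?b"] L'[OF as(2)] L'
          by (force simp: as(1) mult.assoc)
      next
        case False
        then have "alternating (j # js) ((nc_mon [x] - nc_const (lin_ext \<phi> (nc_mon [x]))) # as)"
          using alt j centered_diff[OF x] by (cases js) (auto simp: alternating_def)
        then show ?thesis
          using split[of "nc_mon [x]" "prod_list as" "lin_ext \<phi> (nc_mon [x])"] L'[OF alt] L'
          by force
      qed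
      then show "L (nc_mon (w @ [x]) * prod_list as) = 0"
        unfolding L'_def nc_mon_append by (simp add: mult.assoc)
    qed
  qed
  moreover have "alternating [] []" by (simp add: alternating_def)
  ultimately show ?thesis by force
qed

end

text \<open>The sum over all factorizations \<open>P Q = q\<^sub>1 y q\<^sub>2 y \<dots> y q\<^sub>s\<close> that do not cut \<open>P\<close>, with weight
  \<open>\<kappa> (n + s - 1) \<phi>(q\<^sub>1) \<dots> \<phi>(q\<^sub>s)\<close>, computed letter by letter: \<open>P\<close> is the part of the current factor that
  has been read, and every \<open>y\<close> in \<open>Q\<close> is either a letter of this factor or its end.\<close>

fun block_sum :: "(nat \<Rightarrow> complex) \<Rightarrow> ('i nc_word \<Rightarrow> complex) \<Rightarrow> 'i \<Rightarrow> nat \<Rightarrow> 'i list \<Rightarrow> 'i list \<Rightarrow> complex" where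
  "block_sum \<kappa> \<phi> y n P [] = \<kappa> n * \<phi> (NC_Word P)"
| "block_sum \<kappa> \<phi> y n P (x # Q) = block_sum \<kappa> \<phi> y n (P @ [x]) Q
     + (if x = y then \<phi> (NC_Word P) * block_sum \<kappa> \<phi> y (Suc n) [] Q else 0)"

lemma block_sum_skip:
  "y \<notin> set a \<Longrightarrow> block_sum \<kappa> \<phi> y n P (a @ Q) = block_sum \<kappa> \<phi> y n (P @ a) Q"
  by (induction a arbitrary: P) auto

lemma block_sum_replicate:
  "block_sum \<kappa> \<phi> y n P (replicate k y @ Q) = block_sum \<kappa> \<phi> y n (P @ replicate k y) Q
     + (\<Sum>i<k. \<phi> (NC_Word (P @ replicate i y)) * block_sum \<kappa> \<phi> y (Suc n) [] (replicate (k - 1 - i) y @ Q))"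
proof (induction k arbitrary: P)
  case (Suc k)
  have "block_sum \<kappa> \<phi> y n P (replicate (Suc k) y @ Q)
      = block_sum \<kappa> \<phi> y n (P @ [y]) (replicate k y @ Q)
        + \<phi> (NC_Word P) * block_sum \<kappa> \<phi> y (Suc n) [] (replicate k y @ Q)" by simp
  also have "\<dots> = block_sum \<kappa> \<phi> y n (P @ replicate (Suc k) y) Q
     + ((\<Sum>i<k. \<phi> (NC_Word (P @ replicate (Suc i) y)) * block_sum \<kappa> \<phi> y (Suc n) [] (replicate (k - 1 - i) y @ Q))
        + \<phi> (NC_Word P) * block_sum \<kappa> \<phi> y (Suc n) [] (replicate k y @ Q))"
    by (subst Suc.IH) simp
  finally show ?case
    by (subst sum.lessThan_Suc_shift) simp
qed simp

text \<open>The Schwinger-Dyson equation for a power of \<open>y\<close> alone is the moment-cumulant formula.\<close>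

lemma block_sum_moments:
  assumes "cumulant_relation (\<lambda>k. \<phi> (NC_Word (replicate k y))) \<kappa>"
  shows "block_sum \<kappa> \<phi> y 1 [] (replicate k y) = \<phi> (NC_Word (replicate (Suc k) y))"
proof (rule cumulant_relation_recursion[OF assms, where H = "\<lambda>s n. block_sum \<kappa> \<phi> y s [] (replicate n y)"])
  fix s n
  show "block_sum \<kappa> \<phi> y s [] (replicate n y) = \<kappa> s * \<phi> (NC_Word (replicate n y))
    + (\<Sum>i<n. \<phi> (NC_Word (replicate i y)) * block_sum \<kappa> \<phi> y (Suc s) [] (replicate (n - 1 - i) y))"
    using block_sum_replicate[of \<kappa> \<phi> y s "[]" n "[]"] by simp
qed

text \<open>The linear functional on the tensor square with prescribed values on pairs of words.\<close>

definition bilin_ext :: "('i nc_word \<Rightarrow> 'i nc_word \<Rightarrow> complex) \<Rightarrow> 'i nc_poly \<Rightarrow> 'i nc_poly \<Rightarrow> complex" where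
  "bilin_ext h P Q = lin_ext (\<lambda>v. lin_ext (h v) Q) P"

lemma bilin_ext_mult_right:
  "bilin_ext h P (a * Q) = lin_ext (\<lambda>x. bilin_ext (\<lambda>v w. h v (x + w)) P Q) a"
  unfolding bilin_ext_def lin_ext_mult[of "h _"] by (rule lin_ext_swap)

lemma bilin_ext_mult_left:
  "bilin_ext h (P * a) Q = lin_ext (\<lambda>x. bilin_ext (\<lambda>v w. h (v + x) w) P Q) a"
  unfolding bilin_ext_def lin_ext_mult[of "\<lambda>v. lin_ext (h v) Q"] by (rule lin_ext_swap)

lemma bilin_ext_one_left [simp]: "bilin_ext h 1 Q = lin_ext (h 0) Q"
  by (simp add: bilin_ext_def)

text \<open>The variable \<open>y\<close> alone forms one of the free families.\<close>

locale free_variable = free_functional \<phi> J A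
  for \<phi> :: "'i nc_word \<Rightarrow> complex" and J :: "'g set" and A +
  fixes j0 :: 'g and y :: 'i and \<kappa> :: "nat \<Rightarrow> complex"
  assumes j0: "j0 \<in> J" and A_j0: "A j0 = {y}"
    and y_notin: "\<And>j. j \<in> J \<Longrightarrow> j \<noteq> j0 \<Longrightarrow> y \<notin> A j"
    and cumulants: "cumulant_relation (\<lambda>k. \<phi> (NC_Word (replicate k y))) \<kappa>"
begin

text \<open>The extension of \<open>block_sum\<close> to polynomials makes sense of cutting a centered polynomial in \<open>y\<close>
  between two of its letters.\<close>

definition blocks :: "nat \<Rightarrow> 'i nc_poly \<Rightarrow> 'i nc_poly \<Rightarrow> complex" where
  "blocks n = bilin_ext (\<lambda>v w. block_sum \<kappa> \<phi> y n (letters v) (letters w))"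

lemma blocks_one: "blocks n P 1 = \<kappa> n * lin_ext \<phi> P"
  by (simp add: blocks_def bilin_ext_def lin_ext_fun_mult_left)

lemma blocks_skip:
  assumes "a \<in> nc_subalg (A j)" "j \<in> J" "j \<noteq> j0"
  shows "blocks n P (a * Q) = blocks n (P * a) Q"
  unfolding blocks_def bilin_ext_mult_right bilin_ext_mult_left
proof (rule lin_ext_cong)
  fix x assume "x \<in> Poly_Mapping.keys a"
  then have "y \<notin> set (letters x)"
    using assms y_notin unfolding nc_subalg_def by blast
  then show "bilin_ext (\<lambda>v w. block_sum \<kappa> \<phi> y n (letters v) (letters (x + w))) P Q
      = bilin_ext (\<lambda>v w. block_sum \<kappa> \<phi> y n (letters (v + x)) (letters w)) P Q"
    by (simp add: block_sum_skip)
qed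

lemma keys_power:
  assumes "p \<in> nc_subalg (A j0)" "x \<in> Poly_Mapping.keys p"
  obtains k where "x = NC_Word (replicate k y)"
proof -
  have "set (letters x) \<subseteq> {y}" using assms by (auto simp: nc_subalg_def A_j0)
  then have "letters x = replicate (length (letters x)) y"
    by (metis replicate_length_same singletonD subsetD)
  then show ?thesis using that by (metis nc_word.collapse)
qed

lemma blocks_power:
  "bilin_ext (\<lambda>v w. block_sum \<kappa> \<phi> y n (letters v) (replicate k y @ letters w)) P Q
   = bilin_ext (\<lambda>v w. block_sum \<kappa> \<phi> y n (letters v @ replicate k y) (letters w)) P Q
     + (\<Sum>i<k. lin_ext \<phi> (P * nc_mon (replicate i y)) * blocks (Suc n) 1 (nc_mon (replicate (k - 1 - i) y) * Q))"
proof -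
  have 1: "lin_ext \<phi> (P * nc_mon (replicate i y)) = lin_ext (\<lambda>v. \<phi> (NC_Word (letters v @ replicate i y))) P" for i
    by (simp add: lin_ext_mult plus_nc_word_def)
  have 2: "blocks (Suc n) 1 (nc_mon u * Q) = lin_ext (\<lambda>w. block_sum \<kappa> \<phi> y (Suc n) [] (u @ letters w)) Q" for u
    unfolding blocks_def bilin_ext_mult_right by simp
  have "bilin_ext (\<lambda>v w. block_sum \<kappa> \<phi> y n (letters v) (replicate k y @ letters w)) P Q
    = bilin_ext (\<lambda>v w. block_sum \<kappa> \<phi> y n (letters v @ replicate k y) (letters w)
        + (\<Sum>i<k. \<phi> (NC_Word (letters v @ replicate i y))
            * block_sum \<kappa> \<phi> y (Suc n) [] (replicate (k - 1 - i) y @ letters w))) P Q"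
    by (rule arg_cong[where f = "\<lambda>h. bilin_ext h P Q"], intro ext block_sum_replicate)
  then show ?thesis
    by (simp only: bilin_ext_def lin_ext_fun_add lin_ext_fun_sum
      lin_ext_fun_mult_left lin_ext_fun_mult_right 1 2)
qed

text \<open>Every cut inside \<open>p\<close> produces a factor \<open>\<phi>(P y\<^sup>i)\<close>.\<close>

lemma blocks_absorb:
  assumes p: "p \<in> nc_subalg (A j0)" and P: "\<And>i. lin_ext \<phi> (P * nc_mon (replicate i y)) = 0"
  shows "blocks n P (p * Q) = blocks n (P * p) Q"
  unfolding blocks_def bilin_ext_mult_right bilin_ext_mult_left
proof (rule lin_ext_cong)
  fix x assume "x \<in> Poly_Mapping.keys p"
  then obtain k where "x = NC_Word (replicate k y)" using keys_power p by blast
  then show "bilin_ext (\<lambda>v w. block_sum \<kappa> \<phi> y n (letters v) (letters (x + w))) P Q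
      = bilin_ext (\<lambda>v w. block_sum \<kappa> \<phi> y n (letters (v + x)) (letters w)) P Q"
    using blocks_power[of n k P Q] by (simp add: P)
qed

text \<open>All cuts vanish: the piece in front of the first cut is an alternating product times a power of
  \<open>y\<close>, and the piece without any cut is itself an alternating product.\<close>

lemma blocks_alternating:
  assumes "alternating (js @ js') (as @ bs)" "length js = length as" "as \<noteq> []"
  shows "blocks n (prod_list as) (prod_list bs) = 0"
  using assms
proof (induction bs arbitrary: js js' as)
  case Nil
  then have "js' = []" by (auto simp: alternating_def dest: list_all2_lengthD)
  then show ?case
    using Nil alternating_zero by (simp add: blocks_one)
next
  case (Cons b bs)
  have "length (js @ js') = length (as @ b # bs)"
    using Cons.prems by (auto simp: alternating_def dest: list_all2_lengthD)
  then obtain j js'' where js': "js' = j # js''"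
    using Cons.prems by (cases js') auto
  have la: "list_all2 (centered \<phi> A) js as" "centered \<phi> A j b" and j: "j \<in> J"
    using Cons.prems by (auto simp: alternating_def js' list_all2_append)
  have "distinct_adj (js @ j # js'')" "set js \<subseteq> J" using Cons.prems by (auto simp: alternating_def js')
  then have da: "distinct_adj js" "js \<noteq> []" "last js \<noteq> j"
    using Cons.prems by (auto simp: distinct_adj_append_iff)
  have as: "alternating js as"
    using la da \<open>set js \<subseteq> J\<close> by (simp add: alternating_def)
  have "blocks n (prod_list as) (b * prod_list bs) = blocks n (prod_list as * b) (prod_list bs)"
  proof (cases "j = j0")
    case False
    then show ?thesis using la j by (intro blocks_skip) (auto simp: centered_def)
  next
    case True
    have "lin_ext \<phi> (prod_list as * nc_mon (replicate i y)) = 0" for i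
      by (rule lin_ext_alternating_subalg[OF _ j0 as])
         (use True da Cons.prems in \<open>auto simp: nc_subalg_mon A_j0\<close>)
    then show ?thesis using la True by (intro blocks_absorb) (auto simp: centered_def)
  qed
  also have "\<dots> = blocks n (prod_list (as @ [b])) (prod_list bs)" by simp
  also have "\<dots> = 0"
    using Cons.IH[of "js @ [j]" js'' "as @ [b]"] Cons.prems by (simp add: js')
  finally show ?case by simp
qed

text \<open>If the first cut inside the power is at position \<open>i\<close>, then what follows is again a power times the
  same alternating product, with one more cumulant used.\<close>

lemma blocks_power_alternating:
  assumes alt: "alternating (j # js) (a # as)" and j: "j \<noteq> j0"
  shows "blocks n 1 (nc_mon (replicate k y) * (a * prod_list as)) = 0"
proof (induction k arbitrary: n rule: less_induct)
  case (less k)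
  let ?R = "a * prod_list as" and ?p = "nc_mon (replicate k y)"
  let ?c = "lin_ext \<phi> ?p"
  have jJ: "j \<in> J" and a: "a \<in> nc_subalg (A j)"
    using alt by (auto simp: alternating_def centered_def)
  have R0: "blocks n 1 ?R = 0"
    using blocks_skip[OF a jJ j, of n 1 "prod_list as"] blocks_alternating[of "[j]" js "[a]" as n] alt
    by simp
  have "alternating ([j0] @ (j # js)) ([?p - nc_const ?c] @ (a # as))"
    using alt j j0 centered_diff[of ?p j0]
    by (auto simp: alternating_def nc_subalg_mon A_j0 set_replicate_conv_if)
  then have "blocks n (?p - nc_const ?c) ?R = 0"
    using blocks_alternating[of "[j0]" "j # js" "[?p - nc_const ?c]" "a # as" n] by simp
  moreover have "blocks n ?p ?R = blocks n (?p - nc_const ?c) ?R + ?c * blocks n 1 ?R"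
    unfolding blocks_def bilin_ext_def lin_ext_diff by simp
  ultimately have "blocks n ?p ?R = 0" using R0 by simp
  moreover have "blocks n 1 (?p * ?R) = blocks n ?p ?R
     + (\<Sum>i<k. lin_ext \<phi> (nc_mon (replicate i y)) * blocks (Suc n) 1 (nc_mon (replicate (k - 1 - i) y) * ?R))"
    using blocks_power[of n k 1 ?R] unfolding blocks_def bilin_ext_mult_right by (simp add: bilin_ext_def)
  ultimately show ?case
    using less by simp
qed

text \<open>Both sides are linear in \<open>w\<close>, so let \<open>w\<close> be an alternating product of centered elements. If it is a
  polynomial in \<open>y\<close>, this is the moment-cumulant formula. Otherwise \<open>y w\<close> is up to centering its first
  factor a combination of alternating products, and both sides are zero.\<close>

theorem schwinger_dyson:
  assumes w: "w \<in> lists (\<Union>j\<in>J. A j)"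
  shows "\<phi> (NC_Word (y # w)) = block_sum \<kappa> \<phi> y 1 [] w"
proof -
  define L where "L P = lin_ext \<phi> (nc_mon [y] * P) - blocks 1 1 P" for P
  have ymem: "nc_mon [y] \<in> nc_subalg (A j0)" by (simp add: nc_subalg_mon A_j0)
  have "L (nc_mon w) = 0"
  proof (rule linear_functional_zero[OF _ _ _ w])
    show "L (P + Q) = L P + L Q" for P Q
      unfolding L_def blocks_def by (simp add: distrib_left lin_ext_add)
    show "L (nc_const c * P) = c * L P" for c P
    proof -
      have "nc_mon [y] * (nc_const c * P) = nc_const c * (nc_mon [y] * P)"
        by (metis mult.assoc nc_const_central)
      then show ?thesis unfolding L_def blocks_def by (simp add: right_diff_distrib)
    qed
    fix js as assume alt: "alternating js as"
    have pow: "lin_ext \<phi> (nc_mon [y] * p) = blocks 1 1 p" if p: "p \<in> nc_subalg (A j0)" for p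
    proof -
      have "lin_ext \<phi> (nc_mon [y] * p) = lin_ext (\<lambda>x. \<phi> (NC_Word [y] + x)) p"
        by (simp add: lin_ext_mult)
      also have "\<dots> = lin_ext (\<lambda>x. block_sum \<kappa> \<phi> y 1 [] (letters x)) p"
      proof (rule lin_ext_cong)
        fix x assume "x \<in> Poly_Mapping.keys p"
        then obtain k where "x = NC_Word (replicate k y)" using keys_power p by blast
        then show "\<phi> (NC_Word [y] + x) = block_sum \<kappa> \<phi> y 1 [] (letters x)"
          using block_sum_moments[OF cumulants, of k] by simp
      qed
      finally show ?thesis by (simp add: blocks_def)
    qed
    show "L (prod_list as) = 0"
    proof (cases js)
      case Nil
      then have "as = []" using alt by (simp add: alternating_def)
      then show ?thesis using pow[of 1] by (simp add: L_def)
    next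
      case (Cons j js')
      obtain a as' where as: "as = a # as'" "alternating js' as'" "centered \<phi> A j a"
        using alternating_ConsD alt unfolding Cons by blast
      have jJ: "j \<in> J" using alt Cons by (simp add: alternating_def)
      have a: "a \<in> nc_subalg (A j)" using as by (simp add: centered_def)
      show ?thesis
      proof (cases "j = j0")
        case False
        have "blocks 1 1 (prod_list as) = 0"
          using blocks_skip[OF a jJ False, of 1 1 "prod_list as'"]
            blocks_alternating[of "[j]" js' "[a]" as' 1] alt
          by (simp add: as Cons)
        moreover have "lin_ext \<phi> (nc_mon [y] * prod_list as) = 0"
          by (rule lin_ext_subalg_alternating[OF ymem j0 alt]) (use False Cons as in auto)
        ultimately show ?thesis by (simp add: L_def)
      next
        case True
        show ?thesis
        proof (cases js')
          case Nil
          then have "as' = []" using as by (simp add: alternating_def)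
          then show ?thesis using pow[of a] a True by (simp add: L_def as)
        next
          case (Cons j2 js2)
          then obtain a2 as2 where as': "as' = a2 # as2"
            using alternating_ConsD as by metis
          have ne: "j2 \<noteq> j0" using alt \<open>js = j # js'\<close> Cons True by (auto simp: alternating_def)
          have "lin_ext \<phi> ((nc_mon [y] * a) * prod_list as') = 0"
            by (rule lin_ext_subalg_alternating[OF _ j0 as(2)])
               (use nc_subalg_mult[OF ymem] a True ne Cons as' in auto)
          moreover have "blocks 1 1 (a * prod_list as') = 0"
            unfolding blocks_def bilin_ext_mult_right
          proof (rule lin_ext_eq_0)
            fix x assume "x \<in> Poly_Mapping.keys a"
            then obtain k where "x = NC_Word (replicate k y)" using keys_power a True by blast
            moreover have "blocks 1 1 (nc_mon (replicate k y) * prod_list as') = 0"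
              using blocks_power_alternating[of j2 js2 a2 as2 1 k] as(2) ne by (simp add: Cons as')
            ultimately show "bilin_ext (\<lambda>v w. block_sum \<kappa> \<phi> y 1 (letters v) (letters (x + w))) 1 (prod_list as') = 0"
              unfolding blocks_def bilin_ext_mult_right[of _ 1 "nc_mon _"]
              by (simp only: lin_ext_single mult_1_left)
          qed
          ultimately show ?thesis by (simp add: L_def as mult.assoc)
        qed
      qed
    qed
  qed
  then show ?thesis
    by (simp add: L_def blocks_def mult_single)
qed

end

section \<open>Passing freeness between families\<close>

definition push_word :: "('i \<Rightarrow> 'k) \<Rightarrow> 'i nc_word \<Rightarrow> 'k nc_word" where
  "push_word f w = NC_Word (map f (letters w))"

definition push_poly :: "('i \<Rightarrow> 'k) \<Rightarrow> 'i nc_poly \<Rightarrow> 'k nc_poly" where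
  "push_poly f P = (\<Sum>w\<in>Poly_Mapping.keys P. Poly_Mapping.single (push_word f w) (Poly_Mapping.lookup P w))"

lemma push_word_plus: "push_word f (v + w) = push_word f v + push_word f w"
  by (simp add: push_word_def)

lemma push_word_zero [simp]: "push_word f 0 = 0"
  by (simp add: push_word_def zero_nc_word_def)

lemma lin_ext_push: "lin_ext \<phi> (push_poly f P) = lin_ext (\<lambda>w. \<phi> (push_word f w)) P"
  by (simp add: push_poly_def lin_ext_sum) (simp add: lin_ext_def)

lemma nc_poly_eqI:
  assumes "\<And>\<phi>. lin_ext \<phi> P = lin_ext \<phi> Q"
  shows "P = Q"
proof (rule poly_mapping_eqI)
  have eq: "Poly_Mapping.lookup R w = lin_ext (\<lambda>v. if v = w then 1 else 0) R" for R :: "'i nc_poly" and w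
    by (auto simp: lin_ext_def if_distrib in_keys_iff cong: if_cong)
  show "Poly_Mapping.lookup P w = Poly_Mapping.lookup Q w" for w
    unfolding eq by (rule assms)
qed

text \<open>Comparing the values of all linear functionals avoids computing the coefficients of a product.\<close>

lemma push_poly_mult: "push_poly f (P * Q) = push_poly f P * push_poly f Q"
  by (rule nc_poly_eqI) (simp add: lin_ext_push lin_ext_mult push_word_plus)

lemma push_poly_one [simp]: "push_poly f 1 = 1"
  by (rule nc_poly_eqI) (simp add: lin_ext_push)

lemma push_poly_prod_list: "push_poly f (prod_list as) = prod_list (map (push_poly f) as)"
  by (induction as) (simp_all add: push_poly_mult)

lemma push_poly_subalg:
  assumes "P \<in> nc_subalg S"
  shows "push_poly f P \<in> nc_subalg (f ` S)"
proof -
  have "Poly_Mapping.keys (push_poly f P) \<subseteq> push_word f ` Poly_Mapping.keys P"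
    unfolding push_poly_def by (rule order_trans[OF keys_sum]) auto
  then show ?thesis
    using assms unfolding nc_subalg_def push_word_def by fastforce
qed

text \<open>Renaming variables is an algebra homomorphism, and the functional factors through it on the words
  in question.\<close>

lemma free_family_pullback:
  assumes free: "free_family (lin_ext \<phi>') J (\<lambda>j. nc_subalg (f ` A j))"
    and eq: "\<And>w. w \<in> lists (\<Union>j\<in>J. A j) \<Longrightarrow> \<phi> (NC_Word w) = \<phi>' (NC_Word (map f w))"
  shows "free_family (lin_ext \<phi>) J (\<lambda>j. nc_subalg (A j))"
  unfolding free_family_iff
proof (intro allI impI)
  fix js as
  assume *: "as \<noteq> []" "set js \<subseteq> J" "distinct_adj js" "list_all2 (centered \<phi> A) js as"
  have transfer: "lin_ext \<phi> P = lin_ext \<phi>' (push_poly f P)" if "P \<in> nc_subalg (\<Union>j\<in>J. A j)" for P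
    unfolding lin_ext_push
  proof (rule lin_ext_cong)
    fix w assume "w \<in> Poly_Mapping.keys P"
    then have "letters w \<in> lists (\<Union>j\<in>J. A j)" using that unfolding nc_subalg_def by blast
    then show "\<phi> w = \<phi>' (push_word f w)" using eq[of "letters w"] by (simp add: push_word_def)
  qed
  have sub: "nc_subalg (A j) \<subseteq> nc_subalg (\<Union>j\<in>J. A j)" if "j \<in> J" for j
    by (rule nc_subalg_mono) (use that in blast)
  have "list_all2 (centered \<phi>' (\<lambda>j. f ` A j)) js (map (push_poly f) as)"
    unfolding list_all2_map2 using *(4)
  proof (rule list.rel_mono_strong)
    fix j a assume ja: "j \<in> set js" "centered \<phi> A j a"
    then have "a \<in> nc_subalg (\<Union>j\<in>J. A j)"
      using *(2) sub[of j] by (auto simp: centered_def)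
    then show "centered \<phi>' (\<lambda>j. f ` A j) j (push_poly f a)"
      using transfer[of a] ja(2) by (simp add: centered_def push_poly_subalg)
  qed
  then have "lin_ext \<phi>' (prod_list (map (push_poly f) as)) = 0"
    using *(1-3) free[unfolded free_family_iff[of \<phi>' J "\<lambda>j. f ` A j"], rule_format, of "map (push_poly f) as" js]
    by simp
  moreover have "prod_list as \<in> nc_subalg (\<Union>j\<in>J. A j)"
  proof (rule nc_subalg_prod_list)
    fix a assume "a \<in> set as"
    then obtain i where i: "i < length as" "a = as ! i" by (auto simp: in_set_conv_nth)
    then have "js ! i \<in> set js" "centered \<phi> A (js ! i) a"
      using *(4) by (auto simp: list_all2_conv_all_nth)
    then show "a \<in> nc_subalg (\<Union>j\<in>J. A j)"
      using *(2) sub[of "js ! i"] by (auto simp: centered_def)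
  qed
  ultimately show "lin_ext \<phi> (prod_list as) = 0"
    using transfer by (simp add: push_poly_prod_list)
qed

lemma distinct_adj_appendD: "distinct_adj (xs @ ys) \<Longrightarrow> distinct_adj xs \<and> distinct_adj ys"
  by (simp add: distinct_adj_append_iff)

text \<open>Associativity of freeness. In an alternating product of centered elements, collect maximal runs of
  factors whose families lie in the same coarse family. By freeness inside the coarse family each run
  is centered, so the runs form an alternating product for the coarse families.\<close>

lemma free_family_refine:
  assumes outer: "free_family (lin_ext \<phi>) K (\<lambda>k. nc_subalg (C k))"
    and inner: "\<And>k. k \<in> K \<Longrightarrow> free_family (lin_ext \<phi>) {j \<in> J. \<pi> j = k} (\<lambda>j. nc_subalg (A j))"
    and \<pi>: "\<And>j. j \<in> J \<Longrightarrow> \<pi> j \<in> K \<and> A j \<subseteq> C (\<pi> j)"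
  shows "free_family (lin_ext \<phi>) J (\<lambda>j. nc_subalg (A j))"
proof -
  have group: "\<exists>ks gs. distinct_adj ks \<and> set ks \<subseteq> K \<and> list_all2 (centered \<phi> C) ks gs
      \<and> prod_list gs = prod_list (map snd xs) \<and> gs \<noteq> [] \<and> hd ks = \<pi> (fst (hd xs))"
    if "xs \<noteq> []" "distinct_adj (map fst xs)" "\<forall>(j, a)\<in>set xs. j \<in> J \<and> centered \<phi> A j a" for xs
    using that
  proof (induction xs rule: length_induct)
    case (1 xs)
    let ?k = "\<pi> (fst (hd xs))"
    define run where "run = takeWhile (\<lambda>x. \<pi> (fst x) = ?k) xs"
    define rest where "rest = dropWhile (\<lambda>x. \<pi> (fst x) = ?k) xs"
    have xs: "xs = run @ rest" by (simp add: run_def rest_def)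
    have run_ne: "run \<noteq> []" using 1(2) by (cases xs) (auto simp: run_def)
    have in_run: "\<pi> (fst x) = ?k" if "x \<in> set run" for x
      using set_takeWhileD[OF that[unfolded run_def]] by simp
    have cent: "fst x \<in> J \<and> centered \<phi> A (fst x) (snd x)" if "x \<in> set xs" for x
      using 1(4) that by (auto simp: case_prod_beta)
    have kK: "?k \<in> K" using \<pi> cent[of "hd xs"] 1(2) by auto
    have adj: "distinct_adj (map fst run)" "distinct_adj (map fst rest)"
      using 1(3) distinct_adj_appendD[of "map fst run" "map fst rest"] unfolding xs by auto
    let ?g = "prod_list (map snd run)"
    have "?g \<in> nc_subalg (C ?k)"
    proof (rule nc_subalg_prod_list)
      fix a assume "a \<in> set (map snd run)"
      then obtain x where x: "x \<in> set run" "a = snd x" by auto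
      then have "a \<in> nc_subalg (A (fst x))" "fst x \<in> J"
        using cent[of x] by (auto simp: xs centered_def)
      then show "a \<in> nc_subalg (C ?k)"
        using nc_subalg_mono[of "A (fst x)" "C ?k"] \<pi>[of "fst x"] in_run[OF x(1)] by auto
    qed
    moreover have "lin_ext \<phi> ?g = 0"
    proof -
      have "list_all2 (centered \<phi> A) (map fst run) (map snd run)"
        using cent by (simp add: list_all2_map1 list_all2_map2 list_all2_same xs)
      moreover have "set (map fst run) \<subseteq> {j \<in> J. \<pi> j = ?k}"
        using cent in_run by (auto simp: xs)
      ultimately show ?thesis
        using inner[OF kK, unfolded free_family_iff, rule_format, of "map snd run" "map fst run"] adj(1) run_ne
        by simp
    qed
    ultimately have g: "centered \<phi> C ?k ?g" by (simp add: centered_def)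
    show ?case
    proof (cases "rest = []")
      case True
      then show ?thesis
        using g kK by (intro exI[of _ "[?k]"] exI[of _ "[?g]"]) (simp add: xs)
    next
      case False
      have "length rest < length xs" using run_ne by (simp add: xs)
      moreover have "\<forall>(j, a)\<in>set rest. j \<in> J \<and> centered \<phi> A j a" using 1(4) by (simp add: xs)
      ultimately obtain ks gs where ks: "distinct_adj ks" "set ks \<subseteq> K" "list_all2 (centered \<phi> C) ks gs"
        "prod_list gs = prod_list (map snd rest)" "gs \<noteq> []" "hd ks = \<pi> (fst (hd rest))"
        using 1(1)[rule_format, of rest] adj(2) False by auto
      have "\<pi> (fst (hd rest)) \<noteq> ?k"
        using hd_dropWhile[of "\<lambda>x. \<pi> (fst x) = ?k" xs] False by (simp add: rest_def)
      then have "distinct_adj (?k # ks)" using ks by (cases ks) auto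
      then show ?thesis
        using g kK ks by (intro exI[of _ "?k # ks"] exI[of _ "?g # gs"]) (simp add: xs)
    qed
  qed
  show ?thesis
    unfolding free_family_iff
  proof (intro allI impI)
    fix js as
    assume *: "as \<noteq> []" "set js \<subseteq> J" "distinct_adj js" "list_all2 (centered \<phi> A) js as"
    have len: "length js = length as" using *(4) by (rule list_all2_lengthD)
    let ?xs = "zip js as"
    have "?xs \<noteq> []" "map fst ?xs = js" "map snd ?xs = as" using * len by (auto simp: zip_eq_Nil_iff)
    moreover have "\<forall>(j, a)\<in>set ?xs. j \<in> J \<and> centered \<phi> A j a"
      using *(2,4) by (auto simp: list_all2_iff dest: set_zip_leftD)
    ultimately obtain ks gs where "distinct_adj ks" "set ks \<subseteq> K" "list_all2 (centered \<phi> C) ks gs"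
      "prod_list gs = prod_list as" "gs \<noteq> []"
      using group[of ?xs] *(3) by auto
    then show "lin_ext \<phi> (prod_list as) = 0"
      using outer[unfolded free_family_iff[of \<phi> K C], rule_format, of gs ks] by simp
  qed
qed

lemma free_family_singleton:
  "free_family (lin_ext \<phi>) {j} (\<lambda>j. nc_subalg (A j))"
  unfolding free_family_iff
proof (intro allI impI)
  fix js as
  assume *: "as \<noteq> []" "set js \<subseteq> {j}" "distinct_adj js" "list_all2 (centered \<phi> A) js as"
  have "js = [j]"
    using * by (cases js rule: remdups_adj.cases) auto
  then show "lin_ext \<phi> (prod_list as) = 0"
    using *(4) by (auto simp: list_all2_Cons1 centered_def)
qed


lemma free_family_reindex:
  assumes free: "free_family \<phi> J A" and g: "inj_on g I" "\<And>i. i \<in> I \<Longrightarrow> g i \<in> J \<and> B i = A (g i)"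
  shows "free_family \<phi> I B"
  unfolding free_family_def
proof (intro allI impI)
  fix js as
  assume *: "as \<noteq> []" "length js = length as" "set js \<subseteq> I" "distinct_adj js"
    "\<forall>i<length as. as ! i \<in> B (js ! i) \<and> \<phi> (as ! i) = 0"
  have "distinct_adj (map g js)"
    using *(3,4) g(1) by (intro distinct_adj_mapI) (auto intro: inj_on_subset)
  moreover have "set (map g js) \<subseteq> J" using *(3) g(2) by auto
  moreover have "\<forall>i<length as. as ! i \<in> A (map g js ! i) \<and> \<phi> (as ! i) = 0"
  proof (intro allI impI)
    fix i assume i: "i < length as"
    then have "js ! i \<in> I" using *(2,3) by (metis nth_mem subsetD)
    then show "as ! i \<in> A (map g js ! i) \<and> \<phi> (as ! i) = 0"
      using *(2,5) g(2)[of "js ! i"] i by auto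
  qed
  ultimately show "\<phi> (prod_list as) = 0"
    using free *(1,2) unfolding free_family_def by (metis length_map)
qed

section \<open>Free multiplicative convolution and the S-transform\<close>

text \<open>Words are cut at the letters \<open>y\<close>; the list contains the gaps between them.\<close>

definition interleave :: "'i \<Rightarrow> 'i list list \<Rightarrow> 'i list" where
  "interleave y L = hd L @ concat (map ((#) y) (tl L))"

lemma interleave_single [simp]: "interleave y [v] = v"
  by (simp add: interleave_def)

lemma interleave_Cons: "L \<noteq> [] \<Longrightarrow> interleave y (v # L) = v @ y # interleave y L"
  by (cases L) (simp_all add: interleave_def)

lemma interleave_replicate:
  "interleave y (replicate k v @ [w]) = concat (replicate k (v @ [y])) @ w"
  by (induction k) (simp_all add: interleave_Cons)

text \<open>The sum of \<open>block_sum\<close> for a word given by its gaps, the first of which has already been read.\<close>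

definition gap_sum :: "(nat \<Rightarrow> complex) \<Rightarrow> ('i nc_word \<Rightarrow> complex) \<Rightarrow> 'i \<Rightarrow> nat \<Rightarrow> 'i list list \<Rightarrow> complex" where
  "gap_sum \<kappa> \<phi> y n L = block_sum \<kappa> \<phi> y n (hd L) (concat (map ((#) y) (tl L)))"

lemma block_sum_interleave:
  assumes "L \<noteq> []" "\<And>v. v \<in> set L \<Longrightarrow> y \<notin> set v"
  shows "block_sum \<kappa> \<phi> y n [] (interleave y L) = gap_sum \<kappa> \<phi> y n L"
  using assms by (cases L) (simp_all add: gap_sum_def interleave_def block_sum_skip)

text \<open>Case distinction on the first letter \<open>y\<close> at which a cut is made, if there is one.\<close>

lemma gap_sum_Cons:
  assumes "\<And>v. v \<in> set L \<Longrightarrow> y \<notin> set v"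
  shows "gap_sum \<kappa> \<phi> y n (x # L) = \<kappa> n * \<phi> (NC_Word (interleave y (x # L)))
    + (\<Sum>i<length L. \<phi> (NC_Word (interleave y (x # take i L))) * gap_sum \<kappa> \<phi> y (Suc n) (drop i L))"
  using assms
proof (induction L arbitrary: x)
  case Nil
  then show ?case by (simp add: gap_sum_def interleave_def)
next
  case (Cons a L)
  have glue: "interleave y ((x @ y # a) # l) = interleave y (x # a # l)" for l
    by (simp add: interleave_def)
  have "gap_sum \<kappa> \<phi> y n (x # a # L) = gap_sum \<kappa> \<phi> y n ((x @ y # a) # L)
      + \<phi> (NC_Word x) * gap_sum \<kappa> \<phi> y (Suc n) (a # L)"
    using Cons.prems by (simp add: gap_sum_def block_sum_skip)
  also have "gap_sum \<kappa> \<phi> y n ((x @ y # a) # L) = \<kappa> n * \<phi> (NC_Word (interleave y (x # a # L)))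
    + (\<Sum>i<length L. \<phi> (NC_Word (interleave y (x # a # take i L))) * gap_sum \<kappa> \<phi> y (Suc n) (drop i L))"
    using Cons.IH[of "x @ y # a"] Cons.prems by (simp add: glue)
  finally show ?case
    by (simp add: sum.lessThan_Suc_shift del: sum.lessThan_Suc)
qed

text \<open>All gaps but the last are equal, so the factors of a factorization depend on their length only
  and the sum is a convolution.\<close>

lemma gap_sum_uniform:
  assumes v: "y \<notin> set v" and w: "y \<notin> set w"
  shows "Abs_fps (\<lambda>k. gap_sum \<kappa> \<phi> y 1 (replicate k v @ [w]))
    = Abs_fps (\<lambda>k. \<phi> (NC_Word (concat (replicate k (v @ [y])) @ w)))
      * (Abs_fps (\<lambda>j. \<kappa> (Suc j)) oo (fps_X * Abs_fps (\<lambda>k. \<phi> (NC_Word (concat (replicate k (v @ [y])) @ v)))))"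
proof -
  have rec: "gap_sum \<kappa> \<phi> y s (replicate k v @ [w]) = \<kappa> s * \<phi> (NC_Word (concat (replicate k (v @ [y])) @ w))
      + (\<Sum>i<k. \<phi> (NC_Word (concat (replicate i (v @ [y])) @ v))
           * gap_sum \<kappa> \<phi> y (Suc s) (replicate (k - 1 - i) v @ [w]))" for s k
  proof (cases k)
    case 0
    then show ?thesis by (simp add: gap_sum_def)
  next
    case (Suc m)
    let ?L = "replicate m v @ [w]"
    have tk: "interleave y (v # take i ?L) = concat (replicate i (v @ [y])) @ v" if "i < k" for i
    proof -
      have "v # take i ?L = replicate i v @ [v]"
        using that Suc by (simp add: min_def replicate_append_same[symmetric])
      then show ?thesis by (simp add: interleave_replicate)
    qed
    have dr: "drop i ?L = replicate (k - 1 - i) v @ [w]" if "i < k" for i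
      using that Suc by simp
    have "replicate k v @ [w] = v # ?L" using Suc by simp
    moreover have "gap_sum \<kappa> \<phi> y s (v # ?L) = \<kappa> s * \<phi> (NC_Word (interleave y (v # ?L)))
      + (\<Sum>i<length ?L. \<phi> (NC_Word (interleave y (v # take i ?L))) * gap_sum \<kappa> \<phi> y (Suc s) (drop i ?L))"
      by (rule gap_sum_Cons) (use v w in auto)
    moreover have "length ?L = k" using Suc by simp
    moreover have "(\<Sum>i<k. \<phi> (NC_Word (interleave y (v # take i ?L))) * gap_sum \<kappa> \<phi> y (Suc s) (drop i ?L))
      = (\<Sum>i<k. \<phi> (NC_Word (concat (replicate i (v @ [y])) @ v))
           * gap_sum \<kappa> \<phi> y (Suc s) (replicate (k - 1 - i) v @ [w]))"
      by (intro sum.cong refl) (simp only: tk dr lessThan_iff)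
    ultimately show ?thesis
      by (simp only: interleave_replicate[of y k v w, symmetric])
  qed
  show ?thesis
    using convolution_recursion_fps[where H = "\<lambda>s k. gap_sum \<kappa> \<phi> y s (replicate k v @ [w])" and s = 1, OF rec]
    by simp
qed

lemma (in free_variable) schwinger_dyson_uniform:
  assumes v: "v \<in> lists (\<Union>j\<in>J. A j)" "y \<notin> set v" and w: "w \<in> lists (\<Union>j\<in>J. A j)" "y \<notin> set w"
  shows "Abs_fps (\<lambda>k. \<phi> (NC_Word (y # concat (replicate k (v @ [y])) @ w)))
    = Abs_fps (\<lambda>k. \<phi> (NC_Word (concat (replicate k (v @ [y])) @ w)))
      * (Abs_fps (\<lambda>j. \<kappa> (Suc j)) oo (fps_X * Abs_fps (\<lambda>k. \<phi> (NC_Word (concat (replicate k (v @ [y])) @ v)))))"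
proof -
  have yA: "y \<in> (\<Union>j\<in>J. A j)" using j0 A_j0 by blast
  have "\<phi> (NC_Word (y # concat (replicate k (v @ [y])) @ w)) = gap_sum \<kappa> \<phi> y 1 (replicate k v @ [w])" for k
  proof -
    have "concat (replicate k (v @ [y])) @ w \<in> lists (\<Union>j\<in>J. A j)"
      using v w yA by (induction k) auto
    then have "\<phi> (NC_Word (y # concat (replicate k (v @ [y])) @ w))
        = block_sum \<kappa> \<phi> y 1 [] (interleave y (replicate k v @ [w]))"
      unfolding interleave_replicate by (rule schwinger_dyson)
    also have "\<dots> = gap_sum \<kappa> \<phi> y 1 (replicate k v @ [w])"
      by (rule block_sum_interleave) (use v w in \<open>auto simp: set_replicate_conv_if split: if_splits\<close>)
    finally show ?thesis .
  qed
  then show ?thesis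
    using gap_sum_uniform[OF v(2) w(2), of \<kappa> \<phi>] by simp
qed

text \<open>Let \<open>x\<^sub>1, x\<^sub>2, \<dots>\<close> be variables with moments \<open>m x\<close>. A list of pairs \<open>(x, i)\<close> in which neighbouring
  variables differ, and \<open>i \<ge> 1\<close>, stands for the product of the centered powers \<open>x\<^sup>i - m x i\<close>. These
  products form a basis of the free algebra, and \<open>f\<close> is a linear functional given by its values on the
  basis. Then \<open>shift_act m f x\<close> is the functional \<open>w \<mapsto> f (x w)\<close>, obtained by expanding \<open>x w\<close> in the
  basis; the three terms of the first case come from
  \<open>x (x\<^sup>i - m\<^sub>i) = (x\<^bsup>i+1\<^esup> - m\<^bsub>i+1\<^esub>) - m\<^sub>i (x - m\<^sub>1) + (m\<^bsub>i+1\<^esub> - m\<^sub>i m\<^sub>1)\<close>.\<close>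

definition shift_act :: "('g \<Rightarrow> distr) \<Rightarrow> (('g \<times> nat) list \<Rightarrow> complex) \<Rightarrow> 'g \<Rightarrow> ('g \<times> nat) list \<Rightarrow> complex" where
  "shift_act m f x w =
     (if w \<noteq> [] \<and> fst (hd w) = x
      then let i = snd (hd w) in f ((x, Suc i) # tl w) - m x i * f ((x, 1) # tl w)
             + (m x (Suc i) - m x i * m x 1) * f (tl w)
      else f ((x, 1) # w) + m x 1 * f w)"

text \<open>The coefficient of the empty product when a word is expanded in the basis of products of centered
  powers.\<close>

definition free_product :: "('g \<Rightarrow> distr) \<Rightarrow> 'g nc_word \<Rightarrow> complex" where
  "free_product m v = foldl (shift_act m) (\<lambda>w. if w = [] then 1 else 0) (letters v) []"

text \<open>In terms of the basis, \<open>x\<^sup>n w = (x\<^sup>n - m\<^sub>n) w + m\<^sub>n w\<close>.\<close>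

lemma shift_act_power:
  assumes "w = [] \<or> fst (hd w) \<noteq> x" "m x 0 = 1"
  shows "foldl (shift_act m) f (replicate n x) w = (if n = 0 then 0 else f ((x, n) # w)) + m x n * f w"
proof (induction n arbitrary: f)
  case (Suc n)
  have "shift_act m f x w = f ((x, 1) # w) + m x 1 * f w"
    using assms(1) by (auto simp: shift_act_def)
  moreover have "shift_act m f x ((x, n) # w) = f ((x, Suc n) # w) - m x n * f ((x, 1) # w)
      + (m x (Suc n) - m x n * m x 1) * f w"
    by (simp add: shift_act_def)
  ultimately show ?case
    using Suc.IH[of "shift_act m f x"] assms(2) by (cases "n = 0") (simp_all add: algebra_simps)
qed (use assms(2) in simp)

lemma free_product_replicate: "m x 0 = 1 \<Longrightarrow> free_product m (NC_Word (replicate n x)) = m x n"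
  by (simp add: free_product_def shift_act_power)

text \<open>An alternating product of centered elements acts on a basis element \<open>w\<close> that starts with another
  variable by prepending one centered power per factor. The result has no component at the empty
  product.\<close>

lemma free_product_free:
  assumes m: "\<And>x. m x 0 = 1"
  shows "free_family (lin_ext (free_product m)) J (\<lambda>j. nc_subalg {j})"
proof -
  define ev where "ev P w = lin_ext (\<lambda>v. foldl (shift_act m) (\<lambda>w. if w = [] then 1 else 0) (letters v) w) P" for P w
  have zero: "ev (prod_list as) w = 0"
    if "list_all2 (centered (free_product m) (\<lambda>j. {j})) js as" "distinct_adj js"
      "w = [] \<or> js = [] \<or> fst (hd w) \<noteq> last js" "as \<noteq> [] \<or> w \<noteq> []" for js as w
    using that
  proof (induction as arbitrary: js w rule: rev_induct)
    case Nil
    then show ?case by (simp add: ev_def)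
  next
    case (snoc a as)
    obtain js' j where js: "js = js' @ [j]" "list_all2 (centered (free_product m) (\<lambda>j. {j})) js' as"
      "centered (free_product m) (\<lambda>j. {j}) j a"
      using snoc.prems(1) by (auto simp: list_all2_append2 list_all2_Cons2)
    have keys: "\<exists>n. v = NC_Word (replicate n j)" if "v \<in> Poly_Mapping.keys a" for v
    proof -
      have "set (letters v) \<subseteq> {j}" using js(3) that by (auto simp: centered_def nc_subalg_def)
      then have "letters v = replicate (length (letters v)) j"
        by (metis replicate_length_same singletonD subsetD)
      then show ?thesis by (metis nc_word.collapse)
    qed
    have w: "w = [] \<or> fst (hd w) \<noteq> j" using snoc.prems js by auto
    have da: "distinct_adj js'" "js' = [] \<or> last js' \<noteq> j"
      using snoc.prems(2) by (auto simp: js distinct_adj_append_iff)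
    have up: "ev (prod_list as) ((j, n) # w) = 0" for n
      using snoc.IH[OF js(2) da(1), of "(j, n) # w"] da(2) by auto
    have "ev (prod_list as * a) w = lin_ext (\<lambda>v. lin_ext (\<lambda>u. foldl (shift_act m)
        (foldl (shift_act m) (\<lambda>w. if w = [] then 1 else 0) (letters u)) (letters v) w) (prod_list as)) a"
      unfolding ev_def lin_ext_mult letters_plus foldl_append by (rule lin_ext_swap)
    also have "\<dots> = lin_ext (\<lambda>v. free_product m v * ev (prod_list as) w) a"
    proof (rule lin_ext_cong)
      fix v assume "v \<in> Poly_Mapping.keys a"
      then obtain n where v: "v = NC_Word (replicate n j)" using keys by blast
      have "lin_ext (\<lambda>u. foldl (shift_act m)
        (foldl (shift_act m) (\<lambda>w. if w = [] then 1 else 0) (letters u)) (letters v) w) (prod_list as)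
        = (if n = 0 then 0 else ev (prod_list as) ((j, n) # w)) + m j n * ev (prod_list as) w"
        unfolding v nc_word.sel shift_act_power[where m = m, OF w m] lin_ext_fun_add lin_ext_fun_mult_left ev_def
        by (auto simp: lin_ext_def)
      then show "lin_ext (\<lambda>u. foldl (shift_act m)
        (foldl (shift_act m) (\<lambda>w. if w = [] then 1 else 0) (letters u)) (letters v) w) (prod_list as)
        = free_product m v * ev (prod_list as) w"
        using up by (simp add: v free_product_replicate m)
    qed
    also have "\<dots> = 0"
      using js(3) by (simp add: lin_ext_fun_mult_right centered_def)
    finally show ?case by simp
  qed
  have ev_Nil: "lin_ext (free_product m) P = ev P []" for P
    unfolding ev_def by (rule lin_ext_cong) (simp add: free_product_def)
  show ?thesis
    unfolding free_family_iff[where A = "\<lambda>j. {j}"] ev_Nil using zero by blast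
qed

lemma compose_fps_inv:
  fixes R g P :: "complex fps"
  assumes "fps_nth R 0 = 0" "fps_nth R 1 \<noteq> 0" "fps_nth g 0 = 0" "P = R oo g"
  shows "fps_inv R oo P = g"
  using assms by (simp add: fps_compose_assoc fps_inv)

text \<open>Let \<open>u\<close> and \<open>v\<close> be free with cumulants \<open>\<kappa>\<close> and \<open>\<kappa>'\<close>, let \<open>\<psi>\<close> and \<open>\<psi>'\<close> be the moment series of \<open>u v\<close> and
  \<open>v u\<close>, and let \<open>F\<^sub>u\<close> and \<open>F\<^sub>v\<close> be the series of \<open>u (v u)\<^sup>k\<close> and \<open>v (u v)\<^sup>k\<close>. The Schwinger-Dyson equation
  for \<open>u\<close> gives \<open>\<psi> = R\<^sub>u(z F\<^sub>v)\<close> and \<open>z F\<^sub>u F\<^sub>v = \<psi> (1 + \<psi>')\<close>, and the one for \<open>v\<close> the same with \<open>u\<close> and \<open>v\<close>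
  exchanged. Comparison yields \<open>\<psi> = \<psi>'\<close>, and then
  \<open>R\<^sub>u\<^sup>-\<^sup>1(\<psi>) R\<^sub>v\<^sup>-\<^sup>1(\<psi>) = z\<^sup>2 F\<^sub>u F\<^sub>v = z \<psi> (1 + \<psi>)\<close>, which is the product formula for S-transforms.\<close>

lemma product_of_free_variables:
  fixes \<phi> :: "bool nc_word \<Rightarrow> complex"
  assumes free: "free_family (lin_ext \<phi>) UNIV (\<lambda>b :: bool. nc_subalg {b})"
    and mu: "\<And>k. \<phi> (NC_Word (replicate k True)) = \<mu> k"
    and nu: "\<And>k. \<phi> (NC_Word (replicate k False)) = \<nu> k"
    and rho: "\<And>k. \<phi> (NC_Word (concat (replicate k [True, False]))) = \<rho> k"
    and one: "\<mu> 0 = 1" "\<nu> 0 = 1" and nz: "\<mu> 1 \<noteq> 0" "\<nu> 1 \<noteq> 0"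
  shows "\<rho> 0 = 1" "\<rho> 1 \<noteq> 0" "S_transform \<rho> = S_transform \<mu> * S_transform \<nu>"
proof -
  have unit: "\<phi> 0 = 1" using mu[of 0] one by (simp add: NC_Word_Nil)
  show "\<rho> 0 = 1" using rho[of 0] unit by (simp add: NC_Word_Nil)
  obtain \<kappa> where \<kappa>: "cumulant_relation \<mu> \<kappa>" using cumulant_relation_exists one by blast
  obtain \<kappa>' where \<kappa>': "cumulant_relation \<nu> \<kappa>'" using cumulant_relation_exists one by blast
  interpret u: free_variable \<phi> UNIV "\<lambda>b. {b}" True True \<kappa>
    by unfold_locales (use unit free \<kappa> in \<open>auto simp: mu\<close>)
  interpret v: free_variable \<phi> UNIV "\<lambda>b. {b}" False False \<kappa>'
    by unfold_locales (use unit free \<kappa>' in \<open>auto simp: nu\<close>)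
  define \<rho>' where "\<rho>' k = \<phi> (NC_Word (concat (replicate k [False, True])))" for k
  define Fu where "Fu = Abs_fps (\<lambda>k. \<phi> (NC_Word (concat (replicate k [True, False]) @ [True])))"
  define Fv where "Fv = Abs_fps (\<lambda>k. \<phi> (NC_Word (concat (replicate k [False, True]) @ [False])))"
  have one': "\<rho>' 0 = 1" using unit by (simp add: \<rho>'_def NC_Word_Nil)
  have rot: "x # concat (replicate k [y, x]) = concat (replicate k [x, y]) @ [x]" for x y :: bool and k
    by (induction k) auto
  have rot2: "x # concat (replicate k [y, x]) @ [y] = concat (replicate (Suc k) [x, y])" for x y :: bool and k
    by (induction k) auto
  have psi: "psi_series \<rho> = fps_X * Abs_fps (\<lambda>k. \<rho> (Suc k))" for \<rho>
    by (rule fps_ext) (simp add: psi_series_def fps_X_mult_nth)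
  let ?Q = "\<lambda>\<kappa> F. Abs_fps (\<lambda>j. \<kappa> (Suc j)) oo (fps_X * F)"
  have u1: "Abs_fps (\<lambda>k. \<rho> (Suc k)) = Fv * ?Q \<kappa> Fv"
    using u.schwinger_dyson_uniform[of "[False]" "[False]"]
    by (simp add: rot2 rho Fv_def del: replicate_Suc)
  have u2: "Fu = (1 + psi_series \<rho>') * ?Q \<kappa> Fv"
    using u.schwinger_dyson_uniform[of "[False]" "[]"]
    by (simp add: rot Fu_def Fv_def Abs_fps_eq_psi_series[of \<rho>', OF one', symmetric] \<rho>'_def[symmetric])
  have v1: "Abs_fps (\<lambda>k. \<rho>' (Suc k)) = Fu * ?Q \<kappa>' Fu"
    using v.schwinger_dyson_uniform[of "[True]" "[True]"]
    by (simp add: rot2 Fu_def \<rho>'_def del: replicate_Suc)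
  have v2: "Fv = (1 + psi_series \<rho>) * ?Q \<kappa>' Fu"
    using v.schwinger_dyson_uniform[of "[True]" "[]"]
    by (simp add: rot Fu_def Fv_def Abs_fps_eq_psi_series[of \<rho>, OF \<open>\<rho> 0 = 1\<close>, symmetric] rho)
  have prod1: "fps_X * Fu * Fv = psi_series \<rho> * (1 + psi_series \<rho>')"
    unfolding psi[of \<rho>] u1 by (subst u2) (simp add: mult_ac)
  have prod2: "fps_X * Fu * Fv = psi_series \<rho>' * (1 + psi_series \<rho>)"
    unfolding psi[of \<rho>'] v1 by (subst v2) (simp add: mult_ac)
  have same: "psi_series \<rho>' = psi_series \<rho>"
    using prod1 prod2 by (simp add: algebra_simps)
  have R1: "psi_series \<rho> = cumulant_series \<kappa> oo (fps_X * Fv)"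
    unfolding psi u1 by (simp add: cumulant_series_compose mult_ac)
  have R2: "psi_series \<rho> = cumulant_series \<kappa>' oo (fps_X * Fu)"
    unfolding same[symmetric] psi[of \<rho>'] v1 by (simp add: cumulant_series_compose mult_ac)
  have k1: "\<kappa> 1 = \<mu> 1" "\<kappa>' 1 = \<nu> 1"
    using cumulant_relation_1 \<kappa> \<kappa>' by auto
  have "\<rho> 1 = \<mu> 1 * \<nu> 1"
  proof -
    have "fps_nth Fv 0 = \<nu> 1" using nu[of 1] by (simp add: Fv_def)
    then show ?thesis
      using arg_cong[OF u1, of "\<lambda>F. fps_nth F 0"] k1 by (simp add: mult.commute)
  qed
  then show nz': "\<rho> 1 \<noteq> 0" using nz by simp
  have P: "fps_nth (psi_series \<rho>) 0 = 0" "fps_nth (psi_series \<rho>) 1 \<noteq> 0"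
    using nz' by (simp_all add: psi_series_nth_1)
  have S1: "(fps_X * S_transform \<mu>) oo psi_series \<rho> = fps_X * Fv"
    unfolding S_transform_cumulants[OF \<kappa> nz(1)]
    by (rule compose_fps_inv[OF _ _ _ R1]) (use k1 nz in \<open>simp_all add: cumulant_series_nth_1\<close>)
  have S2: "(fps_X * S_transform \<nu>) oo psi_series \<rho> = fps_X * Fu"
    unfolding S_transform_cumulants[OF \<kappa>' nz(2)]
    by (rule compose_fps_inv[OF _ _ _ R2]) (use k1 nz in \<open>simp_all add: cumulant_series_nth_1\<close>)
  have "((fps_X * S_transform \<mu>) * (fps_X * S_transform \<nu>)) oo psi_series \<rho> = (fps_X * Fv) * (fps_X * Fu)"
    using P by (simp add: fps_compose_mult_distrib S1 S2)
  also have "\<dots> = fps_X * (psi_series \<rho> * (1 + psi_series \<rho>))"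
    using prod1 unfolding same by (simp add: mult_ac)
  finally have "psi_series \<rho> * ((fps_X * (S_transform \<mu> * S_transform \<nu>)) oo psi_series \<rho>)
      = psi_series \<rho> * (fps_X * (1 + psi_series \<rho>))"
    using P by (simp add: fps_compose_mult_distrib mult_ac)
  moreover have "psi_series \<rho> \<noteq> 0" using P by auto
  ultimately have eq: "(fps_X * (S_transform \<mu> * S_transform \<nu>)) oo psi_series \<rho> = fps_X * (1 + psi_series \<rho>)"
    by simp
  have i0: "fps_nth (fps_inv (psi_series \<rho>)) 0 = 0" by (simp add: fps_inv_def)
  have "fps_X * (S_transform \<mu> * S_transform \<nu>)
      = ((fps_X * (S_transform \<mu> * S_transform \<nu>)) oo psi_series \<rho>) oo fps_inv (psi_series \<rho>)"
    using P i0 by (simp add: fps_compose_assoc[symmetric] fps_inv_right)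
  also have "\<dots> = fps_inv (psi_series \<rho>) * (1 + fps_X)"
    using P i0 by (simp add: eq fps_compose_mult_distrib fps_compose_add_distrib fps_inv_right)
  also have "\<dots> = fps_X * S_transform \<rho>"
    by (simp add: S_transform_eq algebra_simps)
  finally show "S_transform \<rho> = S_transform \<mu> * S_transform \<nu>" by simp
qed

text \<open>Shows that the product formula determines the convolution.\<close>

lemma S_transform_inj:
  assumes "S_transform \<rho> = S_transform \<rho>'" "\<rho> 0 = \<rho>' 0" "\<rho> 1 \<noteq> 0" "\<rho>' 1 \<noteq> 0"
  shows "\<rho> = \<rho>'"
proof -
  have "(fps_X + 1) * fps_inv (psi_series \<rho>) = (fps_X + 1) * fps_inv (psi_series \<rho>')"
    using assms(1) by (metis S_transform_eq)
  moreover have "fps_X + 1 \<noteq> (0 :: complex fps)"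
    by (metis add_cancel_left_left fps_X_nth fps_one_nth fps_zero_nth fps_add_nth zero_neq_one)
  ultimately have "fps_inv (psi_series \<rho>) = fps_inv (psi_series \<rho>')" by simp
  moreover have "fps_inv (fps_inv (psi_series \<rho>)) = psi_series \<rho>" if "\<rho> 1 \<noteq> 0" for \<rho>
    using that by (intro fps_inv_idempotent) (auto simp: psi_series_nth_1)
  ultimately have "psi_series \<rho> = psi_series \<rho>'" using assms by metis
  then have "\<rho> k = \<rho>' k" for k
  proof (cases "k = 0")
    case False
    have "fps_nth (psi_series \<rho>) k = fps_nth (psi_series \<rho>') k"
      using \<open>psi_series \<rho> = psi_series \<rho>'\<close> by (rule arg_cong)
    with False show ?thesis by (simp only: psi_series_def fps_nth_Abs_fps if_False)
  qed (use assms(2) in simp)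
  then show ?thesis by blast
qed

text \<open>The convolution is defined by a unique description: \<open>free_product\<close> provides the existence, and the
  product formula for the S-transform the uniqueness.\<close>

theorem free_mult_conv_S_transform:
  assumes one: "\<mu> 0 = 1" "\<nu> 0 = 1" and nz: "\<mu> 1 \<noteq> 0" "\<nu> 1 \<noteq> 0"
  shows "free_mult_conv \<mu> \<nu> 0 = 1" "free_mult_conv \<mu> \<nu> 1 \<noteq> 0"
    "S_transform (free_mult_conv \<mu> \<nu>) = S_transform \<mu> * S_transform \<nu>"
proof -
  let ?is = "\<lambda>\<rho>. \<exists>\<phi>. free_family (lin_ext \<phi>) UNIV (\<lambda>b :: bool. nc_subalg {b}) \<and>
     (\<forall>k. \<phi> (NC_Word (replicate k True)) = \<mu> k) \<and>
     (\<forall>k. \<phi> (NC_Word (replicate k False)) = \<nu> k) \<and>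
     (\<forall>k. \<phi> (NC_Word (concat (replicate k [True, False]))) = \<rho> k)"
  have props: "\<rho> 0 = 1 \<and> \<rho> 1 \<noteq> 0 \<and> S_transform \<rho> = S_transform \<mu> * S_transform \<nu>" if "?is \<rho>" for \<rho>
  proof -
    from that obtain \<phi> where F: "free_family (lin_ext \<phi>) UNIV (\<lambda>b :: bool. nc_subalg {b})"
     and M: "\<forall>k. \<phi> (NC_Word (replicate k True)) = \<mu> k"
     "\<forall>k. \<phi> (NC_Word (replicate k False)) = \<nu> k"
     "\<forall>k. \<phi> (NC_Word (concat (replicate k [True, False]))) = \<rho> k"
      by (elim exE conjE)
    show ?thesis
      using product_of_free_variables[OF F M[rule_format] one nz] by (intro conjI)
  qed
  let ?m = "\<lambda>b. if b then \<mu> else \<nu>"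
  let ?\<rho> = "\<lambda>k. free_product ?m (NC_Word (concat (replicate k [True, False])))"
  have m: "?m b 0 = 1" for b using one by simp
  have ex: "?is ?\<rho>"
  proof (intro exI[of _ "free_product ?m"] conjI allI)
    show "free_family (lin_ext (free_product ?m)) UNIV (\<lambda>b. nc_subalg {b})"
      by (rule free_product_free) (rule m)
  qed (simp_all add: free_product_replicate one)
  have "free_mult_conv \<mu> \<nu> = ?\<rho>"
    unfolding free_mult_conv_def
  proof (rule the_equality)
    show "?is ?\<rho>" by fact
    fix \<rho> assume "?is \<rho>"
    note P = props[OF this] and P' = props[OF ex]
    show "\<rho> = ?\<rho>"
      by (rule S_transform_inj) (use P P' in \<open>simp_all only:\<close>, simp_all)
  qed
  then show "free_mult_conv \<mu> \<nu> 0 = 1" "free_mult_conv \<mu> \<nu> 1 \<noteq> 0"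
    "S_transform (free_mult_conv \<mu> \<nu>) = S_transform \<mu> * S_transform \<nu>"
    using props[OF ex] unfolding \<open>free_mult_conv \<mu> \<nu> = ?\<rho>\<close> by blast+
qed

section \<open>Walks on a path and their generating series\<close>

lemma concat_replicate_rotate:
  "a @ concat (replicate k (b @ a)) = concat (replicate k (a @ b)) @ a"
  by (induction k) auto

lemma concat_replicate_Suc: "concat (replicate (Suc k) w) = concat (replicate k w) @ w"
  by (induction k) simp_all

lemma interleave_pairs:
  "interleave y (concat (replicate j [a, b]) @ [c]) = concat (replicate j (a @ y # b @ [y])) @ c"
  by (induction j) (simp_all add: interleave_Cons)

lemma take_pairs: "j \<le> k \<Longrightarrow> take (2 * j) (concat (replicate k [a, b]) @ r) = concat (replicate j [a, b])"
proof (induction k arbitrary: j)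
  case (Suc k)
  then show ?case by (cases j) auto
qed simp

lemma drop_pairs: "j \<le> k \<Longrightarrow> drop (2 * j) (concat (replicate k [a, b]) @ r) = concat (replicate (k - j) [a, b]) @ r"
proof (induction k arbitrary: j)
  case (Suc k)
  then show ?case by (cases j) auto
qed simp

lemma length_pairs: "length (concat (replicate k [a, b])) = 2 * k"
  by (induction k) auto

lemma sum_even_terms:
  fixes g :: "nat \<Rightarrow> complex"
  assumes "\<And>j. j < k \<Longrightarrow> g (2 * j + 1) = 0"
  shows "(\<Sum>i<2 * k + 1. g i) = (\<Sum>j\<le>k. g (2 * j))"
  using assms by (induction k) auto

lemma convolution_fps:
  "Abs_fps (\<lambda>k. \<Sum>j\<le>k. f j * g (k - j)) = Abs_fps f * Abs_fps g" for f g :: "nat \<Rightarrow> complex"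
  by (rule fps_ext) (simp add: fps_mult_nth atLeast0AtMost)

text \<open>If \<open>\<phi>\<close> vanishes on every piece that starts at a gap of one kind and ends at a gap of the other
  kind, then the pieces of a factorization start and end alternately with \<open>\<alpha>\<close> and with \<open>\<beta>\<close> or the
  final gap \<open>\<gamma>\<close>. So their number is even, and two steps of the recursion for \<open>gap_sum\<close> form one step
  of a geometric series in the even cumulants.\<close>

lemma gap_sum_alternating:
  fixes \<phi> :: "'i nc_word \<Rightarrow> complex"
  assumes y: "y \<notin> set \<alpha>" "y \<notin> set \<beta>" "y \<notin> set \<gamma>"
    and zero1: "\<And>j. \<phi> (NC_Word (interleave y (concat (replicate j [\<alpha>, \<beta>]) @ [\<alpha>, \<beta>]))) = 0"
    and zero2: "\<And>j. \<phi> (NC_Word (interleave y (concat (replicate j [\<alpha>, \<beta>]) @ [\<alpha>, \<gamma>]))) = 0"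
    and zero3: "\<And>j. \<phi> (NC_Word (interleave y (concat (replicate j [\<beta>, \<alpha>]) @ [\<beta>, \<alpha>]))) = 0"
  shows "Abs_fps (\<lambda>k. gap_sum \<kappa> \<phi> y 1 (concat (replicate k [\<alpha>, \<beta>]) @ [\<alpha>, \<gamma>]))
    = Abs_fps (\<lambda>j. \<phi> (NC_Word (concat (replicate j (\<alpha> @ y # \<beta> @ [y])) @ \<alpha>)))
      * Abs_fps (\<lambda>j. \<phi> (NC_Word (concat (replicate j (\<beta> @ y # \<alpha> @ [y])) @ \<gamma>)))
      * (Abs_fps (\<lambda>j. \<kappa> (2 * Suc j)) oo (fps_X
          * (Abs_fps (\<lambda>j. \<phi> (NC_Word (concat (replicate j (\<alpha> @ y # \<beta> @ [y])) @ \<alpha>)))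
             * Abs_fps (\<lambda>j. \<phi> (NC_Word (concat (replicate j (\<beta> @ y # \<alpha> @ [y])) @ \<beta>))))))"
proof -
  define a where "a j = \<phi> (NC_Word (concat (replicate j (\<alpha> @ y # \<beta> @ [y])) @ \<alpha>))" for j
  define b where "b j = \<phi> (NC_Word (concat (replicate j (\<beta> @ y # \<alpha> @ [y])) @ \<beta>))" for j
  define e where "e j = \<phi> (NC_Word (concat (replicate j (\<beta> @ y # \<alpha> @ [y])) @ \<gamma>))" for j
  \<comment> \<open>The gaps of a word that starts with \<open>\<alpha>\<close>, respectively \<open>\<beta>\<close>, and ends with \<open>\<gamma>\<close>.\<close>
  define LA where "LA k = concat (replicate k [\<alpha>, \<beta>]) @ [\<alpha>, \<gamma>]" for k
  define LB where "LB k = concat (replicate k [\<beta>, \<alpha>]) @ [\<gamma>]" for k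
  define HA where "HA s k = gap_sum \<kappa> \<phi> y s (LA k)" for s k
  define HB where "HB s k = gap_sum \<kappa> \<phi> y s (LB k)" for s k
  have rot: "u # concat (replicate j [v, u]) = concat (replicate j [u, v]) @ [u]" for u v :: "'i list" and j
    using concat_replicate_rotate[of "[u]" j "[v]"] by simp
  have LA: "LA k = \<alpha> # LB k" for k
    unfolding LA_def LB_def using rot[of \<alpha> k \<beta>] by simp
  have LB: "LB (Suc k) = \<beta> # LA k" for k
    unfolding LA by (simp add: LB_def)
  have notin: "y \<notin> set v" if "v \<in> set (LA k) \<or> v \<in> set (LB k)" for v k
    using that y by (auto simp: LA_def LB_def split: if_splits)
  have HA: "HA s k = (\<Sum>j\<le>k. a j * HB (Suc s) (k - j))" for s k
  proof -
    let ?g = "\<lambda>i. \<phi> (NC_Word (interleave y (\<alpha> # take i (LB k)))) * gap_sum \<kappa> \<phi> y (Suc s) (drop i (LB k))"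
    have "HA s k = \<kappa> s * \<phi> (NC_Word (interleave y (LA k))) + (\<Sum>i<length (LB k). ?g i)"
      unfolding HA_def LA by (rule gap_sum_Cons) (use notin in auto)
    also have "\<phi> (NC_Word (interleave y (LA k))) = 0"
      unfolding LA_def by (rule zero2)
    also have "length (LB k) = 2 * k + 1" by (simp add: LB_def length_pairs)
    also have "(\<Sum>i<2 * k + 1. ?g i) = (\<Sum>j\<le>k. ?g (2 * j))"
    proof (rule sum_even_terms)
      fix j assume j: "j < k"
      have "take (2 * j + 1) (LB k) = concat (replicate j [\<beta>, \<alpha>]) @ [\<beta>]"
      proof -
        have "take (2 * j + 1) (LB k) = take (2 * j) (LB k) @ take 1 (drop (2 * j) (LB k))"
          by (rule take_add)
        also have "take (2 * j) (LB k) = concat (replicate j [\<beta>, \<alpha>])"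
          unfolding LB_def using j by (intro take_pairs) simp
        also have "take 1 (drop (2 * j) (LB k)) = [\<beta>]"
          unfolding LB_def drop_pairs[OF less_imp_le[OF j]] using j by (cases "k - j") auto
        finally show ?thesis .
      qed
      then have "\<alpha> # take (2 * j + 1) (LB k) = concat (replicate j [\<alpha>, \<beta>]) @ [\<alpha>, \<beta>]"
        using rot[of \<alpha> j \<beta>] by simp
      then show "?g (2 * j + 1) = 0" using zero1[of j] by simp
    qed
    also have "\<dots> = (\<Sum>j\<le>k. a j * HB (Suc s) (k - j))"
    proof (intro sum.cong refl)
      fix j assume "j \<in> {..k}"
      then have j: "j \<le> k" by simp
      have "\<alpha> # take (2 * j) (LB k) = concat (replicate j [\<alpha>, \<beta>]) @ [\<alpha>]"
        unfolding LB_def take_pairs[OF j] by (rule rot)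
      moreover have "drop (2 * j) (LB k) = LB (k - j)"
        unfolding LB_def by (rule drop_pairs[OF j])
      ultimately show "?g (2 * j) = a j * HB (Suc s) (k - j)"
        by (simp add: a_def HB_def interleave_pairs)
    qed
    finally show ?thesis by simp
  qed
  have HB0: "HB s 0 = \<kappa> s * e 0" for s
    by (simp add: HB_def LB_def e_def gap_sum_def)
  have HBS: "HB s (Suc k) = \<kappa> s * e (Suc k) + (\<Sum>j\<le>k. b j * HA (Suc s) (k - j))" for s k
  proof -
    let ?g = "\<lambda>i. \<phi> (NC_Word (interleave y (\<beta> # take i (LA k)))) * gap_sum \<kappa> \<phi> y (Suc s) (drop i (LA k))"
    have odd: "?g (2 * j + 1) = 0" if j: "j \<le> k" for j
    proof -
      have "take (2 * j + 1) (LA k) = concat (replicate j [\<alpha>, \<beta>]) @ [\<alpha>]"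
      proof -
        have "take (2 * j + 1) (LA k) = take (2 * j) (LA k) @ take 1 (drop (2 * j) (LA k))"
          by (rule take_add)
        moreover have "take 1 (drop (2 * j) (LA k)) = [\<alpha>]"
          unfolding LA_def drop_pairs[OF j] by (cases "k - j") auto
        ultimately show ?thesis using take_pairs[OF j, of \<alpha> \<beta> "[\<alpha>, \<gamma>]"] by (simp add: LA_def)
      qed
      then have "\<beta> # take (2 * j + 1) (LA k) = concat (replicate j [\<beta>, \<alpha>]) @ [\<beta>, \<alpha>]"
        using rot[of \<beta> j \<alpha>] by simp
      then show ?thesis using zero3[of j] by simp
    qed
    have "HB s (Suc k) = \<kappa> s * \<phi> (NC_Word (interleave y (LB (Suc k)))) + (\<Sum>i<length (LA k). ?g i)"
      unfolding HB_def LB by (rule gap_sum_Cons) (use notin in auto)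
    also have "\<phi> (NC_Word (interleave y (LB (Suc k)))) = e (Suc k)"
      unfolding LB_def e_def interleave_pairs ..
    also have "length (LA k) = Suc (2 * k + 1)" by (simp add: LA_def length_pairs)
    also have "(\<Sum>i<Suc (2 * k + 1). ?g i) = (\<Sum>i<2 * k + 1. ?g i)"
      using odd[of k] by simp
    also have "\<dots> = (\<Sum>j\<le>k. ?g (2 * j))"
      by (rule sum_even_terms) (use odd in auto)
    also have "\<dots> = (\<Sum>j\<le>k. b j * HA (Suc s) (k - j))"
    proof (intro sum.cong refl)
      fix j assume "j \<in> {..k}"
      then have j: "j \<le> k" by simp
      have "\<beta> # take (2 * j) (LA k) = concat (replicate j [\<beta>, \<alpha>]) @ [\<beta>]"
        unfolding LA_def take_pairs[OF j] by (rule rot)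
      moreover have "drop (2 * j) (LA k) = LA (k - j)"
        unfolding LA_def by (rule drop_pairs[OF j])
      ultimately show "?g (2 * j) = b j * HA (Suc s) (k - j)"
        by (simp add: b_def HA_def interleave_pairs)
    qed
    finally show ?thesis .
  qed
  have fA: "Abs_fps (HA s) = Abs_fps a * Abs_fps (HB (Suc s))" for s
    unfolding convolution_fps[symmetric] using HA by (intro arg_cong[of _ _ Abs_fps] ext)
  have fB: "Abs_fps (HB s) = fps_const (\<kappa> s) * Abs_fps e + fps_X * (Abs_fps b * Abs_fps (HA (Suc s)))" for s
  proof (rule fps_ext)
    fix n
    show "fps_nth (Abs_fps (HB s)) n
      = fps_nth (fps_const (\<kappa> s) * Abs_fps e + fps_X * (Abs_fps b * Abs_fps (HA (Suc s)))) n"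
      by (cases n) (simp_all add: HB0 HBS convolution_fps[symmetric])
  qed
  \<comment> \<open>Two steps at once. A factorization can only end in the step through \<open>HB\<close>, hence at an even cumulant.\<close>
  have "Abs_fps (HA (1 + 2 * s)) = fps_const (\<kappa> (2 * Suc s)) * (Abs_fps a * Abs_fps e)
      + fps_X * (Abs_fps a * Abs_fps b) * Abs_fps (HA (1 + 2 * Suc s))" for s
    using fA[of "1 + 2 * s"] fB[of "2 * Suc s"] by (simp add: algebra_simps)
  from fps_geometric_unfold[where X = "\<lambda>s. Abs_fps (HA (1 + 2 * s))" and \<kappa> = "\<lambda>s. \<kappa> (2 * Suc s)", OF this, of 0]
  have "Abs_fps (HA 1) = Abs_fps a * Abs_fps e
      * (Abs_fps (\<lambda>j. \<kappa> (2 * Suc j)) oo (fps_X * (Abs_fps a * Abs_fps b)))"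
    by simp
  then show ?thesis
    unfolding HA_def LA_def a_def b_def e_def .
qed


text \<open>Words in the letters \<open>D l\<close> (being at the vertex \<open>l\<close>) and \<open>y l\<close> (a step between \<open>l\<close> and \<open>l + 1\<close>)
  describe walks on a path.\<close>

locale excursion_model =
  fixes p :: nat and \<phi> :: "'i nc_word \<Rightarrow> complex" and y D :: "nat \<Rightarrow> 'i"
    and \<kappa> :: "nat \<Rightarrow> nat \<Rightarrow> complex"
  assumes p: "1 \<le> p"
    and trace: "\<And>v w. v \<in> lists (y ` {1..p} \<union> D ` {1..p + 1}) \<Longrightarrow> w \<in> lists (y ` {1..p} \<union> D ` {1..p + 1})
      \<Longrightarrow> \<phi> (NC_Word (v @ w)) = \<phi> (NC_Word (w @ v))"
    and idem: "\<And>l w. l \<in> {1..p + 1} \<Longrightarrow> w \<in> lists (y ` {1..p} \<union> D ` {1..p + 1})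
      \<Longrightarrow> \<phi> (NC_Word (D l # D l # w)) = \<phi> (NC_Word (D l # w))"
    and orth: "\<And>l m w. l \<in> {1..p + 1} \<Longrightarrow> m \<in> {1..p + 1} \<Longrightarrow> l \<noteq> m
      \<Longrightarrow> w \<in> lists (y ` {1..p} \<union> D ` {1..p + 1}) \<Longrightarrow> \<phi> (NC_Word (D l # D m # w)) = 0"
    and dyson: "\<And>l w. l \<in> {1..p} \<Longrightarrow> w \<in> lists (y ` {1..p} \<union> D ` {1..p + 1})
      \<Longrightarrow> \<phi> (NC_Word (y l # w)) = block_sum (\<kappa> l) \<phi> (y l) 1 [] w"
    and y_inj: "inj_on y {1..p}" and D_inj: "inj D" and y_D: "\<And>l m. y l \<noteq> D m"
    and D_nz: "\<And>l. l \<in> {1..p + 1} \<Longrightarrow> \<phi> (NC_Word [D l]) \<noteq> 0"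
    and \<kappa>_nz: "\<And>l. l \<in> {1..p} \<Longrightarrow> \<kappa> l 2 \<noteq> 0"
begin

abbreviation alphabet :: "'i set" where "alphabet \<equiv> y ` {1..p} \<union> D ` {1..p + 1}"

text \<open>The walk from \<open>l\<close> straight up to the vertex \<open>p + 1\<close> and back, by recursion on \<open>n = p + 1 - l\<close>.\<close>

primrec up_walk_aux :: "nat \<Rightarrow> 'i list" where
  "up_walk_aux 0 = [D (p + 1)]"
| "up_walk_aux (Suc n) = D (p - n) # y (p - n) # up_walk_aux n @ [y (p - n), D (p - n)]"

definition up_walk :: "nat \<Rightarrow> 'i list" where "up_walk l = up_walk_aux (p + 1 - l)"

text \<open>The walk from \<open>l = n + 1\<close> straight down to the vertex \<open>1\<close> and back.\<close>

primrec down_walk_aux :: "nat \<Rightarrow> 'i list" where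
  "down_walk_aux 0 = [D 1]"
| "down_walk_aux (Suc n) = D (Suc (Suc n)) # y (Suc n) # down_walk_aux n @ [y (Suc n), D (Suc (Suc n))]"

definition down_walk :: "nat \<Rightarrow> 'i list" where "down_walk l = down_walk_aux (l - 1)"

text \<open>The same excursions without the visits of \<open>l\<close> at their ends, so that \<open>D l\<close> occurs once between
  consecutive excursions of a longer walk.\<close>

definition up_loop :: "nat \<Rightarrow> 'i list" where "up_loop l = y l # up_walk (l + 1) @ [y l]"

definition down_loop :: "nat \<Rightarrow> 'i list" where "down_loop l = y (l - 1) # down_walk (l - 1) @ [y (l - 1)]"

lemma up_walk_top: "up_walk (p + 1) = [D (p + 1)]"
  by (simp add: up_walk_def)

lemma up_walk_step: "l \<in> {1..p} \<Longrightarrow> up_walk l = D l # up_loop l @ [D l]"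
proof -
  assume l: "l \<in> {1..p}"
  then have "p + 1 - l = Suc (p - l)" "p - (p - l) = l" "p + 1 - (l + 1) = p - l" by auto
  then show ?thesis by (simp add: up_walk_def up_loop_def)
qed

lemma down_walk_bottom: "down_walk 1 = [D 1]"
  by (simp add: down_walk_def)

lemma down_walk_step: "2 \<le> l \<Longrightarrow> down_walk l = D l # down_loop l @ [D l]"
proof -
  assume "2 \<le> l"
  then obtain n where "l = Suc (Suc n)" by (metis Suc_le_D numeral_2_eq_2 Suc_le_mono)
  then show ?thesis by (simp add: down_walk_def down_loop_def)
qed

lemma set_up_walk:
  assumes "1 \<le> l" "l \<le> p + 1"
  shows "set (up_walk l) \<subseteq> y ` {l..p} \<union> D ` {l..p + 1}"
proof -
  have "n \<le> p \<Longrightarrow> set (up_walk_aux n) \<subseteq> y ` {p + 1 - n..p} \<union> D ` {p + 1 - n..p + 1}" for n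
  proof (induction n)
    case (Suc n)
    have "y ` {p + 1 - n..p} \<union> D ` {p + 1 - n..p + 1} \<subseteq> y ` {p - n..p} \<union> D ` {p - n..p + 1}"
      by (intro Un_mono image_mono) auto
    moreover have "set (up_walk_aux n) \<subseteq> y ` {p + 1 - n..p} \<union> D ` {p + 1 - n..p + 1}"
      using Suc by simp
    ultimately have "set (up_walk_aux n) \<subseteq> y ` {p - n..p} \<union> D ` {p - n..p + 1}" by (rule order_trans[rotated])
    moreover have "p - n \<in> {p - n..p}" "p - n \<in> {p - n..p + 1}" by auto
    ultimately have "set (up_walk_aux (Suc n)) \<subseteq> y ` {p - n..p} \<union> D ` {p - n..p + 1}"
      unfolding up_walk_aux.simps set_simps set_append by blast
    then show ?case by simp
  qed simp
  from this[of "p + 1 - l"] show ?thesis using assms by (simp add: up_walk_def)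
qed

lemma set_down_walk:
  assumes "1 \<le> l"
  shows "set (down_walk l) \<subseteq> y ` {1..<l} \<union> D ` {1..l}"
proof -
  have "set (down_walk_aux n) \<subseteq> y ` {1..<Suc n} \<union> D ` {1..Suc n}" for n
  proof (induction n)
    case (Suc n)
    have "{1..<Suc (Suc n)} = insert (Suc n) {1..<Suc n}" "{1..Suc (Suc n)} = insert (Suc (Suc n)) {1..Suc n}"
      by auto
    then show ?case using Suc by auto
  qed simp
  from this[of "l - 1"] show ?thesis using assms by (simp add: down_walk_def)
qed

lemma up_walk_lists: "1 \<le> l \<Longrightarrow> l \<le> p + 1 \<Longrightarrow> up_walk l \<in> lists alphabet"
  using set_up_walk[of l] by fastforce

lemma down_walk_lists: "1 \<le> l \<Longrightarrow> l \<le> p + 1 \<Longrightarrow> down_walk l \<in> lists alphabet"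
  using set_down_walk[of l] by fastforce

lemma up_loop_lists: "l \<in> {1..p} \<Longrightarrow> up_loop l \<in> lists alphabet"
  using up_walk_lists[of "l + 1"] by (auto simp: up_loop_def)

lemma down_loop_lists: "l \<in> {2..p + 1} \<Longrightarrow> down_loop l \<in> lists alphabet"
  using down_walk_lists[of "l - 1"] by (cases l) (auto simp: down_loop_def)

lemma y_notin_up_walk: "l \<in> {1..p} \<Longrightarrow> y l \<notin> set (up_walk (l + 1))"
proof
  assume l: "l \<in> {1..p}" and "y l \<in> set (up_walk (l + 1))"
  then obtain m where "y l = y m" "m \<in> {l + 1..p}"
    using set_up_walk[of "l + 1"] y_D by fastforce
  then show False using y_inj l by (auto dest: inj_onD)
qed

lemma y_notin_down_walk: "l \<in> {1..p} \<Longrightarrow> y l \<notin> set (down_walk l)"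
proof
  assume l: "l \<in> {1..p}" and "y l \<in> set (down_walk l)"
  then obtain m where "y l = y m" "m \<in> {1..<l}"
    using set_down_walk[of l] y_D by fastforce
  then show False using y_inj l by (auto dest: inj_onD)
qed

lemma up_walk_ends: "l \<in> {1..p + 1} \<Longrightarrow> (\<exists>x. up_walk l = D l # x) \<and> (\<exists>x. up_walk l = x @ [D l])"
  using up_walk_top up_walk_step[of l] by (cases "l = p + 1") auto

lemma down_walk_ends: "1 \<le> l \<Longrightarrow> (\<exists>x. down_walk l = D l # x) \<and> (\<exists>x. down_walk l = x @ [D l])"
  using down_walk_bottom down_walk_step[of l] by (cases "l = 1") auto

lemma lists_concat_replicate: "w \<in> lists S \<Longrightarrow> concat (replicate k w) \<in> lists S"
  by (induction k) auto

lemma rotate_power: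
  assumes "a \<in> lists alphabet" "b \<in> lists alphabet"
  shows "\<phi> (NC_Word (concat (replicate k (a @ b)))) = \<phi> (NC_Word (concat (replicate k (b @ a))))"
proof (cases k)
  case (Suc m)
  have "\<phi> (NC_Word (a @ (b @ concat (replicate m (a @ b))))) = \<phi> (NC_Word ((b @ concat (replicate m (a @ b))) @ a))"
    using assms lists_concat_replicate[of "a @ b" alphabet m] by (intro trace) auto
  also have "(b @ concat (replicate m (a @ b))) @ a = concat (replicate (Suc m) (b @ a))"
    using concat_replicate_rotate[of a m b] by (induction m) auto
  finally show ?thesis by (simp add: Suc)
qed simp

text \<open>By the trace property the two end letters become neighbours.\<close>

lemma different_ends_zero:
  assumes i: "i \<in> {1..p + 1}" "m \<in> {1..p + 1}" "i \<noteq> m" and w: "w \<in> lists alphabet"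
    and ends: "w = D i # x" "w = z @ [D m]"
  shows "\<phi> (NC_Word w) = 0"
proof -
  obtain x' where x': "w = D i # x' @ [D m]"
    using ends i(3) D_inj by (cases z) (auto dest: injD)
  have "\<phi> (NC_Word ((D i # x') @ [D m])) = \<phi> (NC_Word ([D m] @ (D i # x')))"
    using w x' by (intro trace) auto
  then show ?thesis
    using orth[of m i x'] i w x' by simp
qed


text \<open>The series \<open>M\<close>, \<open>A\<^sub>l\<close>, \<open>B\<^sub>l\<close> of the introduction; \<open>cumulant_factor l\<close> is \<open>R\<^sub>l(x) / x\<close> at
  \<open>x = z A\<^bsub>l+1\<^esub> B\<^sub>l\<close>.\<close>

definition moment_series :: "nat \<Rightarrow> complex fps" where
  "moment_series l = Abs_fps (\<lambda>k. if k = 0 then 0 else \<phi> (NC_Word (concat (replicate k (up_loop l @ down_walk l)))))"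

definition up_series :: "nat \<Rightarrow> complex fps" where
  "up_series l = Abs_fps (\<lambda>j. \<phi> (NC_Word (concat (replicate j (up_walk l @ down_loop l)) @ up_walk l)))"

definition down_series :: "nat \<Rightarrow> complex fps" where
  "down_series l = Abs_fps (\<lambda>j. \<phi> (NC_Word (concat (replicate j (down_walk l @ up_loop l)) @ down_walk l)))"

definition cumulant_factor :: "nat \<Rightarrow> complex fps" where
  "cumulant_factor l = Abs_fps (\<lambda>j. \<kappa> l (2 * Suc j)) oo (fps_X * (up_series (l + 1) * down_series l))"

text \<open>The gaps between the letters \<open>y l\<close> are the walks above and below the edge. With the last gap
  \<open>down_walk l\<close> the word is a power of \<open>up_loop l @ down_walk l\<close>; with the last gap \<open>[D l]\<close> it is a
  walk at \<open>l\<close> that starts and ends with an upward excursion.\<close>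

lemma dyson_excursions:
  assumes l: "l \<in> {1..p}" and \<gamma>: "\<gamma> = down_walk l \<or> \<gamma> = [D l]"
  shows "Abs_fps (\<lambda>k. \<phi> (NC_Word (concat (replicate k (up_loop l @ down_walk l)) @ up_loop l @ \<gamma>)))
    = up_series (l + 1) * Abs_fps (\<lambda>j. \<phi> (NC_Word (concat (replicate j (down_walk l @ up_loop l)) @ \<gamma>))) * cumulant_factor l"
proof -
  let ?\<alpha> = "up_walk (l + 1)" and ?\<beta> = "down_walk l"
  have mem: "l \<in> {1..p + 1}" "l + 1 \<in> {1..p + 1}" "l + 1 \<noteq> l" "l \<noteq> l + 1" using l by auto
  obtain a1 a2 where a: "?\<alpha> = D (l + 1) # a1" "?\<alpha> = a2 @ [D (l + 1)]"
    using up_walk_ends[OF mem(2)] by blast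
  obtain b1 b2 where b: "?\<beta> = D l # b1" "?\<beta> = b2 @ [D l]"
    using down_walk_ends[of l] l by auto
  obtain c where c: "\<gamma> = c @ [D l]" using \<gamma> b(2) by auto
  have lists: "?\<alpha> \<in> lists alphabet" "?\<beta> \<in> lists alphabet" "\<gamma> \<in> lists alphabet" "[y l] \<in> lists alphabet"
    using up_walk_lists[of "l + 1"] down_walk_lists[of l] \<gamma> l mem by auto
  have words: "concat (replicate j (u @ y l # v @ [y l])) @ u @ y l # w \<in> lists alphabet"
    if "u \<in> lists alphabet" "v \<in> lists alphabet" "w \<in> lists alphabet" for u v w j
    using that lists(4) lists_concat_replicate[of "u @ y l # v @ [y l]" alphabet j] by auto
  have join: "interleave (y l) (concat (replicate j [u, v]) @ [u, w])
      = concat (replicate j (u @ y l # v @ [y l])) @ u @ y l # w" for u v w j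
    by (induction j) (simp_all add: interleave_Cons)
  have hd: "\<exists>x. concat (replicate j (u @ v)) @ u @ w = d # x" if "u = d # u'" for u v w u' j and d :: 'i
    using that by (cases j) auto
  have z: "\<phi> (NC_Word (concat (replicate j (u @ y l # v @ [y l])) @ u @ y l # w)) = 0"
    if "u = D i # u'" "w = w' @ [D m]" "i \<in> {1..p + 1}" "m \<in> {1..p + 1}" "i \<noteq> m"
      "u \<in> lists alphabet" "v \<in> lists alphabet" "w \<in> lists alphabet" for u v w u' w' i m j
  proof -
    have "\<exists>x. concat (replicate j (u @ (y l # v @ [y l]))) @ u @ (y l # w) = D i # x"
      by (rule hd[OF that(1)])
    then obtain x where "concat (replicate j (u @ (y l # v @ [y l]))) @ u @ (y l # w) = D i # x" ..
    then show ?thesis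
      by (rule different_ends_zero[OF that(3-5) words[OF that(6-8)]]) (simp add: that(2))
  qed
  have notin: "y l \<notin> set ?\<alpha>" "y l \<notin> set ?\<beta>" "y l \<notin> set \<gamma>"
    using y_notin_up_walk y_notin_down_walk l \<gamma> y_D by auto
  have "\<phi> (NC_Word (concat (replicate k (up_loop l @ down_walk l)) @ up_loop l @ \<gamma>))
      = gap_sum (\<kappa> l) \<phi> (y l) 1 (concat (replicate k [?\<alpha>, ?\<beta>]) @ [?\<alpha>, \<gamma>])" for k
  proof -
    have "concat (replicate k (up_loop l @ down_walk l)) @ up_loop l @ \<gamma>
        = y l # interleave (y l) (concat (replicate k [?\<alpha>, ?\<beta>]) @ [?\<alpha>, \<gamma>])"
      unfolding join by (induction k) (simp_all add: up_loop_def)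
    then have "\<phi> (NC_Word (concat (replicate k (up_loop l @ down_walk l)) @ up_loop l @ \<gamma>))
        = block_sum (\<kappa> l) \<phi> (y l) 1 [] (interleave (y l) (concat (replicate k [?\<alpha>, ?\<beta>]) @ [?\<alpha>, \<gamma>]))"
      using dyson[OF l] words[OF lists(1-3), of k] by (simp only: join)
    also have "\<dots> = gap_sum (\<kappa> l) \<phi> (y l) 1 (concat (replicate k [?\<alpha>, ?\<beta>]) @ [?\<alpha>, \<gamma>])"
      by (rule block_sum_interleave) (use notin in \<open>auto split: if_splits\<close>)
    finally show ?thesis .
  qed
  moreover have "Abs_fps (\<lambda>k. gap_sum (\<kappa> l) \<phi> (y l) 1 (concat (replicate k [?\<alpha>, ?\<beta>]) @ [?\<alpha>, \<gamma>]))
    = Abs_fps (\<lambda>j. \<phi> (NC_Word (concat (replicate j (?\<alpha> @ y l # ?\<beta> @ [y l])) @ ?\<alpha>)))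
      * Abs_fps (\<lambda>j. \<phi> (NC_Word (concat (replicate j (?\<beta> @ y l # ?\<alpha> @ [y l])) @ \<gamma>)))
      * (Abs_fps (\<lambda>j. \<kappa> l (2 * Suc j)) oo (fps_X
          * (Abs_fps (\<lambda>j. \<phi> (NC_Word (concat (replicate j (?\<alpha> @ y l # ?\<beta> @ [y l])) @ ?\<alpha>)))
             * Abs_fps (\<lambda>j. \<phi> (NC_Word (concat (replicate j (?\<beta> @ y l # ?\<alpha> @ [y l])) @ ?\<beta>))))))"
    by (rule gap_sum_alternating[OF notin]; unfold join)
       (rule z[OF a(1) b(2) mem(2,1,3) lists(1,2,2)] z[OF a(1) c mem(2,1,3) lists(1,2,3)]
          z[OF b(1) a(2) mem(1,2,4) lists(2,1,1)])+
  ultimately show ?thesis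
    unfolding cumulant_factor_def up_series_def down_series_def by (simp add: up_loop_def down_loop_def)
qed

text \<open>The final \<open>D l\<close> is moved to the front and absorbed there. This fails only for the empty walk,
  which contributes the constant term.\<close>

lemma down_up_moments:
  assumes l: "l \<in> {1..p}"
  shows "Abs_fps (\<lambda>j. \<phi> (NC_Word (concat (replicate j (down_walk l @ up_loop l)) @ [D l])))
    = fps_const (\<phi> (NC_Word [D l])) + moment_series l"
proof (rule fps_ext)
  fix k
  have lists: "down_walk l \<in> lists alphabet" "up_loop l \<in> lists alphabet" "[D l] \<in> lists alphabet"
    using down_walk_lists[of l] up_loop_lists[of l] l by auto
  obtain x where x: "down_walk l = D l # x" using down_walk_ends[of l] l by auto
  have "\<phi> (NC_Word (concat (replicate (Suc m) (down_walk l @ up_loop l)) @ [D l]))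
      = \<phi> (NC_Word (concat (replicate (Suc m) (up_loop l @ down_walk l))))" for m
  proof -
    let ?w = "concat (replicate (Suc m) (down_walk l @ up_loop l))"
    have w: "?w \<in> lists alphabet" using lists by (intro lists_concat_replicate) auto
    obtain x' where x': "?w = D l # x'" using x by simp
    have "\<phi> (NC_Word (?w @ [D l])) = \<phi> (NC_Word ([D l] @ ?w))"
      using w lists(3) by (rule trace)
    also have "\<dots> = \<phi> (NC_Word ?w)"
      using idem[of l x'] w l unfolding x' by auto
    also have "\<dots> = \<phi> (NC_Word (concat (replicate (Suc m) (up_loop l @ down_walk l))))"
      by (rule rotate_power[OF lists(1,2)])
    finally show ?thesis .
  qed
  then show "fps_nth (Abs_fps (\<lambda>j. \<phi> (NC_Word (concat (replicate j (down_walk l @ up_loop l)) @ [D l])))) k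
      = fps_nth (fps_const (\<phi> (NC_Word [D l])) + moment_series l) k"
    by (cases k) (simp_all add: moment_series_def)
qed

lemma moment_series_eq:
  assumes l: "l \<in> {1..p}"
  shows "moment_series l = fps_X * (up_series (l + 1) * down_series l * cumulant_factor l)"
proof -
  have "up_series (l + 1) * down_series l * cumulant_factor l = Abs_fps (\<lambda>k. \<phi> (NC_Word (concat (replicate (Suc k) (up_loop l @ down_walk l)))))"
    using dyson_excursions[OF l, of "down_walk l"] unfolding down_series_def concat_replicate_Suc append_assoc by simp
  then show ?thesis
    unfolding moment_series_def by (intro fps_ext) (simp add: fps_X_mult_nth del: replicate_Suc)
qed

lemma up_series_eq:
  assumes l: "l \<in> {2..p}"
  shows "up_series l = up_series (l + 1) * (fps_const (\<phi> (NC_Word [D l])) + moment_series l) * cumulant_factor l"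
proof -
  have l1: "l \<in> {1..p}" using l by auto
  have "\<phi> (NC_Word (concat (replicate j (up_walk l @ down_loop l)) @ up_walk l))
      = \<phi> (NC_Word (concat (replicate j (up_loop l @ down_walk l)) @ up_loop l @ [D l]))" for j
  proof -
    let ?w = "concat (replicate j (up_loop l @ down_walk l)) @ up_loop l"
    have w: "?w \<in> lists alphabet" "[D l] \<in> lists alphabet"
      using down_walk_lists[of l] up_loop_lists[OF l1] l lists_concat_replicate[of "up_loop l @ down_walk l" alphabet j] by auto
    have "concat (replicate j (up_walk l @ down_loop l)) @ up_walk l = [D l] @ (?w @ [D l])"
      using l1 l by (induction j) (simp_all add: up_walk_step down_walk_step)
    then have "\<phi> (NC_Word (concat (replicate j (up_walk l @ down_loop l)) @ up_walk l)) = \<phi> (NC_Word ((?w @ [D l]) @ [D l]))"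
      using trace[of "[D l]" "?w @ [D l]"] w by auto
    also have "\<dots> = \<phi> (NC_Word ([D l, D l] @ ?w))"
      using trace[of ?w "[D l, D l]"] w by auto
    also have "\<dots> = \<phi> (NC_Word ([D l] @ ?w))"
      using idem[of l ?w] w l by auto
    also have "\<dots> = \<phi> (NC_Word (?w @ [D l]))"
      by (rule trace) (use w in auto)
    finally show ?thesis by simp
  qed
  then show ?thesis
    using dyson_excursions[OF l1, of "[D l]"] down_up_moments[OF l1] by (simp add: up_series_def)
qed

text \<open>A walk that repeats the full excursion may be started at any vertex, by the trace property.\<close>

lemma moment_series_const: "l \<in> {1..p} \<Longrightarrow> moment_series l = moment_series 1"
proof (induction l rule: less_induct)
  case (less l)
  show ?case
  proof (cases "l = 1")
    case False
    then obtain m where m: "l = m + 1" "m \<in> {1..p}" using less.prems by (cases l) auto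
    have lists: "[y m] \<in> lists alphabet" "up_walk l @ y m # down_walk m \<in> lists alphabet" "up_walk l @ down_loop l \<in> lists alphabet"
      "[D l] \<in> lists alphabet" "up_loop l \<in> lists alphabet" "down_loop l \<in> lists alphabet"
      using m less.prems up_walk_lists[of l] down_walk_lists[of m] up_loop_lists[of l] down_loop_lists[of l] by auto
    have "\<phi> (NC_Word (concat (replicate k (up_loop m @ down_walk m)))) = \<phi> (NC_Word (concat (replicate k (up_loop l @ down_walk l))))" for k
    proof -
      have "\<phi> (NC_Word (concat (replicate k (up_loop m @ down_walk m))))
          = \<phi> (NC_Word (concat (replicate k ([y m] @ (up_walk l @ y m # down_walk m)))))"
        by (simp add: up_loop_def m)
      also have "\<dots> = \<phi> (NC_Word (concat (replicate k ((up_walk l @ y m # down_walk m) @ [y m]))))"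
        by (rule rotate_power) (use lists in auto)
      also have "(up_walk l @ y m # down_walk m) @ [y m] = [D l] @ (up_loop l @ [D l] @ down_loop l)"
        using less.prems by (simp add: down_loop_def m up_walk_step)
      also have "\<phi> (NC_Word (concat (replicate k ([D l] @ (up_loop l @ [D l] @ down_loop l)))))
          = \<phi> (NC_Word (concat (replicate k ((up_loop l @ [D l] @ down_loop l) @ [D l]))))"
        by (rule rotate_power) (use lists in auto)
      also have "(up_loop l @ [D l] @ down_loop l) @ [D l] = up_loop l @ down_walk l"
        using down_walk_step[of l] m by simp
      finally show ?thesis .
    qed
    then have "moment_series m = moment_series l"
      unfolding moment_series_def by (intro arg_cong[where f = Abs_fps] ext if_cong refl)
    moreover have "moment_series m = moment_series 1"
      by (rule less.IH) (use m in auto)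
    ultimately show ?thesis by simp
  qed simp
qed

lemma up_series_top: "up_series (p + 1) = fps_const (\<phi> (NC_Word [D (p + 1)])) + moment_series p"
proof (rule fps_ext)
  fix k
  let ?D = "[D (p + 1)]"
  have lists: "?D \<in> lists alphabet" "[y p] \<in> lists alphabet" "down_loop (p + 1) \<in> lists alphabet" "down_walk p \<in> lists alphabet"
    using down_loop_lists[of "p + 1"] down_walk_lists[of p] p by auto
  have "\<phi> (NC_Word (concat (replicate (Suc m) (?D @ down_loop (p + 1))) @ ?D))
      = \<phi> (NC_Word (concat (replicate (Suc m) (up_loop p @ down_walk p))))" for m
  proof -
    let ?w = "concat (replicate (Suc m) (?D @ down_loop (p + 1)))"
    have w: "?w \<in> lists alphabet" using lists by (intro lists_concat_replicate) auto
    obtain x' where x': "?w = D (p + 1) # x'" by simp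
    have "\<phi> (NC_Word (?w @ ?D)) = \<phi> (NC_Word (?D @ ?w))"
      using w lists(1) by (rule trace)
    also have "\<dots> = \<phi> (NC_Word ?w)"
    proof -
      have "x' \<in> lists alphabet" using w unfolding x' by simp
      then show ?thesis using idem[of "p + 1" x'] unfolding x' by simp
    qed
    also have "\<phi> (NC_Word ?w) = \<phi> (NC_Word (concat (replicate (Suc m) ((?D @ y p # down_walk p) @ [y p]))))"
      by (simp add: down_loop_def)
    also have "\<dots> = \<phi> (NC_Word (concat (replicate (Suc m) ([y p] @ (?D @ y p # down_walk p)))))"
      by (rule rotate_power) (use lists in auto)
    also have "[y p] @ (?D @ y p # down_walk p) = up_loop p @ down_walk p"
      using up_walk_top by (simp add: up_loop_def)
    finally show ?thesis .
  qed
  then show "fps_nth (up_series (p + 1)) k = fps_nth (fps_const (\<phi> (NC_Word ?D)) + moment_series p) k"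
    using up_walk_top by (cases k) (simp_all add: moment_series_def up_series_def)
qed

lemma down_series_bot: "down_series 1 = fps_const (\<phi> (NC_Word [D 1])) + moment_series 1"
  using down_up_moments[of 1] p down_walk_bottom by (simp add: down_series_def)


lemma cumulant_factor_nth_0: "fps_nth (cumulant_factor l) 0 = \<kappa> l 2"
  by (simp add: cumulant_factor_def numeral_2_eq_2)

lemma moment_series_nth_0: "fps_nth (moment_series l) 0 = 0"
  by (simp add: moment_series_def)

lemma up_series_nth_0: "l \<in> {2..p + 1} \<Longrightarrow> fps_nth (up_series l) 0 \<noteq> 0"
proof (induction "p + 1 - l" arbitrary: l)
  case 0
  then have "l = p + 1" by auto
  then show ?case using D_nz[of "p + 1"] up_series_top moment_series_nth_0 by simp
next
  case (Suc n)
  then have l: "l \<in> {2..p}" "l \<in> {1..p}" "l \<in> {1..p + 1}" by auto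
  have "fps_nth (up_series (l + 1)) 0 \<noteq> 0" using Suc l by auto
  then show ?case
    using up_series_eq[OF l(1)] D_nz[OF l(3)] \<kappa>_nz[OF l(2)] by (simp add: moment_series_nth_0 cumulant_factor_nth_0)
qed

lemma moment_series_nz: "moment_series 1 \<noteq> 0"
proof -
  have "up_series 2 * down_series 1 * cumulant_factor 1 \<noteq> 0"
  proof
    assume "up_series 2 * down_series 1 * cumulant_factor 1 = 0"
    then have "fps_nth (up_series 2) 0 * fps_nth (down_series 1) 0 * fps_nth (cumulant_factor 1) 0 = 0"
      by (metis fps_mult_nth_0 fps_zero_nth)
    then show False
      using up_series_nth_0[of 2] D_nz[of 1] \<kappa>_nz[of 1] p
      by (simp add: down_series_bot[simplified] moment_series_nth_0 cumulant_factor_nth_0)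
  qed
  then show ?thesis
    using moment_series_eq[of 1] p by (simp add: numeral_2_eq_2)
qed

text \<open>The equation \<open>M = R\<^sub>l(z A\<^bsub>l+1\<^esub> B\<^sub>l)\<close>, solved for the argument of \<open>R\<^sub>l\<close>.\<close>

lemma S_compose_moment_series:
  assumes l: "l \<in> {1..p}" and S: "fps_X * S = fps_inv (cumulant_series (\<lambda>k. \<kappa> l (2 * k)))"
  shows "moment_series 1 * (S oo moment_series 1) = fps_X * (up_series (l + 1) * down_series l)"
proof -
  have M0: "fps_nth (moment_series 1) 0 = 0" by (rule moment_series_nth_0)
  have "moment_series 1 = cumulant_series (\<lambda>k. \<kappa> l (2 * k)) oo (fps_X * (up_series (l + 1) * down_series l))"
    using moment_series_eq[OF l] moment_series_const[OF l] by (simp add: cumulant_series_compose cumulant_factor_def mult.assoc)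
  then have "fps_inv (cumulant_series (\<lambda>k. \<kappa> l (2 * k))) oo moment_series 1 = fps_X * (up_series (l + 1) * down_series l)"
    using \<kappa>_nz[OF l] by (intro compose_fps_inv) (simp_all add: cumulant_series_nth_1)
  then show ?thesis
    using M0 unfolding S[symmetric] by (simp add: fps_compose_mult_distrib)
qed

text \<open>Eliminates the cumulants of the edge above the inner vertex \<open>l + 1\<close>: they enter \<open>A\<^bsub>l+1\<^esub>\<close> and \<open>M\<close> through
  the same factor.\<close>

lemma up_series_down_series:
  assumes l: "l \<in> {1..p}" "l < p"
  shows "fps_X * (up_series (l + 1) * down_series (l + 1)) = moment_series 1 * (fps_const (\<phi> (NC_Word [D (l + 1)])) + moment_series 1)"
proof -
  have l1: "l + 1 \<in> {2..p}" "l + 1 \<in> {1..p}" using l by auto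
  have "fps_X * (up_series (l + 1) * down_series (l + 1))
      = fps_X * (up_series (l + 1 + 1) * down_series (l + 1) * cumulant_factor (l + 1)) * (fps_const (\<phi> (NC_Word [D (l + 1)])) + moment_series 1)"
    by (subst up_series_eq[OF l1(1)], subst moment_series_const[OF l1(2)]) (simp only: mult_ac)
  also have "fps_X * (up_series (l + 1 + 1) * down_series (l + 1) * cumulant_factor (l + 1)) = moment_series 1"
    using moment_series_eq[OF l1(2)] moment_series_const[OF l1(2)] by simp
  finally show ?thesis .
qed

text \<open>Multiply the equations of the edges from the bottom to the top. After each inner vertex one factor
  \<open>M\<close> cancels, which is possible because \<open>M \<noteq> 0\<close>: its first coefficient is a product of the nonzero
  numbers \<open>\<phi>(D l)\<close> and \<open>\<kappa> l 2\<close>.\<close>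

lemma moment_equation:
  assumes S: "\<And>l. l \<in> {1..p} \<Longrightarrow> fps_X * S l = fps_inv (cumulant_series (\<lambda>k. \<kappa> l (2 * k)))"
  shows "moment_series 1 * ((\<Prod>l\<in>{1..p}. S l) oo moment_series 1)
    = fps_X * (\<Prod>l\<in>{1..p + 1}. fps_const (\<phi> (NC_Word [D l])) + moment_series 1)"
proof -
  let ?M = "moment_series 1" and ?f = "\<lambda>l. fps_const (\<phi> (NC_Word [D l])) + moment_series 1"
  have M0: "fps_nth ?M 0 = 0" by (rule moment_series_nth_0)
  have "?M * ((\<Prod>l\<in>{1..n}. S l) oo ?M) = fps_X * up_series (n + 1) * (\<Prod>l\<in>{1..n}. ?f l)" if "1 \<le> n" "n \<le> p" for n
    using that
  proof (induction n rule: nat_induct_at_least)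
    case base
    then show ?case
      using S_compose_moment_series[of 1 "S 1", OF _ S] p down_series_bot by (simp add: mult_ac)
  next
    case (Suc n)
    have n: "n \<in> {1..p}" "n + 1 \<in> {1..p}" "n < p" using Suc by auto
    have split: "(\<Prod>l\<in>{1..Suc n}. g l) = g (n + 1) * (\<Prod>l\<in>{1..n}. g l)" for g :: "nat \<Rightarrow> complex fps"
      by (simp add: mult.commute)
    have "?M * (?M * ((\<Prod>l\<in>{1..Suc n}. S l) oo ?M))
        = (?M * (S (n + 1) oo ?M)) * (?M * ((\<Prod>l\<in>{1..n}. S l) oo ?M))"
      unfolding split using M0 by (simp add: fps_compose_mult_distrib mult_ac)
    also have "\<dots> = (fps_X * (up_series (n + 1 + 1) * down_series (n + 1))) * (fps_X * up_series (n + 1) * (\<Prod>l\<in>{1..n}. ?f l))"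
      using Suc.IH S_compose_moment_series[OF n(2) S[OF n(2)]] n by simp
    also have "\<dots> = fps_X * up_series (n + 1 + 1) * (\<Prod>l\<in>{1..n}. ?f l) * (fps_X * (up_series (n + 1) * down_series (n + 1)))"
      by (simp only: mult_ac)
    also have "\<dots> = ?M * (fps_X * up_series (Suc n + 1) * (\<Prod>l\<in>{1..Suc n}. ?f l))"
      unfolding up_series_down_series[OF n(1,3)] split by (simp add: mult_ac)
    finally show ?case using moment_series_nz by simp
  qed
  from this[OF p order_refl] have "?M * ((\<Prod>l\<in>{1..p}. S l) oo ?M)
      = fps_X * (?f (p + 1) * (\<Prod>l\<in>{1..p}. ?f l))"
    using up_series_top moment_series_const[of p] p by (simp add: mult_ac)
  then show ?thesis by (simp add: mult.commute)
qed

end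

lemma S_transform_nth_0:
  assumes "\<mu> 1 \<noteq> 0"
  shows "fps_nth (S_transform \<mu>) 0 \<noteq> 0"
proof -
  let ?g = "fps_inv (psi_series \<mu>)"
  have "fps_nth (?g oo psi_series \<mu>) 1 = 1"
    using assms by (subst fps_inv) (simp_all add: psi_series_nth_1)
  then have "fps_nth ?g 1 \<noteq> 0"
    by (auto simp: fps_compose_nth fps_inv_def)
  moreover have "fps_nth (fps_X * S_transform \<mu>) 1 = fps_nth ?g 1"
    unfolding S_transform_eq by (simp add: distrib_right fps_inv_def)
  ultimately show ?thesis by simp
qed

lemma foldl_free_mult_conv:
  assumes "\<And>\<mu>. \<mu> \<in> set (\<mu>0 # \<mu>s) \<Longrightarrow> \<mu> 0 = 1 \<and> \<mu> 1 \<noteq> 0"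
  shows "foldl free_mult_conv \<mu>0 \<mu>s 0 = 1 \<and> foldl free_mult_conv \<mu>0 \<mu>s 1 \<noteq> 0
    \<and> S_transform (foldl free_mult_conv \<mu>0 \<mu>s) = prod_list (map S_transform (\<mu>0 # \<mu>s))"
  using assms
proof (induction \<mu>s arbitrary: \<mu>0)
  case (Cons \<mu> \<mu>s)
  have "\<mu>0 0 = 1" "\<mu> 0 = 1" "\<mu>0 1 \<noteq> 0" "\<mu> 1 \<noteq> 0" using Cons.prems by auto
  note conv = free_mult_conv_S_transform[OF this]
  show ?case
    using Cons.IH[of "free_mult_conv \<mu>0 \<mu>"] conv Cons.prems by (auto simp: mult.assoc)
qed simp

text \<open>Since \<open>S T = 1\<close>, the equation for \<open>M\<close> reads \<open>M = z (\<Prod>\<^sub>j (d\<^sub>j + X) T)(M)\<close>, and its coefficients follow by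
  Lagrange inversion. For \<open>k \<ge> 1\<close> the series \<open>M\<close> and \<open>B\<^sub>1 = d\<^sub>1 + M\<close> have the same coefficients.\<close>

theorem (in excursion_model) moments_formula:
  fixes d :: "nat \<Rightarrow> real"
  defines "\<nu>t \<equiv> \<lambda>l. distr_of_cumulants (\<lambda>k. \<kappa> l (2 * k))"
  assumes D: "\<And>l. l \<in> {1..p + 1} \<Longrightarrow> \<phi> (NC_Word [D l]) = of_real (d l)"
    and d: "\<And>l. l \<in> {1..p + 1} \<Longrightarrow> d l > 0" and k: "k \<ge> 1"
  shows "\<phi> (NC_Word (D 1 # concat (replicate k (up_loop 1 @ [D 1]))))
    = (\<Sum>s = 1..k. of_real (fuss_narayana p k s d)
        * T_coeff k s (fps_nth (T_transform (foldl free_mult_conv (\<nu>t 1) (map \<nu>t [2..<p + 1])))))"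
proof -
  let ?M = "moment_series 1" and ?\<rho> = "foldl free_mult_conv (\<nu>t 1) (map \<nu>t [2..<p + 1])"
  have M0: "fps_nth ?M 0 = 0" by (rule moment_series_nth_0)
  have rel: "cumulant_relation (\<nu>t l) (\<lambda>k. \<kappa> l (2 * k))" for l
    unfolding \<nu>t_def by (rule cumulant_relation_distr_of_cumulants)
  have \<nu>1: "\<nu>t l 1 \<noteq> 0" if "l \<in> {1..p}" for l
    using cumulant_relation_1[OF rel, of l] \<kappa>_nz[OF that] by simp
  have \<nu>0: "\<nu>t l 0 = 1" for l by (simp add: \<nu>t_def)
  have S: "fps_X * S_transform (\<nu>t l) = fps_inv (cumulant_series (\<lambda>k. \<kappa> l (2 * k)))" if "l \<in> {1..p}" for l
    by (rule S_transform_cumulants[OF rel \<nu>1[OF that]])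
  have upt: "[1..<p + 1] = 1 # [2..<p + 1]" using p by (simp add: upt_conv_Cons numeral_2_eq_2)
  have "?\<rho> 0 = 1 \<and> ?\<rho> 1 \<noteq> 0 \<and> S_transform ?\<rho> = prod_list (map S_transform (\<nu>t 1 # map \<nu>t [2..<p + 1]))"
    by (rule foldl_free_mult_conv) (use p \<nu>0 \<nu>1 in auto)
  moreover have "prod_list (map S_transform (\<nu>t 1 # map \<nu>t [2..<p + 1])) = prod_list (map (\<lambda>l. S_transform (\<nu>t l)) [1..<p + 1])"
    unfolding upt by (simp add: comp_def)
  moreover have "\<dots> = (\<Prod>l\<in>{1..p}. S_transform (\<nu>t l))"
    by (subst prod.distinct_set_conv_list[symmetric]) (auto intro: prod.cong)
  ultimately have \<rho>: "?\<rho> 1 \<noteq> 0" "S_transform ?\<rho> = (\<Prod>l\<in>{1..p}. S_transform (\<nu>t l))" by auto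
  let ?S = "S_transform ?\<rho>" and ?T = "T_transform ?\<rho>"
  have S0: "fps_nth ?S 0 \<noteq> 0" by (rule S_transform_nth_0[where \<mu> = ?\<rho>, OF \<rho>(1)])
  have T0: "fps_nth ?T 0 \<noteq> 0" using S0 by (simp add: T_transform_def)
  let ?P = "\<Prod>i<p + 1. fps_const (complex_of_real (d (i + 1))) + fps_X"
  have P: "?P oo ?M = (\<Prod>l\<in>{1..p + 1}. fps_const (\<phi> (NC_Word [D l])) + ?M)"
  proof -
    have "?P oo ?M = (\<Prod>i<p + 1. fps_const (complex_of_real (d (i + 1))) + ?M)"
      using M0 by (simp add: fps_compose_prod_distrib fps_compose_add_distrib del: prod.lessThan_Suc)
    also have "\<dots> = (\<Prod>l\<in>{1..p + 1}. fps_const (\<phi> (NC_Word [D l])) + ?M)"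
      by (rule prod.reindex_bij_witness[of _ "\<lambda>l. l - 1" Suc]) (auto simp: D)
    finally show ?thesis .
  qed
  have "?M * (?S oo ?M) = fps_X * (?P oo ?M)"
    unfolding \<rho>(2) P by (rule moment_equation[OF S])
  then have "?M * ((?S oo ?M) * (?T oo ?M)) = fps_X * ((?P * ?T) oo ?M)"
    using M0 by (simp add: fps_compose_mult_distrib mult.assoc[symmetric])
  moreover have "(?S oo ?M) * (?T oo ?M) = 1"
  proof -
    have "?S * ?T = 1" unfolding T_transform_def using S0 by (simp add: inverse_mult_eq_1')
    then show ?thesis using M0 by (simp add: fps_compose_mult_distrib[symmetric])
  qed
  ultimately have "?M = fps_X * ((?P * ?T) oo ?M)" by simp
  then have "fps_nth ?M k = (\<Sum>s = 1..k. of_real (fuss_narayana p k s d) * T_coeff k s (fps_nth ?T))"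
    using T0 d k by (rule coeff_of_functional_equation)
  moreover have "fps_nth ?M k = fps_nth (down_series 1) k"
    using k unfolding down_series_bot by simp
  moreover have "fps_nth (down_series 1) k = \<phi> (NC_Word (D 1 # concat (replicate k (up_loop 1 @ [D 1]))))"
    using concat_replicate_rotate[of "[D 1]" k "up_loop 1"] down_walk_bottom by (simp add: down_series_def)
  ultimately show ?thesis by simp
qed

section \<open>Matrices\<close>

lemma mat_prod_list_simps [simp]:
  "mat_prod_list n [] = 1\<^sub>m n" "mat_prod_list n (A # As) = A * mat_prod_list n As"
  by (simp_all add: mat_prod_list_def)

lemma mat_prod_list_carrier:
  "set As \<subseteq> carrier_mat n n \<Longrightarrow> mat_prod_list n As \<in> carrier_mat n n"
  by (induction As) (auto intro: mult_carrier_mat)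

lemma mat_prod_list_append:
  assumes "set As \<subseteq> carrier_mat n n" "set Bs \<subseteq> carrier_mat n n"
  shows "mat_prod_list n (As @ Bs) = mat_prod_list n As * mat_prod_list n Bs"
  using assms
proof (induction As)
  case Nil
  then show ?case using mat_prod_list_carrier[of Bs n] by simp
next
  case (Cons A As)
  then show ?case
    using mat_prod_list_carrier[of Bs n] mat_prod_list_carrier[of As n] assoc_mult_mat[of A n n] by auto
qed

lemma mat_prod_list_concat:
  assumes "\<And>As. As \<in> set Ls \<Longrightarrow> set As \<subseteq> carrier_mat n n"
  shows "mat_prod_list n (map (mat_prod_list n) Ls) = mat_prod_list n (concat Ls)"
  using assms
proof (induction Ls)
  case (Cons As Ls)
  then have "set As \<subseteq> carrier_mat n n" "set (concat Ls) \<subseteq> carrier_mat n n" by auto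
  then show ?case using Cons by (simp add: mat_prod_list_append)
qed simp

lemma mat_prod_list_replicate:
  "A \<in> carrier_mat n n \<Longrightarrow> mat_prod_list n (replicate k A) = A ^\<^sub>m k"
proof (induction k)
  case (Suc k)
  have "mat_prod_list n (replicate k A @ [A]) = A ^\<^sub>m k * A"
    using Suc by (subst mat_prod_list_append) (auto split: if_splits)
  then show ?case by (simp add: replicate_append_same)
qed auto

lemma mat_adjoint_index:
  assumes "A \<in> carrier_mat m n" "i < n" "j < m"
  shows "mat_adjoint A $$ (i, j) = conjugate (A $$ (j, i))"
  using assms unfolding mat_adjoint_def by (simp add: mat_of_rows_index)

lemma mat_adjoint_carrier: "A \<in> carrier_mat m n \<Longrightarrow> mat_adjoint A \<in> carrier_mat n m"
  unfolding mat_adjoint_def carrier_mat_def by (auto simp: mat_of_rows_def)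

lemma mat_adjoint_mult:
  fixes A B :: "complex mat"
  assumes A: "A \<in> carrier_mat n n" and B: "B \<in> carrier_mat n n"
  shows "mat_adjoint (A * B) = mat_adjoint B * mat_adjoint A"
proof (rule eq_matI)
  note c = mat_adjoint_carrier[OF A] mat_adjoint_carrier[OF B] mult_carrier_mat[OF A B]
  fix i j assume "i < dim_row (mat_adjoint B * mat_adjoint A)" "j < dim_col (mat_adjoint B * mat_adjoint A)"
  then have ij: "i < n" "j < n" using c by auto
  have "mat_adjoint (A * B) $$ (i, j) = conjugate ((A * B) $$ (j, i))"
    by (rule mat_adjoint_index[OF c(3) ij])
  also have "\<dots> = (\<Sum>k<n. conjugate (A $$ (j, k)) * conjugate (B $$ (k, i)))"
    using A B ij by (simp add: scalar_prod_def atLeast0LessThan)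
  also have "\<dots> = (\<Sum>k<n. mat_adjoint B $$ (i, k) * mat_adjoint A $$ (k, j))"
    using A B ij by (intro sum.cong refl) (simp add: mat_adjoint_index mult.commute)
  also have "\<dots> = (mat_adjoint B * mat_adjoint A) $$ (i, j)"
    using c ij by (simp add: scalar_prod_def atLeast0LessThan)
  finally show "mat_adjoint (A * B) $$ (i, j) = (mat_adjoint B * mat_adjoint A) $$ (i, j)" .
qed (use mat_adjoint_carrier[OF A] mat_adjoint_carrier[OF B] mat_adjoint_carrier[OF mult_carrier_mat[OF A B]] in auto)

lemma mat_adjoint_one: "mat_adjoint (1\<^sub>m n :: complex mat) = 1\<^sub>m n"
proof (rule eq_matI)
  fix i j assume "i < dim_row (1\<^sub>m n :: complex mat)" "j < dim_col (1\<^sub>m n :: complex mat)"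
  then have "i < n" "j < n" by auto
  then show "mat_adjoint (1\<^sub>m n :: complex mat) $$ (i, j) = 1\<^sub>m n $$ (i, j)"
    by (subst mat_adjoint_index[of _ n n]) auto
qed (use mat_adjoint_carrier[of "1\<^sub>m n" n n] in auto)

lemma mat_adjoint_prod_list:
  fixes As :: "complex mat list"
  assumes "\<And>A. A \<in> set As \<Longrightarrow> A \<in> carrier_mat n n \<and> mat_adjoint A = A"
  shows "mat_adjoint (mat_prod_list n As) = mat_prod_list n (rev As)"
  using assms
proof (induction As)
  case Nil
  then show ?case by (simp add: mat_adjoint_one)
next
  case (Cons A As)
  have c: "set As \<subseteq> carrier_mat n n" "A \<in> carrier_mat n n" using Cons.prems by auto
  have "mat_adjoint (A * mat_prod_list n As) = mat_adjoint (mat_prod_list n As) * mat_adjoint A"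
    by (rule mat_adjoint_mult[OF c(2) mat_prod_list_carrier[OF c(1)]])
  also have "\<dots> = mat_prod_list n (rev As) * mat_prod_list n [A]"
    using Cons c by (simp add: right_mult_one_mat[of A n n])
  also have "\<dots> = mat_prod_list n (rev As @ [A])"
    using c by (intro mat_prod_list_append[symmetric]) auto
  finally show ?case by simp
qed

lemma mat_trace_commute:
  assumes A: "A \<in> carrier_mat n n" and B: "B \<in> carrier_mat n n"
  shows "mat_trace (A * B) = mat_trace (B * A)"
proof -
  have "mat_trace (A * B) = (\<Sum>i<n. \<Sum>k<n. A $$ (i, k) * B $$ (k, i))"
    using A B by (simp add: mat_trace_def scalar_prod_def atLeast0LessThan)
  also have "\<dots> = (\<Sum>k<n. \<Sum>i<n. B $$ (k, i) * A $$ (i, k))"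
    by (subst sum.swap) (simp add: mult.commute)
  also have "\<dots> = mat_trace (B * A)"
    using A B by (simp add: mat_trace_def scalar_prod_def atLeast0LessThan)
  finally show ?thesis .
qed

lemma block_proj_carrier [simp]: "block_proj n N j \<in> carrier_mat n n"
  by (simp add: block_proj_def)

lemma diagonal_indicator_mult:
  "mat n n (\<lambda>(i, j). if i = j \<and> P i then 1 else 0) * mat n n (\<lambda>(i, j). if i = j \<and> Q i then 1 else 0)
    = (mat n n (\<lambda>(i, j). if i = j \<and> P i \<and> Q i then 1 else 0) :: complex mat)"
proof (rule eq_matI)
  fix i j
  assume "i < dim_row (mat n n (\<lambda>(i, j). if i = j \<and> P i \<and> Q i then 1 else 0) :: complex mat)"
    "j < dim_col (mat n n (\<lambda>(i, j). if i = j \<and> P i \<and> Q i then 1 else 0) :: complex mat)"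
  then have ij: "i < n" "j < n" by auto
  have "(\<Sum>k<n. (if i = k \<and> P i then 1 else 0) * (if k = j \<and> Q k then 1 else 0 :: complex))
    = (\<Sum>k<n. if k = i then (if i = j \<and> P i \<and> Q i then 1 else 0) else 0)"
    by (intro sum.cong refl) auto
  also have "\<dots> = (if i = j \<and> P i \<and> Q i then 1 else 0)"
    using ij by simp
  finally show "(mat n n (\<lambda>(i, j). if i = j \<and> P i then 1 else 0) * mat n n (\<lambda>(i, j). if i = j \<and> Q i then 1 else 0)) $$ (i, j)
      = (mat n n (\<lambda>(i, j). if i = j \<and> P i \<and> Q i then 1 else 0) :: complex mat) $$ (i, j)"
    using ij by (simp add: scalar_prod_def atLeast0LessThan)
qed auto

lemma block_proj_idem: "block_proj n N j * block_proj n N j = block_proj n N j"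
  unfolding block_proj_def diagonal_indicator_mult by simp

text \<open>The diagonal blocks belong to consecutive disjoint intervals of indices.\<close>

lemma block_proj_orth:
  assumes "l \<noteq> m" "1 \<le> l" "1 \<le> m"
  shows "block_proj n N l * block_proj n N m = 0\<^sub>m n n"
proof -
  have "(\<Sum>i\<in>{1..a}. N i) \<le> (\<Sum>i\<in>{1..<b}. N i)" if "a < b" for a b
    using that by (intro sum_mono2) auto
  then have "\<not> (((\<Sum>j\<in>{1..<l}. N j) \<le> i \<and> i < (\<Sum>j\<in>{1..l}. N j)) \<and> ((\<Sum>j\<in>{1..<m}. N j) \<le> i \<and> i < (\<Sum>j\<in>{1..m}. N j)))" for i
    using assms(1) by (meson leD le_less_trans less_le_trans linorder_neqE_nat)
  then show ?thesis
    unfolding block_proj_def diagonal_indicator_mult by (intro eq_matI) auto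
qed

lemma block_proj_trace:
  assumes "1 \<le> j" "(\<Sum>l\<in>{1..j}. N l) \<le> n"
  shows "mat_trace (block_proj n N j) = of_nat (N j)"
proof -
  let ?a = "\<Sum>l\<in>{1..<j}. N l" and ?b = "\<Sum>l\<in>{1..j}. N l"
  have "{1..j} = insert j {1..<j}" using assms(1) by auto
  then have ab: "?b = ?a + N j" by simp
  have "mat_trace (block_proj n N j) = (\<Sum>i<n. if ?a \<le> i \<and> i < ?b then 1 else 0)"
    by (simp add: mat_trace_def block_proj_def)
  also have "\<dots> = (\<Sum>i\<in>{?a..<?b}. 1)"
    using assms(2) by (intro sum.mono_neutral_cong_right) auto
  also have "\<dots> = of_nat (N j)" using ab by simp
  finally show ?thesis .
qed

lemma block_proj_adjoint: "mat_adjoint (block_proj n N j) = block_proj n N j"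
proof (rule eq_matI)
  fix i i' assume "i < dim_row (block_proj n N j)" "i' < dim_col (block_proj n N j)"
  then have "i < n" "i' < n" by (auto simp: block_proj_def)
  then show "mat_adjoint (block_proj n N j) $$ (i, i') = block_proj n N j $$ (i, i')"
    by (subst mat_adjoint_index[of _ n n]) (auto simp: block_proj_def)
qed (use mat_adjoint_carrier[of "block_proj n N j" n n] in \<open>auto simp: block_proj_def\<close>)

section \<open>Limits of traces\<close>

text \<open>All joint moments of the random matrices \<open>Z n i\<close> converge. Identities between the traces of matrix
  products carry over to the limit \<open>\<phi>\<close>.\<close>

locale limit_state =
  fixes M :: "nat \<Rightarrow> 'w measure" and Z :: "nat \<Rightarrow> 'i \<Rightarrow> 'w \<Rightarrow> complex mat"
    and S :: "'i set" and \<phi> :: "'i nc_word \<Rightarrow> complex"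
  assumes carrier: "\<And>n i \<omega>. i \<in> S \<Longrightarrow> \<omega> \<in> space (M n) \<Longrightarrow> Z n i \<omega> \<in> carrier_mat n n"
    and limit: "\<And>w. w \<in> lists S \<Longrightarrow>
      (\<lambda>n. tau (M n) n (\<lambda>\<omega>. mat_prod_list n (map (\<lambda>i. Z n i \<omega>) w))) \<longlonglongrightarrow> \<phi> (NC_Word w)"
begin

definition ev :: "nat \<Rightarrow> 'i list \<Rightarrow> 'w \<Rightarrow> complex mat" where
  "ev n w \<omega> = mat_prod_list n (map (\<lambda>i. Z n i \<omega>) w)"

lemma map_carrier: "w \<in> lists S \<Longrightarrow> \<omega> \<in> space (M n) \<Longrightarrow> set (map (\<lambda>i. Z n i \<omega>) w) \<subseteq> carrier_mat n n"
  using carrier by auto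

lemma ev_carrier: "w \<in> lists S \<Longrightarrow> \<omega> \<in> space (M n) \<Longrightarrow> ev n w \<omega> \<in> carrier_mat n n"
  unfolding ev_def by (intro mat_prod_list_carrier map_carrier)

lemma ev_append:
  assumes "v \<in> lists S" "w \<in> lists S" "\<omega> \<in> space (M n)"
  shows "ev n (v @ w) \<omega> = ev n v \<omega> * ev n w \<omega>"
  unfolding ev_def map_append using assms by (intro mat_prod_list_append map_carrier)

lemma ev_Cons: "ev n (i # w) \<omega> = Z n i \<omega> * ev n w \<omega>"
  by (simp add: ev_def)

lemma limit_ev: "w \<in> lists S \<Longrightarrow> (\<lambda>n. tau (M n) n (ev n w)) \<longlonglongrightarrow> \<phi> (NC_Word w)"
  unfolding ev_def by (rule limit)

lemma tau_cong:
  assumes "\<And>\<omega>. \<omega> \<in> space N \<Longrightarrow> mat_trace (A \<omega>) = mat_trace (A' \<omega>)"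
  shows "tau N n A = tau N n A'"
  unfolding tau_def by (intro arg_cong2[where f = times] refl Bochner_Integration.integral_cong assms)

lemma limit_unique:
  assumes w: "w \<in> lists S" and X: "(\<lambda>n. tau (M n) n (X n)) \<longlonglongrightarrow> L"
    and eq: "\<And>n \<omega>. \<omega> \<in> space (M n) \<Longrightarrow> mat_trace (ev n w \<omega>) = mat_trace (X n \<omega>)"
  shows "\<phi> (NC_Word w) = L"
proof -
  have "tau (M n) n (ev n w) = tau (M n) n (X n)" for n
    by (rule tau_cong) (rule eq)
  then show ?thesis using limit_ev[OF w] X LIMSEQ_unique by simp
qed

lemma limit_cong:
  assumes "v \<in> lists S" "w \<in> lists S"
    and "\<And>n \<omega>. \<omega> \<in> space (M n) \<Longrightarrow> mat_trace (ev n v \<omega>) = mat_trace (ev n w \<omega>)"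
  shows "\<phi> (NC_Word v) = \<phi> (NC_Word w)"
  using limit_unique[OF assms(1) limit_ev[OF assms(2)]] assms(3) by blast

lemma limit_trace:
  assumes "v \<in> lists S" "w \<in> lists S"
  shows "\<phi> (NC_Word (v @ w)) = \<phi> (NC_Word (w @ v))"
  using assms by (intro limit_cong) (auto simp: ev_append intro!: mat_trace_commute ev_carrier)

text \<open>Words with the same value as matrices may replace each other inside longer words.\<close>

definition equivalent :: "'i list \<Rightarrow> 'i list \<Rightarrow> bool" where
  "equivalent v w \<longleftrightarrow> v \<in> lists S \<and> w \<in> lists S \<and> (\<forall>n. \<forall>\<omega>\<in>space (M n). ev n v \<omega> = ev n w \<omega>)"

lemma equivalent_refl: "w \<in> lists S \<Longrightarrow> equivalent w w"
  by (simp add: equivalent_def)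

lemma equivalent_trans: "equivalent u v \<Longrightarrow> equivalent v w \<Longrightarrow> equivalent u w"
  by (simp add: equivalent_def)

lemma equivalent_append:
  assumes "equivalent v v'" "equivalent w w'"
  shows "equivalent (v @ w) (v' @ w')"
  using assms unfolding equivalent_def by (simp add: ev_append)

end

theorem theorem5p1:
  fixes p :: nat
    and N :: "nat \<Rightarrow> nat \<Rightarrow> nat"
    and d :: "nat \<Rightarrow> real"
    and M :: "nat \<Rightarrow> 'w measure"
    and U :: "'u set"
    and Y :: "nat \<Rightarrow> 'u \<Rightarrow> 'w \<Rightarrow> complex mat"
    and u :: "nat \<Rightarrow> 'u"
    and \<nu> :: "nat \<Rightarrow> distr"
    and r :: "nat \<Rightarrow> nat \<Rightarrow> complex"
  defines "D \<equiv> \<lambda>n. block_proj n (N n)"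
  defines "B \<equiv> \<lambda>n \<omega>. mat_prod_list n
             (map (\<lambda>l. D n l * Y n (u l) \<omega> * D n (l + 1)) [1..<p + 1])"
  defines "\<nu>t \<equiv> \<lambda>l. distr_of_cumulants (\<lambda>k. r l (2 * k))"
  defines "t \<equiv> \<lambda>k. fps_nth (T_transform (foldl free_mult_conv (\<nu>t 1) (map \<nu>t [2..<p + 1]))) k"
  assumes p: "p \<ge> 1"
    and N_sum: "\<And>n. (\<Sum>j\<in>{1..p + 1}. N n j) = n"
    and d_lim: "\<And>j. j \<in> {1..p + 1} \<Longrightarrow> (\<lambda>n. real (N n j) / real n) \<longlonglongrightarrow> d j"
    and d_pos: "\<And>j. j \<in> {1..p + 1} \<Longrightarrow> d j > 0"
    and prob: "\<And>n. prob_space (M n)"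
    and random: "\<And>n v. v \<in> U \<Longrightarrow> random_matrix (M n) n (Y n v)"
    and herm: "\<And>n v \<omega>. v \<in> U \<Longrightarrow> \<omega> \<in> space (M n) \<Longrightarrow> mat_adjoint (Y n v \<omega>) = Y n v \<omega>"
    and indep: "\<And>n. indep_matrices (M n) n (Y n) U"
    and A1: "asymptotically_free M Y U (\<lambda>v. {v})"
    and A2: "asymptotically_free M (\<lambda>n. case_sum (Y n) (\<lambda>j \<omega>. D n j)) UNIV
               (\<lambda>b. if b then Inl ` U else Inr ` {1..p + 1})"
    and A3: "\<exists>C. \<forall>n. \<forall>v\<in>U. AE \<omega> in M n. op_norm (Y n v \<omega>) \<le> C"
    and u_mem: "u ` {1..p} \<subseteq> U"
    and u_inj: "inj_on u {1..p}"
    and limit_distr: "\<And>l k. l \<in> {1..p} \<Longrightarrow> (\<lambda>n. tau (M n) n (\<lambda>\<omega>. Y n (u l) \<omega> ^\<^sub>m k)) \<longlonglongrightarrow> \<nu> l k"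
    and cumulants: "\<And>l. l \<in> {1..p} \<Longrightarrow> has_free_cumulants (\<nu> l) (r l)"
    and r2: "\<And>l. l \<in> {1..p} \<Longrightarrow> r l 2 \<noteq> 0"
  shows "\<forall>k\<ge>1. (\<lambda>n. partial_tau (M n) (N n 1) (D n 1) (\<lambda>\<omega>. (B n \<omega> * mat_adjoint (B n \<omega>)) ^\<^sub>m k))
           \<longlonglongrightarrow> of_real (1 / d 1) * (\<Sum>s = 1..k. of_real (fuss_narayana p k s d) * T_coeff k s t)"
proof -
  let ?I = "{1..p + 1}"
  let ?S = "Inl ` U \<union> Inr ` ?I :: ('u + nat) set"
  define Z where "Z = (\<lambda>n. case_sum (Y n) (\<lambda>j \<omega>. D n j))"
  have Z_simps: "Z n (Inl v) = Y n v" "Z n (Inr j) = (\<lambda>\<omega>. D n j)" for n v j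
    by (simp_all add: Z_def)
  obtain \<phi> where lim: "\<And>w. w \<in> lists ?S \<Longrightarrow>
        (\<lambda>n. tau (M n) n (\<lambda>\<omega>. mat_prod_list n (map (\<lambda>i. Z n i \<omega>) w))) \<longlonglongrightarrow> \<phi> (NC_Word w)"
    and free2: "free_family (lin_ext \<phi>) UNIV (\<lambda>b. nc_subalg (if b then Inl ` U else Inr ` ?I))"
  proof -
    have union: "(\<Union>b. if b then Inl ` U else Inr ` ?I) = ?S" by (auto simp: UNIV_bool)
    from A2 obtain \<phi> where "\<forall>w\<in>lists (\<Union>b. if b then Inl ` U else Inr ` ?I).
        (\<lambda>n. tau (M n) n (\<lambda>\<omega>. mat_prod_list n (map (\<lambda>i. Z n i \<omega>) w))) \<longlonglongrightarrow> \<phi> (NC_Word w)"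
      and "free_family (lin_ext \<phi>) UNIV (\<lambda>b. nc_subalg (if b then Inl ` U else Inr ` ?I))"
      unfolding asymptotically_free_def Z_def by (elim exE conjE)
    then show ?thesis
      by (intro that[of \<phi>]) (simp_all only: union)
  qed
  have u_U: "u l \<in> U" if "l \<in> {1..p}" for l
    using u_mem that by blast
  have D_carrier: "D n j \<in> carrier_mat n n" for n j by (simp add: D_def)
  have Y_carrier: "Y n v \<omega> \<in> carrier_mat n n" if "v \<in> U" "\<omega> \<in> space (M n)" for n v \<omega>
    using random[OF that(1)] that(2) by (simp add: random_matrix_def)
  interpret limit_state M Z ?S \<phi>
    by unfold_locales (use D_carrier Y_carrier lim in \<open>auto simp: Z_simps\<close>)
  have selfadjoint: "mat_adjoint (Z n i \<omega>) = Z n i \<omega>" if "i \<in> ?S" "\<omega> \<in> space (M n)" for n i \<omega>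
    using that herm by (auto simp: Z_simps D_def block_proj_adjoint)
  have const: "tau (M n) n (\<lambda>\<omega>. A) = mat_trace A / of_nat n" for n A
    using prob_space.prob_space[OF prob, of n] by (simp add: tau_def)
  have unit: "\<phi> 0 = 1"
  proof -
    have "(\<lambda>n. tau (M n) n (\<lambda>\<omega>. 1\<^sub>m n)) \<longlonglongrightarrow> 1"
      by (rule tendsto_eventually, rule eventually_sequentiallyI[of 1]) (simp add: const mat_trace_def)
    then show ?thesis
      using limit_unique[of "[]"] by (simp add: ev_def NC_Word_Nil)
  qed
  have trace_D: "\<phi> (NC_Word [Inr l]) = of_real (d l)" if l: "l \<in> ?I" for l
  proof (rule limit_unique)
    show "[Inr l] \<in> lists ?S" using l by simp
    show "(\<lambda>n. tau (M n) n (\<lambda>\<omega>. D n l)) \<longlonglongrightarrow> of_real (d l)"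
    proof -
      have "mat_trace (D n l) = of_nat (N n l)" for n
      proof -
        have "(\<Sum>i\<in>{1..l}. N n i) \<le> (\<Sum>i\<in>?I. N n i)"
          using l by (intro sum_mono2) auto
        then show ?thesis
          unfolding D_def using l N_sum by (intro block_proj_trace) auto
      qed
      then have "tau (M n) n (\<lambda>\<omega>. D n l) = of_real (real (N n l) / real n)" for n
        by (simp add: const)
      moreover have "(\<lambda>n. complex_of_real (real (N n l) / real n)) \<longlonglongrightarrow> of_real (d l)"
        by (rule tendsto_of_real[OF d_lim[OF l]])
      ultimately show ?thesis by (simp only:)
    qed
    show "mat_trace (ev n [Inr l] \<omega>) = mat_trace (D n l)" for n \<omega>
      using D_carrier[of n l] by (simp add: ev_def Z_simps right_mult_one_mat[of _ n n])
  qed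
  have moments: "\<phi> (NC_Word (replicate k (Inl (u l)))) = \<nu> l k" if l: "l \<in> {1..p}" for l k
  proof (rule limit_unique[OF _ limit_distr[OF l]])
    have ul: "u l \<in> U" by (rule u_U[OF l])
    then show "replicate k (Inl (u l)) \<in> lists ?S" by auto
    show "mat_trace (ev n (replicate k (Inl (u l))) \<omega>) = mat_trace (Y n (u l) \<omega> ^\<^sub>m k)"
      if "\<omega> \<in> space (M n)" for n \<omega>
      using Y_carrier[OF ul that] by (simp add: ev_def Z_simps mat_prod_list_replicate)
  qed
  \<comment> \<open>The index \<open>None\<close> collects the diagonal matrices, and every \<open>Y(v)\<close> has its own index.\<close>
  define J where "J = insert None (Some ` U)"
  define A where "A = case_option (Inr ` ?I) (\<lambda>v. {Inl v} :: ('u + nat) set)"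
  have A_simps: "A None = Inr ` ?I" "A (Some v) = {Inl v}" for v
    by (simp_all add: A_def)
  have A_union: "(\<Union>j\<in>J. A j) = ?S"
    by (auto simp: J_def A_simps)
  have free1: "free_family (lin_ext \<phi>) U (\<lambda>v. nc_subalg {Inl v})"
  proof -
    have union: "(\<Union>v\<in>U. {v}) = U" by blast
    from A1 obtain \<phi>1 where "\<forall>w\<in>lists (\<Union>v\<in>U. {v}).
        (\<lambda>n. tau (M n) n (\<lambda>\<omega>. mat_prod_list n (map (\<lambda>i. Y n i \<omega>) w))) \<longlonglongrightarrow> \<phi>1 (NC_Word w)"
      and free: "free_family (lin_ext \<phi>1) U (\<lambda>v. nc_subalg {v})"
      unfolding asymptotically_free_def by (elim exE conjE)
    then have lim1: "(\<lambda>n. tau (M n) n (\<lambda>\<omega>. mat_prod_list n (map (\<lambda>i. Y n i \<omega>) w))) \<longlonglongrightarrow> \<phi>1 (NC_Word w)"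
      if "w \<in> lists U" for w
      using that unfolding union by simp
    show ?thesis
    proof (rule free_family_pullback[where f = projl and \<phi>' = \<phi>1])
      show "free_family (lin_ext \<phi>1) U (\<lambda>j. nc_subalg (projl ` {Inl j}))" using free by simp
      fix w :: "('u + nat) list" assume w: "w \<in> lists (\<Union>v\<in>U. {Inl v})"
      then have wU: "map projl w \<in> lists U" and wS: "w \<in> lists ?S" by (fastforce simp: in_lists_conv_set)+
      have Zw: "map (\<lambda>i. Z n i \<omega>) w = map (\<lambda>i. Y n i \<omega>) (map projl w)" for n \<omega>
        using w by (auto simp: Z_simps)
      show "\<phi> (NC_Word w) = \<phi>1 (NC_Word (map projl w))"
        by (rule limit_unique[OF wS lim1[OF wU]]) (simp only: ev_def Zw)
    qed
  qed
  have free: "free_family (lin_ext \<phi>) J (\<lambda>j. nc_subalg (A j))"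
  proof (rule free_family_refine[OF free2, where \<pi> = "\<lambda>j. j \<noteq> None"])
    fix k :: bool
    show "free_family (lin_ext \<phi>) {j \<in> J. (j \<noteq> None) = k} (\<lambda>j. nc_subalg (A j))"
    proof (cases k)
      case True
      then have "{j \<in> J. (j \<noteq> None) = k} = Some ` U" by (auto simp: J_def)
      moreover have "free_family (lin_ext \<phi>) (Some ` U) (\<lambda>j. nc_subalg (A j))"
        by (rule free_family_reindex[OF free1, where g = the]) (auto simp: A_simps inj_on_def)
      ultimately show ?thesis by simp
    next
      case False
      then have "{j \<in> J. (j \<noteq> None) = k} = {None}" by (auto simp: J_def)
      then show ?thesis using free_family_singleton by metis
    qed
  qed (auto simp: J_def A_simps)
  let ?L = "(\<lambda>l. Inl (u l)) ` {1..p} \<union> Inr ` ?I :: ('u + nat) set"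
  have LS: "w \<in> lists ?S" if "w \<in> lists ?L" for w
  proof -
    have "?L \<subseteq> ?S" using u_mem by auto
    then show ?thesis using that lists_mono by blast
  qed
  have DD: "ev n (Inr l # Inr m # w) \<omega> = (D n l * D n m) * ev n w \<omega>"
    if "w \<in> lists ?S" "\<omega> \<in> space (M n)" for n l m w \<omega>
    unfolding ev_Cons Z_simps
    by (rule assoc_mult_mat[OF D_carrier D_carrier ev_carrier[OF that], symmetric])
  have D_idem: "D n l * D n l = D n l" for n l by (simp add: D_def block_proj_idem)
  interpret exc: excursion_model p \<phi> "\<lambda>l. Inl (u l)" "Inr :: nat \<Rightarrow> 'u + nat" r
  proof
    show "1 \<le> p" by (rule p)
    fix v w assume "v \<in> lists ?L" "w \<in> lists ?L"
    then show "\<phi> (NC_Word (v @ w)) = \<phi> (NC_Word (w @ v))"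
      by (intro limit_trace LS)
  next
    fix l w assume l: "l \<in> ?I" and w: "w \<in> lists ?L"
    show "\<phi> (NC_Word (Inr l # Inr l # w)) = \<phi> (NC_Word (Inr l # w))"
    proof (rule limit_cong)
      show "mat_trace (ev n (Inr l # Inr l # w) \<omega>) = mat_trace (ev n (Inr l # w) \<omega>)"
        if "\<omega> \<in> space (M n)" for n \<omega>
        by (simp only: DD[OF LS[OF w] that] D_idem) (simp add: ev_Cons Z_simps)
    qed (use l LS[OF w] in auto)
  next
    fix l m w assume lm: "l \<in> ?I" "m \<in> ?I" "l \<noteq> m" and w: "w \<in> lists ?L"
    show "\<phi> (NC_Word (Inr l # Inr m # w)) = 0"
    proof (rule limit_unique)
      show "(\<lambda>n. tau (M n) n (\<lambda>\<omega>. 0\<^sub>m n n)) \<longlonglongrightarrow> 0"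
        by (simp add: const mat_trace_def)
      show "mat_trace (ev n (Inr l # Inr m # w) \<omega>) = mat_trace (0\<^sub>m n n)" if "\<omega> \<in> space (M n)" for n \<omega>
        using block_proj_orth[of l m n "N n"] lm left_mult_zero_mat[OF ev_carrier[OF LS[OF w] that], of n]
        by (simp add: DD[OF LS[OF w] that] D_def)
    qed (use lm LS[OF w] in auto)
  next
    fix l w assume l: "l \<in> {1..p}" and w: "w \<in> lists ?L"
    have ul: "u l \<in> U" by (rule u_U[OF l])
    have "free_variable \<phi> J A (Some (u l)) (Inl (u l)) (r l)"
    proof
      show "cumulant_relation (\<lambda>k. \<phi> (NC_Word (replicate k (Inl (u l))))) (r l)"
        using cumulants[OF l] cumulant_relation_distr_of_cumulants[of "r l"]
        by (simp add: moments[OF l] has_free_cumulants_def)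
    qed (use unit free ul in \<open>auto simp: J_def A_simps\<close>)
    then show "\<phi> (NC_Word (Inl (u l) # w)) = block_sum (r l) \<phi> (Inl (u l)) 1 [] w"
      by (rule free_variable.schwinger_dyson) (unfold A_union, rule LS[OF w])
  next
    show "inj_on (\<lambda>l. Inl (u l) :: 'u + nat) {1..p}"
      by (rule inj_onI, rule inj_onD[OF u_inj]) simp_all
    show "inj (Inr :: nat \<Rightarrow> 'u + nat)" by simp
    show "Inl (u l) \<noteq> (Inr m :: 'u + nat)" for l m by simp
    show "\<phi> (NC_Word [Inr l]) \<noteq> 0" if "l \<in> ?I" for l
      using trace_D[OF that] d_pos[OF that] by simp
    show "r l 2 \<noteq> 0" if "l \<in> {1..p}" for l by (rule r2[OF that])
  qed
  \<comment> \<open>The word of \<open>X\<^sub>l \<dots> X\<^sub>p\<close>. It visits every inner vertex twice in a row, in contrast to \<open>up_walk\<close>.\<close>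
  define wB where "wB l = concat (map (\<lambda>l. [Inr l, Inl (u l), Inr (l + 1)]) [l..<p + 1])" for l
  have wB_lists: "wB l \<in> lists ?S" if "1 \<le> l" for l
  proof -
    have "u i \<in> U" if "1 \<le> i" "i \<le> p" for i using that by (intro u_U) simp
    then show ?thesis using that by (auto simp: wB_def in_lists_conv_set intro!: imageI)
  qed
  have double: "equivalent [Inr l, Inr l] [Inr l]" if "l \<in> ?I" for l
    unfolding equivalent_def
  proof (intro conjI allI ballI)
    fix n \<omega> assume "\<omega> \<in> space (M n)"
    then show "ev n [Inr l, Inr l] \<omega> = ev n [Inr l] \<omega>"
      using DD[of "[]" \<omega> n l l] by (simp add: D_idem ev_Cons Z_simps)
  qed (use that in auto)
  have eq_Up: "equivalent ([Inr l] @ (wB l @ rev (wB l)) @ [Inr l]) (exc.up_walk l)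
      \<and> (l \<le> p \<longrightarrow> equivalent (wB l @ rev (wB l)) (exc.up_walk l))" if "l \<in> ?I" for l
    using that
  proof (induction "p + 1 - l" arbitrary: l)
    case 0
    then have "l = p + 1" by auto
    then show ?case using double[of l] 0 exc.up_walk_top by (simp add: wB_def)
  next
    case (Suc n)
    then have l: "l \<in> {1..p}" "l + 1 \<in> ?I" "l \<in> ?I" by auto
    have lists: "[Inr l, Inl (u l)] \<in> lists ?S" "[Inl (u l), Inr l] \<in> lists ?S" "exc.up_loop l \<in> lists ?S"
      using l u_U[OF l(1)] LS[OF exc.up_loop_lists[OF l(1)]] by simp_all
    have "[l..<p + 1] = l # [l + 1..<p + 1]"
      using l by (simp add: upt_conv_Cons del: upt_Suc)
    then have "wB l = [Inr l, Inl (u l), Inr (l + 1)] @ wB (l + 1)"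
      by (simp only: wB_def list.map concat.simps)
    then have split: "wB l @ rev (wB l)
        = [Inr l, Inl (u l)] @ ([Inr (l + 1)] @ (wB (l + 1) @ rev (wB (l + 1))) @ [Inr (l + 1)]) @ [Inl (u l), Inr l]"
      by simp
    have "equivalent ([Inr (l + 1)] @ (wB (l + 1) @ rev (wB (l + 1))) @ [Inr (l + 1)]) (exc.up_walk (l + 1))"
      using Suc.hyps(1)[of "l + 1"] Suc.hyps(2) l(2) by auto
    then have "equivalent (wB l @ rev (wB l)) ([Inr l, Inl (u l)] @ exc.up_walk (l + 1) @ [Inl (u l), Inr l])"
      unfolding split by (intro equivalent_append equivalent_refl lists)
    also have "[Inr l, Inl (u l)] @ exc.up_walk (l + 1) @ [Inl (u l), Inr l] = exc.up_walk l"
      using exc.up_walk_step[OF l(1)] by (simp add: exc.up_loop_def)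
    finally have 1: "equivalent (wB l @ rev (wB l)) (exc.up_walk l)" .
    have "equivalent ([Inr l] @ (wB l @ rev (wB l)) @ [Inr l]) ([Inr l] @ exc.up_walk l @ [Inr l])"
      using l by (intro equivalent_append equivalent_refl 1) auto
    moreover have "equivalent ([Inr l, Inr l] @ exc.up_loop l @ [Inr l, Inr l]) ([Inr l] @ exc.up_loop l @ [Inr l])"
      by (intro equivalent_append equivalent_refl double lists l)
    then have "equivalent ([Inr l] @ exc.up_walk l @ [Inr l]) (exc.up_walk l)"
      using exc.up_walk_step[OF l(1)] by simp
    ultimately have "equivalent ([Inr l] @ (wB l @ rev (wB l)) @ [Inr l]) (exc.up_walk l)"
      by (rule equivalent_trans)
    then show ?case using 1 by simp
  qed
  have 1: "1 \<in> {1..p}" "1 \<in> ?I" "1 \<le> p" using p by auto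
  let ?W = "\<lambda>k. Inr 1 # concat (replicate k (exc.up_loop 1 @ [Inr 1]))"
  have eq_W: "equivalent ([Inr 1] @ concat (replicate k (wB 1 @ rev (wB 1)))) (?W k)" for k
  proof (induction k)
    case 0
    then show ?case using equivalent_refl[of "[Inr 1]"] 1 by simp
  next
    case (Suc k)
    have lists: "concat (replicate k ([Inr 1] @ exc.up_loop 1)) \<in> lists ?S" "exc.up_loop 1 @ [Inr 1] \<in> lists ?S"
      using LS[OF exc.up_loop_lists[OF 1(1)]] 1 by (auto intro!: exc.lists_concat_replicate)
    have W: "?W k = concat (replicate k ([Inr 1] @ exc.up_loop 1)) @ [Inr 1]" for k
      using concat_replicate_rotate[of "[Inr 1]" k "exc.up_loop 1"] by simp
    have "equivalent (([Inr 1] @ concat (replicate k (wB 1 @ rev (wB 1)))) @ (wB 1 @ rev (wB 1))) (?W k @ exc.up_walk 1)"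
      using eq_Up[OF 1(2)] 1(3) by (intro equivalent_append Suc.IH) simp
    also have "?W k @ exc.up_walk 1 = concat (replicate k ([Inr 1] @ exc.up_loop 1)) @ [Inr 1, Inr 1] @ exc.up_loop 1 @ [Inr 1]"
      unfolding W using exc.up_walk_step[OF 1(1)] by simp
    finally have "equivalent (([Inr 1] @ concat (replicate k (wB 1 @ rev (wB 1)))) @ (wB 1 @ rev (wB 1)))
        (concat (replicate k ([Inr 1] @ exc.up_loop 1)) @ [Inr 1, Inr 1] @ exc.up_loop 1 @ [Inr 1])" .
    moreover have "equivalent (concat (replicate k ([Inr 1] @ exc.up_loop 1)) @ [Inr 1, Inr 1] @ exc.up_loop 1 @ [Inr 1])
        (concat (replicate k ([Inr 1] @ exc.up_loop 1)) @ [Inr 1] @ exc.up_loop 1 @ [Inr 1])"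
      by (intro equivalent_append equivalent_refl double lists 1)
    ultimately have "equivalent (([Inr 1] @ concat (replicate k (wB 1 @ rev (wB 1)))) @ (wB 1 @ rev (wB 1)))
        (concat (replicate k ([Inr 1] @ exc.up_loop 1)) @ [Inr 1] @ exc.up_loop 1 @ [Inr 1])"
      by (rule equivalent_trans)
    also have "([Inr 1] @ concat (replicate k (wB 1 @ rev (wB 1)))) @ (wB 1 @ rev (wB 1))
        = [Inr 1] @ concat (replicate (Suc k) (wB 1 @ rev (wB 1)))"
      by (simp only: concat_replicate_Suc append_assoc)
    also have "concat (replicate k ([Inr 1] @ exc.up_loop 1)) @ [Inr 1] @ exc.up_loop 1 @ [Inr 1] = ?W (Suc k)"
      unfolding W by (simp only: concat_replicate_Suc append_assoc)
    finally show ?case .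
  qed
  have B_ev: "B n \<omega> = ev n (wB 1) \<omega>" if \<omega>: "\<omega> \<in> space (M n)" for n \<omega>
  proof -
    let ?Ls = "map (\<lambda>l. [D n l, Y n (u l) \<omega>, D n (l + 1)]) [1..<p + 1]"
    have cY: "Y n (u l) \<omega> \<in> carrier_mat n n" if "l \<in> {1..p}" for l
      by (rule Y_carrier[OF u_U[OF that] \<omega>])
    have "D n l * Y n (u l) \<omega> * D n (l + 1) = mat_prod_list n [D n l, Y n (u l) \<omega>, D n (l + 1)]"
      if "l \<in> {1..p}" for l
      using assoc_mult_mat[OF D_carrier[of n l] cY[OF that] D_carrier[of n "l + 1"]]
        right_mult_one_mat[OF D_carrier[of n "l + 1"]] by simp
    then have "B n \<omega> = mat_prod_list n (map (mat_prod_list n) ?Ls)"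
      unfolding B_def by (intro arg_cong[where f = "mat_prod_list n"]) auto
    also have "\<dots> = mat_prod_list n (concat ?Ls)"
      by (rule mat_prod_list_concat) (use D_carrier cY in auto)
    also have "concat ?Ls = map (\<lambda>i. Z n i \<omega>) (wB 1)"
      by (simp add: wB_def map_concat comp_def Z_simps)
    finally show ?thesis by (simp add: ev_def)
  qed
  have word: "mat_trace (D n 1 * (B n \<omega> * mat_adjoint (B n \<omega>)) ^\<^sub>m k) = mat_trace (ev n (?W k) \<omega>)"
    if \<omega>: "\<omega> \<in> space (M n)" for n \<omega> k
  proof -
    let ?v = "wB 1 @ rev (wB 1)"
    have lists: "wB 1 \<in> lists ?S" "rev (wB 1) \<in> lists ?S" using wB_lists[of 1] by auto
    have "mat_adjoint (B n \<omega>) = ev n (rev (wB 1)) \<omega>"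
      unfolding B_ev[OF \<omega>] ev_def rev_map[symmetric]
      by (rule mat_adjoint_prod_list) (use lists carrier[OF _ \<omega>] selfadjoint[OF _ \<omega>] in auto)
    then have BB: "B n \<omega> * mat_adjoint (B n \<omega>) = ev n ?v \<omega>"
      using B_ev[OF \<omega>] ev_append[OF lists \<omega>] by simp
    have cv: "ev n ?v \<omega> \<in> carrier_mat n n" using lists by (intro ev_carrier \<omega>) auto
    have "ev n ?v \<omega> ^\<^sub>m k = ev n (concat (replicate k ?v)) \<omega>"
    proof -
      have "ev n ?v \<omega> ^\<^sub>m k = mat_prod_list n (map (mat_prod_list n) (replicate k (map (\<lambda>i. Z n i \<omega>) ?v)))"
        using mat_prod_list_replicate[OF cv, of k] unfolding ev_def by (simp only: map_replicate)
      also have "\<dots> = mat_prod_list n (concat (replicate k (map (\<lambda>i. Z n i \<omega>) ?v)))"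
        by (rule mat_prod_list_concat) (use map_carrier[OF _ \<omega>, of ?v] lists in \<open>auto split: if_splits\<close>)
      finally show ?thesis by (simp only: ev_def map_concat map_replicate)
    qed
    then have "D n 1 * (B n \<omega> * mat_adjoint (B n \<omega>)) ^\<^sub>m k = ev n ([Inr 1] @ concat (replicate k ?v)) \<omega>"
      unfolding BB by (simp add: ev_Cons Z_simps)
    also have "\<dots> = ev n (?W k) \<omega>"
      using eq_W[of k] \<omega> by (simp only: equivalent_def)
    finally show ?thesis by simp
  qed
  show ?thesis
  proof (intro allI impI)
    fix k :: nat assume k: "1 \<le> k"
    have W_lists: "?W k \<in> lists ?S" using eq_W[of k] by (simp only: equivalent_def)
    have lim_value: "\<phi> (NC_Word (?W k)) = (\<Sum>s = 1..k. of_real (fuss_narayana p k s d) * T_coeff k s t)"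
      unfolding t_def \<nu>t_def by (rule exc.moments_formula[OF trace_D d_pos k])
    \<comment> \<open>The normalization of \<open>\<tau>\<^sub>1\<close> instead of \<open>\<tau>\<close> accounts for the factor \<open>1 / d\<^sub>1\<close>.\<close>
    have "(\<lambda>n. inverse (real (N n 1) / real n)) \<longlonglongrightarrow> inverse (d 1)"
      using d_lim[OF 1(2)] d_pos[OF 1(2)] by (intro tendsto_inverse) auto
    then have "(\<lambda>n. complex_of_real (inverse (real (N n 1) / real n))) \<longlonglongrightarrow> of_real (1 / d 1)"
      by (simp only: tendsto_of_real inverse_eq_divide)
    then have "(\<lambda>n. complex_of_real (inverse (real (N n 1) / real n)) * tau (M n) n (ev n (?W k)))
        \<longlonglongrightarrow> of_real (1 / d 1) * (\<Sum>s = 1..k. of_real (fuss_narayana p k s d) * T_coeff k s t)"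
      unfolding lim_value[symmetric] by (intro tendsto_mult limit_ev W_lists)
    moreover have "eventually (\<lambda>n. complex_of_real (inverse (real (N n 1) / real n)) * tau (M n) n (ev n (?W k))
        = partial_tau (M n) (N n 1) (D n 1) (\<lambda>\<omega>. (B n \<omega> * mat_adjoint (B n \<omega>)) ^\<^sub>m k)) sequentially"
    proof (rule eventually_sequentiallyI[of 1])
      fix n :: nat assume "1 \<le> n"
      have "(\<integral>\<omega>. mat_trace (D n 1 * (B n \<omega> * mat_adjoint (B n \<omega>)) ^\<^sub>m k) \<partial>M n)
          = (\<integral>\<omega>. mat_trace (ev n (?W k) \<omega>) \<partial>M n)"
        by (rule Bochner_Integration.integral_cong[OF refl word])
      then show "complex_of_real (inverse (real (N n 1) / real n)) * tau (M n) n (ev n (?W k))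
        = partial_tau (M n) (N n 1) (D n 1) (\<lambda>\<omega>. (B n \<omega> * mat_adjoint (B n \<omega>)) ^\<^sub>m k)"
        using \<open>1 \<le> n\<close> by (simp add: partial_tau_def tau_def)
    qed
    ultimately show "(\<lambda>n. partial_tau (M n) (N n 1) (D n 1) (\<lambda>\<omega>. (B n \<omega> * mat_adjoint (B n \<omega>)) ^\<^sub>m k))
        \<longlonglongrightarrow> of_real (1 / d 1) * (\<Sum>s = 1..k. of_real (fuss_narayana p k s d) * T_coeff k s t)"
      by (rule Lim_transform_eventually)
  qed
qed

end
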